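(* Let $K$ be a field of characteristic $0$, let $\varepsilon\in K^\times$ be not a root of unity, let $n\ge 2$ and $r\ge1$. Let $H=\mathcal H_{\vartriangle}(r)_K$ be the extended affine Hecke algebra of type $A$ with Hecke parameter $\varepsilon$ and let $S=\mathcal S_{\vartriangle}(n,r)_K=\operatorname{End}_{H}\bigl(\bigoplus_{\lambda\in\Lambda_{\vartriangle}(n,r)}x_\lambda H\bigr)$ be the affine quantum Schur algebra. Then the natural algebra homomorphism $$\xi_r: H\longrightarrow \operatorname{End}_{S}\Bigl(\bigoplus_{\lambda\in\Lambda_{\vartriangle}(n,r)}x_\lambda H\Bigr)^{\mathrm{op}},\qquad \xi_r(h)(t)=th,$$ is an algebra isomorphism.
   Context: Put $q=\varepsilon^2$. $H=\mathcal H_{\vartriangle}(r)_K$ is the $K$-algebra given by the Bernstein presentation: generators $T_1,\dots,T_{r-1}$, $X_1^{\pm1},\dots,X_r^{\pm1}$ and relations $(T_i+1)(T_i-q)=0$; $T_iT_j=T_jT_i$ for $|i-j|>1$; $T_iT_{i+1}T_i=T_{i+1}T_iT_{i+1}$; $X_iX_i^{-1}=1=X_i^{-1}X_i$; $X_iX_j=X_jX_i$; $T_iX_iT_i=qX_{i+1}$; $X_jT_i=T_iX_j$ for $j\ne i,i+1$. For $w\in\mathfrak S_r$ with reduced expression $w=s_{i_1}\cdots s_{i_m}$ put $T_w=T_{i_1}\cdots T_{i_m}$. $\Lambda_{\vartriangle}(n,r)$ is identified with the set of tuples $(\lambda_1,\dots,\lambda_n)$ of nonnegative integers with sum $r$;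 $\mathfrak S_\lambda\subseteq\mathfrak S_r$ is the standard Young subgroup and $x_\lambda=\sum_{w\in\mathfrak S_\lambda}T_w$. The right $H$-module $\bigoplus_\lambda x_\lambda H$ is isomorphic to the affine tensor space $\Omega_K^{\otimes r}$; it is a left $S$-module by evaluation, and the actions of $S$ and $H$ commute. (In the paper $S$ is defined as $\mathcal S_{\vartriangle}(n,r)_{\mathbb Z[v,v^{-1}]}\otimes K$ with $v\mapsto\varepsilon$, which is canonically identified with $\operatorname{End}_{H}\bigl(\bigoplus_{\lambda\in\Lambda_{\vartriangle}(n,r)}x_\lambda H\bigr)$.) *)

theory Defs
  imports
    "HOL-Algebra.Algebra"
    "HOL-Combinatorics.Permutations"
    "HOL-Library.Poly_Mapping"
begin

section \<open>Free associative algebras\<close>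

text \<open>
  Words under concatenation, with the monoid operation written additively, so that
  \<open>'g free_monoid \<Rightarrow>\<^sub>0 'k\<close> with the convolution product of \<open>Poly_Mapping\<close> is the free
  associative unital \<open>'k\<close>-algebra on \<open>'g\<close>.
\<close>

datatype 'g free_monoid = Word (letters: "'g list")

instantiation free_monoid :: (type) monoid_add
begin

definition zero_free_monoid :: "'a free_monoid"
  where "0 = Word []"

definition plus_free_monoid :: "'a free_monoid \<Rightarrow> 'a free_monoid \<Rightarrow> 'a free_monoid"
  where "u + v = Word (letters u @ letters v)"

instance
  by standard (simp_all add: zero_free_monoid_def plus_free_monoid_def)

end

type_synonym ('g, 'k) free_alg = "'g free_monoid \<Rightarrow>\<^sub>0 'k"

definition free_algebra :: "'g set \<Rightarrow> ('g, 'k::field) free_alg ring"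
  where "free_algebra G =
    \<lparr>carrier = {p. \<forall>w\<in>Poly_Mapping.keys p. set (letters w) \<subseteq> G},
     monoid.mult = (*), one = 1, ring.zero = 0, add = (+)\<rparr>"

definition var :: "'g \<Rightarrow> ('g, 'k::field) free_alg"
  where "var g = Poly_Mapping.single (Word [g]) 1"

definition const :: "'k::field \<Rightarrow> ('g, 'k) free_alg"
  where "const c = Poly_Mapping.single 0 c"

text \<open>
  The algebra with generators \<open>G\<close> and relators \<open>R\<close>. Constants are central in the free
  algebra, so the two-sided ring ideal generated by \<open>R\<close> is also the algebra ideal.
\<close>

definition presented_algebra ::
    "'g set \<Rightarrow> ('g, 'k::field) free_alg set \<Rightarrow> ('k, ('g, 'k) free_alg set) module"
  where "presented_algebra G R =
    (let F = free_algebra G; I = genideal F R; Q = F Quot I in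
     \<lparr>carrier = carrier Q, monoid.mult = monoid.mult Q, one = one Q, ring.zero = ring.zero Q, add = add Q,
      smult = (\<lambda>c x. (I +>\<^bsub>F\<^esub> const c) \<otimes>\<^bsub>Q\<^esub> x)\<rparr>)"

section \<open>The extended affine Hecke algebra (Bernstein presentation)\<close>

datatype hecke_gen = GenT nat | GenX nat | GenXinv nat

definition hecke_gens :: "nat \<Rightarrow> hecke_gen set"
  where "hecke_gens r = GenT ` {1..<r} \<union> GenX ` {1..r} \<union> GenXinv ` {1..r}"

abbreviation (input) tT :: "nat \<Rightarrow> (hecke_gen, 'k::field) free_alg"
  where "tT i \<equiv> var (GenT i)"
abbreviation (input) tX :: "nat \<Rightarrow> (hecke_gen, 'k::field) free_alg"
  where "tX i \<equiv> var (GenX i)"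
abbreviation (input) tY :: "nat \<Rightarrow> (hecke_gen, 'k::field) free_alg"
  where "tY i \<equiv> var (GenXinv i)"

definition hecke_rels :: "nat \<Rightarrow> 'k::field \<Rightarrow> (hecke_gen, 'k) free_alg set"
  where "hecke_rels r q =
      {(tT i + 1) * (tT i - const q) | i. i \<in> {1..<r}}
    \<union> {tT i * tT j - tT j * tT i | i j. i \<in> {1..<r} \<and> j \<in> {1..<r} \<and> (i + 1 < j \<or> j + 1 < i)}
    \<union> {tT i * tT (i + 1) * tT i - tT (i + 1) * tT i * tT (i + 1) | i. 1 \<le> i \<and> i + 1 < r}
    \<union> {tX i * tY i - 1 | i. i \<in> {1..r}}
    \<union> {tY i * tX i - 1 | i. i \<in> {1..r}}
    \<union> {tX i * tX j - tX j * tX i | i j. i \<in> {1..r} \<and> j \<in> {1..r}}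
    \<union> {tT i * tX i * tT i - const q * tX (i + 1) | i. i \<in> {1..<r}}
    \<union> {tX j * tT i - tT i * tX j | i j. i \<in> {1..<r} \<and> j \<in> {1..r} \<and> j \<noteq> i \<and> j \<noteq> i + 1}"

type_synonym 'k hecke = "(hecke_gen, 'k) free_alg set"

text \<open>The parameter \<open>q\<close> is the square of the Hecke parameter \<open>\<epsilon>\<close>.\<close>

definition affine_hecke :: "nat \<Rightarrow> 'k::field \<Rightarrow> ('k, 'k hecke) module"
  where "affine_hecke r q = presented_algebra (hecke_gens r) (hecke_rels r q)"

definition hecke_elt :: "nat \<Rightarrow> 'k::field \<Rightarrow> hecke_gen \<Rightarrow> 'k hecke"
  where "hecke_elt r q g =
    genideal (free_algebra (hecke_gens r)) (hecke_rels r q) +>\<^bsub>free_algebra (hecke_gens r)\<^esub> var g"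

definition perm_of_word :: "nat list \<Rightarrow> nat \<Rightarrow> nat"
  where "perm_of_word is = foldr (\<lambda>i w. Transposition.transpose i (i + 1) \<circ> w) is id"

definition reduced_expression :: "nat \<Rightarrow> (nat \<Rightarrow> nat) \<Rightarrow> nat list \<Rightarrow> bool"
  where "reduced_expression r w is \<longleftrightarrow>
    set is \<subseteq> {1..<r} \<and> perm_of_word is = w \<and>
    (\<forall>js. set js \<subseteq> {1..<r} \<and> perm_of_word js = w \<longrightarrow> length is \<le> length js)"

text \<open>By the braid relations \<open>T\<^sub>w\<close> does not depend on the reduced expression chosen.\<close>

definition hecke_T :: "nat \<Rightarrow> 'k::field \<Rightarrow> (nat \<Rightarrow> nat) \<Rightarrow> 'k hecke"
  where "hecke_T r q w =
    foldr (\<lambda>i h. hecke_elt r q (GenT i) \<otimes>\<^bsub>affine_hecke r q\<^esub> h)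
      (SOME is. reduced_expression r w is) \<one>\<^bsub>affine_hecke r q\<^esub>"

section \<open>Compositions, Young subgroups and the tensor space\<close>

definition compositions :: "nat \<Rightarrow> nat \<Rightarrow> nat list set"
  where "compositions n r = {l. length l = n \<and> sum_list l = r}"

text \<open>The \<open>i\<close>-th block (\<open>i\<close> counted from 0) of consecutive integers in \<open>{1..r}\<close> cut out by \<open>l\<close>.\<close>

definition block :: "nat list \<Rightarrow> nat \<Rightarrow> nat set"
  where "block l i = {sum_list (take i l) + 1 .. sum_list (take (Suc i) l)}"

definition young_subgroup :: "nat list \<Rightarrow> (nat \<Rightarrow> nat) set"
  where "young_subgroup l =
    {w. w permutes {1..sum_list l} \<and> (\<forall>i<length l. w ` block l i = block l i)}"

definition x_elt :: "nat \<Rightarrow> 'k::field \<Rightarrow> nat list \<Rightarrow> 'k hecke"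
  where "x_elt r q l = (\<Oplus>\<^bsub>affine_hecke r q\<^esub> w \<in> young_subgroup l. hecke_T r q w)"

text \<open>
  The right \<open>H\<close>-module \<open>\<Oplus>\<^sub>\<lambda> x\<^sub>\<lambda>H\<close>. Right multiplication is stored in the field \<open>smult\<close>,
  so \<open>h \<odot> t\<close> stands for \<open>th\<close>. In a module the fields \<open>mult\<close> and \<open>one\<close> play no role.
\<close>

definition tensor_space :: "nat \<Rightarrow> nat \<Rightarrow> 'k::field \<Rightarrow> ('k hecke, nat list \<Rightarrow> 'k hecke) module"
  where "tensor_space n r q =
    (let H = affine_hecke r q; L = compositions n r in
     \<lparr>carrier = (\<Pi>\<^sub>E l\<in>L. {x_elt r q l \<otimes>\<^bsub>H\<^esub> h | h. h \<in> carrier H}),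
      monoid.mult = undefined, one = undefined,
      ring.zero = (\<lambda>l\<in>L. \<zero>\<^bsub>H\<^esub>),
      add = (\<lambda>s t. \<lambda>l\<in>L. s l \<oplus>\<^bsub>H\<^esub> t l),
      smult = (\<lambda>h t. \<lambda>l\<in>L. t l \<otimes>\<^bsub>H\<^esub> h)\<rparr>)"

section \<open>Endomorphism algebras\<close>

text \<open>
  \<open>A\<close> is a \<open>'k\<close>-algebra and \<open>M\<close> an \<open>A\<close>-module, left or right: being \<open>A\<close>-linear means the
  same in both cases. Multiplication is composition, and \<open>c\<close> in \<open>'k\<close> acts on \<open>M\<close> through
  the element \<open>c \<odot> \<one>\<close> of \<open>A\<close>. Maps are extensional, i.e. \<open>undefined\<close> off the carrier of \<open>M\<close>.
\<close>

definition End_algebra ::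
    "('k, 'a, 'm) module_scheme \<Rightarrow> ('a, 'b, 'n) module_scheme \<Rightarrow> ('k, 'b \<Rightarrow> 'b) module"
  where "End_algebra A M =
    \<lparr>carrier = {f \<in> carrier M \<rightarrow>\<^sub>E carrier M.
        (\<forall>s\<in>carrier M. \<forall>t\<in>carrier M. f (s \<oplus>\<^bsub>M\<^esub> t) = f s \<oplus>\<^bsub>M\<^esub> f t) \<and>
        (\<forall>a\<in>carrier A. \<forall>t\<in>carrier M. f (a \<odot>\<^bsub>M\<^esub> t) = a \<odot>\<^bsub>M\<^esub> f t)},
     monoid.mult = (\<lambda>f g. compose (carrier M) f g),
     one = (\<lambda>t\<in>carrier M. t),
     ring.zero = (\<lambda>t\<in>carrier M. \<zero>\<^bsub>M\<^esub>),
     add = (\<lambda>f g. \<lambda>t\<in>carrier M. f t \<oplus>\<^bsub>M\<^esub> g t),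
     smult = (\<lambda>c f. \<lambda>t\<in>carrier M. (c \<odot>\<^bsub>A\<^esub> \<one>\<^bsub>A\<^esub>) \<odot>\<^bsub>M\<^esub> f t)\<rparr>"

definition evaluation_module :: "('a, 'b, 'n) module_scheme \<Rightarrow> ('b \<Rightarrow> 'b, 'b) module"
  where "evaluation_module M =
    \<lparr>carrier = carrier M, monoid.mult = undefined, one = undefined, ring.zero = \<zero>\<^bsub>M\<^esub>, add = add M,
     smult = (\<lambda>f t. f t)\<rparr>"

definition op_algebra :: "('k, 'a) module \<Rightarrow> ('k, 'a) module"
  where "op_algebra A = A\<lparr>monoid.mult := (\<lambda>x y. y \<otimes>\<^bsub>A\<^esub> x)\<rparr>"

definition algebra_iso ::
    "('k, 'a, 'm) module_scheme \<Rightarrow> ('k, 'b, 'n) module_scheme \<Rightarrow> ('a \<Rightarrow> 'b) set"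
  where "algebra_iso A B =
    {f \<in> ring_iso A B. \<forall>c. \<forall>x\<in>carrier A. f (c \<odot>\<^bsub>A\<^esub> x) = c \<odot>\<^bsub>B\<^esub> f x}"

section \<open>The affine quantum Schur algebra\<close>

definition affine_schur ::
    "nat \<Rightarrow> nat \<Rightarrow> 'k::field \<Rightarrow> ('k, (nat list \<Rightarrow> 'k hecke) \<Rightarrow> nat list \<Rightarrow> 'k hecke) module"
  where "affine_schur n r q = End_algebra (affine_hecke r q) (tensor_space n r q)"

definition xi ::
    "nat \<Rightarrow> nat \<Rightarrow> 'k::field \<Rightarrow> 'k hecke \<Rightarrow> (nat list \<Rightarrow> 'k hecke) \<Rightarrow> nat list \<Rightarrow> 'k hecke"
  where "xi n r q h = (\<lambda>t\<in>carrier (tensor_space n r q). h \<odot>\<^bsub>tensor_space n r q\<^esub> t)"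

end

theory Submission
  imports Defs "HOL-Computational_Algebra.Fraction_Field" "HOL-Combinatorics.Perm"
begin

text \<open>
  Write \<open>H\<close> for the affine Hecke algebra, \<open>q = \<epsilon>\<^sup>2\<close>, and \<open>A\<close> for the ring of Laurent polynomials in
  \<open>X\<^sub>1, \<dots>, X\<^sub>r\<close>. An endomorphism \<open>f\<close> of \<open>\<Oplus>\<^sub>\<lambda> x\<^sub>\<lambda>H\<close> that commutes with the Schur algebra preserves every
  summand, and it commutes with the left multiplications by \<open>x\<^sub>\<lambda>y\<close> from any \<open>x\<^sub>\<mu>H\<close> to \<open>x\<^sub>\<lambda>H\<close>. Put
  \<open>x = x\<^sub>\<mu>\<close> for \<open>\<mu> = (r - 1, 1, 0, \<dots>)\<close> and let \<open>J = HxH\<close>. For \<open>d = \<Sum> u\<^sub>ixv\<^sub>i\<close> in \<open>J\<close> the element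
  \<open>h\<^sub>d = \<Sum> u\<^sub>if(xv\<^sub>i)\<close> satisfies \<open>f(x\<^sub>\<lambda>yd) = x\<^sub>\<lambda>yh\<^sub>d\<close> for all \<open>\<lambda>\<close> and \<open>y\<close>. So \<open>f\<close> is known on \<open>x\<^sub>\<lambda>J\<close>, and
  the point is to find a single \<open>h\<close> with \<open>h\<^sub>d = dh\<close> for enough \<open>d\<close>.

  Enough means the following. For each \<open>k\<close> in \<open>{1..r}\<close> the ideal \<open>J\<close> contains a Laurent polynomial \<open>E\<^sub>k\<close>,
  a product of distinct factors \<open>qX\<^sub>j - X\<^sub>i\<close>, and no factor occurs in all of them (\<open>E_in_J\<close>). As
  \<open>q\<^sup>2 \<noteq> 1\<close>, these factors are pairwise non-associated primes of \<open>A\<close>. The elements \<open>h\<^sub>k\<close> belonging to \<open>E\<^sub>k\<close>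
  satisfy \<open>E\<^sub>lh\<^sub>k = E\<^sub>kh\<^sub>l\<close>, and \<open>H\<close> is free over \<open>A\<close> with basis the \<open>T\<^sub>w\<close>; comparing coefficients gives
  \<open>h\<^sub>k = E\<^sub>kh\<close> with a common \<open>h\<close> (\<open>division\<close>). The product \<open>\<Delta>\<close> of all factors \<open>qX\<^sub>j - X\<^sub>i\<close> is symmetric,
  hence central, and a multiple of \<open>E\<^sub>1\<close>; so \<open>f(z)\<Delta> = f(z\<Delta>) = zh\<Delta>\<close>, and \<open>\<Delta>\<close> can be cancelled
  (\<open>double_centraliser\<close>). Injectivity is easier: if \<open>xHw = 0\<close>, then \<open>Jw = 0\<close>, so \<open>E\<^sub>1w = 0\<close> and \<open>w = 0\<close>.

  That \<open>E\<^sub>r\<close> lies in \<open>J\<close> is an explicit computation: applying the commuting operators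
  \<open>y \<mapsto> yX\<^sub>m - X\<^sub>iy\<close> for all \<open>i < m\<close> to the symmetriser of \<open>\<SS>\<^sub>m\<close> removes all cosets of \<open>\<SS>\<^sub>m\<^sub>-\<^sub>1\<close> but the
  trivial one (\<open>\<Lambda>s_coset_sum\<close>). The other \<open>E\<^sub>k\<close> arise from \<open>E\<^sub>r\<close> by multiplying with intertwiners on both
  sides.

  Freeness of \<open>H\<close> over \<open>A\<close> comes from a representation by Demazure--Lusztig operators, in which the
  \<open>T\<^sub>u\<close> for normal words \<open>u\<close> are independent over \<open>A\<close> (\<open>opTw_independent\<close>). Since the relations also reduce
  every element to a combination of these, the representation is faithful (\<open>\<rho>_eq_0_iff\<close>). From
  there on \<open>H\<close> is treated as a ring of operators.
\<close>

section \<open>Linear extension\<close>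

text \<open>
  For multiplicative \<open>\<phi>\<close> and central \<open>sc\<close> this is the algebra homomorphism out of a monoid algebra. Words,
  exponent vectors and substitutions of variables are all instances.
\<close>

definition lin_ext :: "('k \<Rightarrow> 'a) \<Rightarrow> ('m \<Rightarrow> 'a) \<Rightarrow> ('m \<Rightarrow>\<^sub>0 'k::field) \<Rightarrow> 'a::ring_1"
  where "lin_ext sc \<phi> p = (\<Sum>m\<in>Poly_Mapping.keys p. sc (Poly_Mapping.lookup p m) * \<phi> m)"

lemma poly_mapping_single_induct [case_names single add]:
  fixes p :: "'m \<Rightarrow>\<^sub>0 'k::field"
  assumes single: "\<And>m c. P (Poly_Mapping.single m c)"
    and add: "\<And>p q. P p \<Longrightarrow> P q \<Longrightarrow> P (p + q)"
  shows "P p"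
proof (induction p rule: update_induct)
  case const
  show ?case using single[of undefined 0] by simp
next
  case (update f a b)
  have "Poly_Mapping.update a b f = f + Poly_Mapping.single a b"
    using update(1)
    by (intro poly_mapping_eqI)
      (auto simp: lookup_update lookup_add lookup_single in_keys_iff when_def)
  then show ?case using add[OF update(3) single] by simp
qed

locale scalars =
  fixes sc :: "'k::field \<Rightarrow> 'a::ring_1"
  assumes sc_add: "sc (c + d) = sc c + sc d"
    and sc_mult: "sc (c * d) = sc c * sc d"
    and sc_one: "sc 1 = 1"
begin

lemma sc_zero: "sc 0 = 0"
  using sc_add[of 0 0] by simp

lemma sc_minus: "sc (- c) = - sc c"
  using sc_add[of c "-c"] by (simp add: sc_zero eq_neg_iff_add_eq_0 add.commute)

lemma sc_diff: "sc (c - d) = sc c - sc d"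
  using sc_add[of c "- d"] by (simp add: sc_minus)

lemma lin_ext_superset:
  assumes "finite S" "Poly_Mapping.keys p \<subseteq> S"
  shows "lin_ext sc \<phi> p = (\<Sum>m\<in>S. sc (Poly_Mapping.lookup p m) * \<phi> m)"
  unfolding lin_ext_def
  by (rule sum.mono_neutral_left) (use assms in \<open>auto simp: in_keys_iff sc_zero\<close>)

lemma lin_ext_add: "lin_ext sc \<phi> (p + q) = lin_ext sc \<phi> p + lin_ext sc \<phi> q"
proof -
  let ?S = "Poly_Mapping.keys p \<union> Poly_Mapping.keys q"
  have "lin_ext sc \<phi> (p + q)
      = (\<Sum>m\<in>?S. sc (Poly_Mapping.lookup (p + q) m) * \<phi> m)"
    by (rule lin_ext_superset) (simp_all add: Poly_Mapping.keys_add)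
  also have "\<dots> = lin_ext sc \<phi> p + lin_ext sc \<phi> q"
    by (simp add: lookup_add sc_add distrib_right sum.distrib lin_ext_superset[of ?S])
  finally show ?thesis .
qed

lemma lin_ext_single [simp]: "lin_ext sc \<phi> (Poly_Mapping.single m c) = sc c * \<phi> m"
  by (simp add: lin_ext_def sc_zero)

lemma lin_ext_zero [simp]: "lin_ext sc \<phi> 0 = 0"
  by (simp add: lin_ext_def)

lemma lin_ext_minus: "lin_ext sc \<phi> (- p) = - lin_ext sc \<phi> p"
  using lin_ext_add[of \<phi> p "-p"] by (simp add: eq_neg_iff_add_eq_0 add.commute)

lemma lin_ext_diff: "lin_ext sc \<phi> (p - q) = lin_ext sc \<phi> p - lin_ext sc \<phi> q"
  using lin_ext_add[of \<phi> p "-q"] by (simp add: lin_ext_minus)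

lemma lin_ext_sum: "lin_ext sc \<phi> (sum f S) = (\<Sum>i\<in>S. lin_ext sc \<phi> (f i))"
  by (induction S rule: infinite_finite_induct) (simp_all add: lin_ext_add)

lemma lin_ext_mult:
  fixes \<phi> :: "'m::monoid_add \<Rightarrow> 'a"
  assumes \<phi>: "\<And>m n. \<phi> (m + n) = \<phi> m * \<phi> n"
    and comm: "\<And>c m. sc c * \<phi> m = \<phi> m * sc c"
  shows "lin_ext sc \<phi> (p * q) = lin_ext sc \<phi> p * lin_ext sc \<phi> q"
proof (induction p rule: poly_mapping_single_induct)
  case (single m c)
  show ?case
  proof (induction q rule: poly_mapping_single_induct)
    case (single n d)
    have "sc c * sc d * (\<phi> m * \<phi> n) = sc c * \<phi> m * (sc d * \<phi> n)"
      by (metis comm mult.assoc)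
    then show ?case by (simp add: mult_single \<phi> sc_mult)
  qed (simp add: distrib_left lin_ext_add)
qed (simp add: distrib_right lin_ext_add)

end

lemma additive_eq_on_singles:
  fixes f g :: "('m \<Rightarrow>\<^sub>0 'k::field) \<Rightarrow> 'a::monoid_add"
  assumes "\<And>p q. f (p + q) = f p + f q" "\<And>p q. g (p + q) = g p + g q"
    and "\<And>m c. f (Poly_Mapping.single m c) = g (Poly_Mapping.single m c)"
  shows "f p = g p"
  by (induction p rule: poly_mapping_single_induct) (simp_all add: assms)

section \<open>Laurent polynomials\<close>

text \<open>
  Exponent vectors form a linearly ordered group, which makes this ring an integral domain. There is one
  variable for each natural number, so that permutations act without reference to \<open>r\<close>.
\<close>

type_synonym 'k laurent = "(nat \<Rightarrow>\<^sub>0 int) \<Rightarrow>\<^sub>0 'k"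

definition lconst :: "'k::field \<Rightarrow> 'k laurent"
  where "lconst c = Poly_Mapping.single 0 c"

definition lmon :: "(nat \<Rightarrow>\<^sub>0 int) \<Rightarrow> 'k::field laurent"
  where "lmon \<alpha> = Poly_Mapping.single \<alpha> 1"

definition lvar :: "nat \<Rightarrow> 'k::field laurent"
  where "lvar i = lmon (Poly_Mapping.single i 1)"

definition linv :: "nat \<Rightarrow> 'k::field laurent"
  where "linv i = lmon (Poly_Mapping.single i (- 1))"

lemma lconst_scalars: "scalars lconst"
  by standard (simp_all add: lconst_def single_add mult_single)

interpretation lconst: scalars lconst
  by (rule lconst_scalars)

lemma lmon_add: "lmon (\<alpha> + \<beta>) = lmon \<alpha> * lmon \<beta>"
  by (simp add: lmon_def mult_single)

lemma lmon_zero [simp]: "lmon 0 = 1"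
  by (simp add: lmon_def)

lemma single_eq_lconst_lmon: "Poly_Mapping.single \<alpha> c = lconst c * lmon \<alpha>"
  by (simp add: lconst_def lmon_def mult_single)

lemma lmon_neq_0 [simp]: "lmon \<alpha> \<noteq> 0"
  by (metis lmon_def lookup_single_eq lookup_zero zero_neq_one)

lemma lconst_eq_0_iff [simp]: "lconst c = 0 \<longleftrightarrow> c = 0"
  by (metis lconst_def lookup_single_eq single_zero)

lemma lvar_linv [simp]: "lvar i * linv i = 1"
  by (simp add: lvar_def linv_def flip: lmon_add single_add)

lemma lvar_inject: "lvar i = (lvar j :: 'k::field laurent) \<longleftrightarrow> i = j"
proof
  assume "lvar i = (lvar j :: 'k laurent)"
  then have "Poly_Mapping.keys (lvar i :: 'k laurent) = Poly_Mapping.keys (lvar j :: 'k laurent)"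
    by simp
  then have "Poly_Mapping.single i 1 = (Poly_Mapping.single j 1 :: nat \<Rightarrow>\<^sub>0 int)"
    by (simp add: lvar_def lmon_def)
  then show "i = j" by (metis keys_single singleton_inject zero_neq_one)
qed simp

lemma lvar_neq_const_lvar:
  assumes "i \<noteq> j"
  shows "lvar i \<noteq> lconst c * (lvar j :: 'k::field laurent)"
proof
  assume *: "lvar i = lconst c * (lvar j :: 'k laurent)"
  have ne: "Poly_Mapping.single j 1 \<noteq> (Poly_Mapping.single i 1 :: nat \<Rightarrow>\<^sub>0 int)"
    using assms by (metis keys_single singleton_inject zero_neq_one)
  have "Poly_Mapping.lookup (lvar i :: 'k laurent) (Poly_Mapping.single i 1) = 1"
    by (simp add: lvar_def lmon_def)
  moreover have "Poly_Mapping.lookup (lconst c * (lvar j :: 'k laurent)) (Poly_Mapping.single i 1) = 0"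
    using ne by (simp add: lvar_def lmon_def lconst_def mult_single lookup_single_not_eq)
  ultimately show False using * by simp
qed

lemma lvar_neq_0 [simp]: "lvar i \<noteq> 0"
  by (simp add: lvar_def)

lemma laurent_induct [case_names const var inv add mult]:
  fixes a :: "'k::field laurent"
  assumes const: "\<And>c. P (lconst c)"
    and var: "\<And>i. P (lvar i)" and inv: "\<And>i. P (linv i)"
    and add: "\<And>a b. P a \<Longrightarrow> P b \<Longrightarrow> P (a + b)"
    and mult: "\<And>a b. P a \<Longrightarrow> P b \<Longrightarrow> P (a * b)"
  shows "P a"
proof -
  have 1: "P 1" using const[of 1] by (simp add: lconst.sc_one)
  have pw: "P (lmon (Poly_Mapping.single i k))" for i and k :: int
  proof (induction k rule: int_induct[of _ 0])
    case base
    show ?case using 1 by simp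
  next
    case (step1 k)
    have "lmon (Poly_Mapping.single i (k + 1)) = lmon (Poly_Mapping.single i k) * (lvar i :: 'k laurent)"
      by (simp add: lvar_def flip: lmon_add single_add)
    then show ?case using mult[OF step1(2) var] by simp
  next
    case (step2 k)
    have "lmon (Poly_Mapping.single i (k - 1)) = lmon (Poly_Mapping.single i k) * (linv i :: 'k laurent)"
      by (simp add: linv_def flip: lmon_add single_add)
    then show ?case using mult[OF step2(2) inv] by simp
  qed
  have mon: "P (lmon \<alpha>)" for \<alpha>
  proof (induction \<alpha> rule: update_induct)
    case const
    show ?case using 1 by simp
  next
    case (update f i k)
    have "Poly_Mapping.update i k f = f + Poly_Mapping.single i k"
      using update(1)
      by (intro poly_mapping_eqI)
        (auto simp: lookup_update lookup_add lookup_single in_keys_iff when_def)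
    then show ?case using mult[OF update(3) pw] by (simp add: lmon_add)
  qed
  show ?thesis
    by (induction a rule: poly_mapping_single_induct)
      (simp_all add: single_eq_lconst_lmon mult const mon add)
qed

subsection \<open>The primes\<close>

text \<open>
  The substitution \<open>X\<^sub>i \<mapsto> qX\<^sub>j\<close>, i.e. restriction to the hypersurface \<open>X\<^sub>i = qX\<^sub>j\<close>.
\<close>

definition subst :: "'k::field \<Rightarrow> nat \<Rightarrow> nat \<Rightarrow> 'k laurent \<Rightarrow> 'k laurent"
  where "subst q i j = lin_ext lconst
    (\<lambda>\<alpha>. let k = Poly_Mapping.lookup \<alpha> i in
      lconst (q powi k) * lmon (\<alpha> + Poly_Mapping.single j k - Poly_Mapping.single i k))"

lemma subst_add: "subst q i j (a + b) = subst q i j a + subst q i j b"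
  by (simp add: subst_def lconst.lin_ext_add)

lemma subst_diff: "subst q i j (a - b) = subst q i j a - subst q i j b"
  by (simp add: subst_def lconst.lin_ext_diff)

lemma subst_mult:
  assumes "q \<noteq> 0"
  shows "subst q i j (a * b) = subst q i j a * subst q i j b"
  unfolding subst_def
proof (rule lconst.lin_ext_mult)
  fix \<alpha> \<beta> :: "nat \<Rightarrow>\<^sub>0 int"
  show "(let k = Poly_Mapping.lookup (\<alpha> + \<beta>) i in
      lconst (q powi k) * lmon (\<alpha> + \<beta> + Poly_Mapping.single j k - Poly_Mapping.single i k)) =
    (let k = Poly_Mapping.lookup \<alpha> i in
      lconst (q powi k) * lmon (\<alpha> + Poly_Mapping.single j k - Poly_Mapping.single i k)) *
    (let k = Poly_Mapping.lookup \<beta> i in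
      lconst (q powi k) * lmon (\<beta> + Poly_Mapping.single j k - Poly_Mapping.single i k))"
    using assms
    by (simp add: Let_def lookup_add power_int_add lconst.sc_mult single_add algebra_simps
        flip: lmon_add)
qed (simp add: mult.commute)

lemma subst_const [simp]: "subst q i j (lconst c) = lconst c"
proof -
  have "subst q i j (lconst c) = subst q i j (Poly_Mapping.single 0 c)"
    by (simp add: lconst_def)
  also have "\<dots> = lconst c"
    by (simp only: subst_def lconst.lin_ext_single) (simp add: lconst.sc_one)
  finally show ?thesis .
qed

lemma subst_zero [simp]: "subst q i j 0 = 0"
  by (simp add: subst_def)

lemma subst_mon: "subst q i j (lmon \<alpha>) = (let k = Poly_Mapping.lookup \<alpha> i in
      lconst (q powi k) * lmon (\<alpha> + Poly_Mapping.single j k - Poly_Mapping.single i k))"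
  by (simp only: subst_def lmon_def lconst.lin_ext_single) (simp add: lconst.sc_one)

lemma subst_var: "subst q i j (lvar k) = (if k = i then lconst q * lvar j else lvar k)"
  by (auto simp: lvar_def subst_mon lconst.sc_one lookup_single)

lemma subst_inv: "subst q i j (linv k) = (if k = i then lconst (inverse q) * linv j else linv k)"
  by (auto simp: linv_def subst_mon lconst.sc_one lookup_single power_int_minus single_uminus)

text \<open>
  Representations annihilated by a symmetriser live on the hypersurfaces \<open>X\<^sub>i = qX\<^sub>j\<close>, whose equations
  these are.
\<close>

definition wall :: "'k::field \<Rightarrow> nat \<Rightarrow> nat \<Rightarrow> 'k laurent"
  where "wall q i j = lconst q * lvar j - lvar i"

lemma wall_dvd_subst:
  assumes "q \<noteq> 0"
  shows "wall q i j dvd a - subst q i j a"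
proof (induction a rule: laurent_induct)
  case (var k)
  show ?case
  proof (cases "k = i")
    case True
    then have "lvar k - subst q i j (lvar k) = wall q i j * (- 1)"
      by (simp add: subst_var wall_def)
    then show ?thesis by (simp only: dvd_triv_left)
  qed (simp add: subst_var)
next
  case (inv k)
  show ?case
  proof (cases "k = i")
    case True
    have c: "lconst q * lconst (inverse q) = 1"
      using assms by (simp add: lconst.sc_one flip: lconst.sc_mult)
    have "wall q i j * (lconst (inverse q) * linv j * linv i)
        = (lconst q * lconst (inverse q)) * (lvar j * linv j) * linv i
          - lconst (inverse q) * linv j * (lvar i * linv i)"
      by (simp add: wall_def algebra_simps)
    also have "\<dots> = linv i - lconst (inverse q) * linv j"
      by (simp only: c lvar_linv) simp
    finally show ?thesis using True by (simp add: subst_inv) (metis dvd_triv_left)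
  qed (simp add: subst_inv)
next
  case (add a b)
  have "a + b - subst q i j (a + b) = (a - subst q i j a) + (b - subst q i j b)"
    by (simp add: subst_add)
  then show ?case using add by (simp only: dvd_add)
next
  case (mult a b)
  have "a * b - subst q i j (a * b) = (a - subst q i j a) * b + subst q i j a * (b - subst q i j b)"
    by (simp add: subst_mult[OF assms] algebra_simps)
  then show ?case using mult by (simp only: dvd_add dvd_mult2 dvd_mult)
qed simp

lemma subst_wall_self: "i \<noteq> j \<Longrightarrow> q \<noteq> 0 \<Longrightarrow> subst q i j (wall q i j) = 0"
  by (simp add: wall_def subst_diff subst_mult subst_var)

text \<open>
  The principal ideal of a wall is the kernel of a homomorphism into a domain; this is why walls are
  prime.
\<close>

lemma wall_dvd_iff:
  assumes "q \<noteq> 0" "i \<noteq> j"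
  shows "wall q i j dvd a \<longleftrightarrow> subst q i j a = 0"
proof
  assume "wall q i j dvd a"
  then obtain b where "a = wall q i j * b" ..
  then show "subst q i j a = 0"
    using assms by (simp add: subst_mult subst_wall_self)
next
  assume "subst q i j a = 0"
  then show "wall q i j dvd a" using wall_dvd_subst[OF assms(1), of i j a] by simp
qed

lemma wall_neq_0:
  assumes "q \<noteq> 0" "i \<noteq> j"
  shows "wall q i j \<noteq> 0"
  using lvar_neq_const_lvar[OF assms(2), of q] by (auto simp: wall_def)

lemma wall_prime:
  assumes "q \<noteq> 0" "i \<noteq> j" "wall q i j dvd a * b"
  shows "wall q i j dvd a \<or> wall q i j dvd b"
  using assms by (simp add: wall_dvd_iff subst_mult)

lemma wall_not_dvd_1:
  assumes "q \<noteq> 0" "i \<noteq> j"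
  shows "\<not> wall q i j dvd 1"
proof -
  have "subst q i j 1 = 1" using subst_const[of q i j 1] by (simp only: lconst.sc_one)
  then show ?thesis using assms by (simp add: wall_dvd_iff)
qed

lemma wall_not_dvd_wall:
  assumes q: "q \<noteq> 0" "q\<^sup>2 \<noteq> 1" and "i \<noteq> j" "k \<noteq> l" "(k, l) \<noteq> (i, j)"
  shows "\<not> wall q i j dvd wall q k l"
proof -
  have s: "subst q i j (wall q k l)
      = lconst q * (if l = i then lconst q * lvar j else lvar l)
        - (if k = i then lconst q * lvar j else lvar k)"
    by (simp add: wall_def subst_diff subst_mult[OF q(1)] subst_var)
  have "subst q i j (wall q k l) \<noteq> 0"
  proof (cases "k = i")
    case True
    then have "l \<noteq> j" "l \<noteq> i" using assms by auto
    then have "subst q i j (wall q k l) = lconst q * (lvar l - lvar j)"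
      unfolding s using True by (simp add: right_diff_distrib)
    then show ?thesis using \<open>l \<noteq> j\<close> q by (simp add: lvar_inject)
  next
    case False
    show ?thesis
    proof (cases "l = i")
      case True
      have e: "subst q i j (wall q k l) = lconst (q * q) * lvar j - lvar k"
        unfolding s using False True by (simp add: lconst.sc_mult mult.assoc)
      show ?thesis
      proof (cases "k = j")
        case True
        have "subst q i j (wall q k l) = lconst (q * q - 1) * lvar j"
          unfolding e using True by (simp add: lconst.sc_diff lconst.sc_one left_diff_distrib)
        then show ?thesis using q by (simp add: power2_eq_square)
      next
        case False
        then show ?thesis using lvar_neq_const_lvar[of k j "q * q"] by (auto simp: e)
      qed
    next
      case l: False
      then show ?thesis using False assms(4) lvar_neq_const_lvar[of k l q]
        unfolding s by auto
    qed
  qed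
  then show ?thesis using q assms(3) by (simp add: wall_dvd_iff)
qed

definition wall_prod :: "'k::field \<Rightarrow> (nat \<times> nat) set \<Rightarrow> 'k laurent"
  where "wall_prod q S = (\<Prod>(i, j)\<in>S. wall q i j)"

lemma wall_dvd_wall_prod_iff:
  assumes q: "q \<noteq> 0" "q\<^sup>2 \<noteq> 1" and "i \<noteq> j" "finite S" "\<forall>(k, l)\<in>S. k \<noteq> l"
  shows "wall q i j dvd wall_prod q S \<longleftrightarrow> (i, j) \<in> S"
  using assms(4,5)
proof (induction S rule: finite_induct)
  case empty
  then show ?case using wall_not_dvd_1[OF q(1) assms(3)] by (simp add: wall_prod_def)
next
  case (insert x S)
  obtain k l where x: "x = (k, l)" by (cases x)
  have e: "wall_prod q (insert x S) = wall q k l * wall_prod q S"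
    using insert by (simp add: wall_prod_def x)
  show ?case
  proof
    assume "wall q i j dvd wall_prod q (insert x S)"
    then consider "wall q i j dvd wall q k l" | "wall q i j dvd wall_prod q S"
      unfolding e using wall_prime[OF q(1) assms(3)] by blast
    then show "(i, j) \<in> insert x S"
      using wall_not_dvd_wall[OF q assms(3)] insert x by cases auto
  next
    assume "(i, j) \<in> insert x S"
    then show "wall q i j dvd wall_prod q (insert x S)" unfolding e using insert x by auto
  qed
qed

lemma wall_prod_neq_0:
  assumes "q \<noteq> 0" "finite S" "\<forall>(k, l)\<in>S. k \<noteq> l"
  shows "wall_prod q S \<noteq> 0"
  using assms wall_neq_0[OF assms(1)] by (auto simp: wall_prod_def split: prod.splits)

lemma wall_prod_dvd:
  assumes q: "q \<noteq> 0" "q\<^sup>2 \<noteq> 1" and "finite S" "\<forall>(k, l)\<in>S. k \<noteq> l"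
    and "\<And>i j. (i, j) \<in> S \<Longrightarrow> wall q i j dvd a"
  shows "wall_prod q S dvd a"
  using assms(3-)
proof (induction S rule: finite_induct)
  case empty
  then show ?case by (simp add: wall_prod_def)
next
  case (insert x S)
  obtain k l where x: "x = (k, l)" by (cases x)
  have "k \<noteq> l" using insert x by auto
  have "wall_prod q S dvd a" using insert by auto
  then obtain b where b: "a = wall_prod q S * b" ..
  have "wall q k l dvd wall_prod q S * b" using insert(5) x b by auto
  moreover have "\<not> wall q k l dvd wall_prod q S"
    using wall_dvd_wall_prod_iff[OF q \<open>k \<noteq> l\<close>, of S] insert x by auto
  ultimately have "wall q k l dvd b" using wall_prime[OF q(1) \<open>k \<noteq> l\<close>] by blast
  then obtain c where "b = wall q k l * c" ..
  then have "a = wall_prod q (insert x S) * c"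
    using insert by (simp add: b wall_prod_def x)
  then show ?case by simp
qed

text \<open>
  The quotients \<open>a\<^sub>k / \<Prod> S\<^sub>k\<close> agree as fractions. A factor of the \<open>k\<close>-th denominator is absent from some other
  denominator, so it must divide \<open>a\<^sub>k\<close>: the common fraction has no denominator at all.
\<close>

lemma wall_prod_common_quotient:
  fixes a :: "'i \<Rightarrow> 'k::field laurent"
  assumes q: "q \<noteq> 0" "q\<^sup>2 \<noteq> 1"
    and S: "\<And>k. k \<in> K \<Longrightarrow> finite (S k)" "\<And>k. k \<in> K \<Longrightarrow> \<forall>(i, j)\<in>S k. i \<noteq> j"
    and cop: "\<And>i j k. k \<in> K \<Longrightarrow> (i, j) \<in> S k \<Longrightarrow> \<exists>l\<in>K. (i, j) \<notin> S l"
    and cross: "\<And>k l. k \<in> K \<Longrightarrow> l \<in> K \<Longrightarrow> wall_prod q (S l) * a k = wall_prod q (S k) * a l"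
  shows "\<exists>b. \<forall>k\<in>K. a k = wall_prod q (S k) * b"
proof (cases "K = {}")
  case False
  then obtain k where k: "k \<in> K" by auto
  have "wall_prod q (S k) dvd a k"
  proof (rule wall_prod_dvd[OF q S[OF k]])
    fix i j assume ij: "(i, j) \<in> S k"
    then have "i \<noteq> j" using S(2)[OF k] by auto
    obtain l where l: "l \<in> K" "(i, j) \<notin> S l" using cop[OF k ij] by auto
    have "wall q i j dvd wall_prod q (S k)"
      using wall_dvd_wall_prod_iff[OF q \<open>i \<noteq> j\<close> S[OF k]] ij by simp
    then have "wall q i j dvd wall_prod q (S l) * a k" by (simp add: cross[OF k l(1)])
    moreover have "\<not> wall q i j dvd wall_prod q (S l)"
      using wall_dvd_wall_prod_iff[OF q \<open>i \<noteq> j\<close> S[OF l(1)]] l by simp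
    ultimately show "wall q i j dvd a k" using wall_prime[OF q(1) \<open>i \<noteq> j\<close>] by blast
  qed
  then obtain b where b: "a k = wall_prod q (S k) * b" ..
  have "a l = wall_prod q (S l) * b" if "l \<in> K" for l
  proof -
    have "wall_prod q (S k) * (wall_prod q (S l) * b) = wall_prod q (S k) * a l"
      using cross[OF k that] b by (simp add: mult_ac)
    then show ?thesis using wall_prod_neq_0[OF q(1) S[OF k]] by simp
  qed
  then show ?thesis by blast
qed auto

section \<open>Normal forms of words in the adjacent transpositions\<close>

text \<open>
  Only the homogeneous relations are used, not the cancellation of two equal letters. Hence the product
  of the \<open>T\<^sub>i\<close> along a word depends only on the class of the word, and words in a class have equal length.
\<close>

inductive braid_eq :: "nat list \<Rightarrow> nat list \<Rightarrow> bool" (infix "\<sim>\<^sub>b" 50) where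
  same: "u \<sim>\<^sub>b u"
| far: "i + 1 < j \<or> j + 1 < i \<Longrightarrow> a @ [i, j] @ b \<sim>\<^sub>b a @ [j, i] @ b"
| braid: "a @ [i, i + 1, i] @ b \<sim>\<^sub>b a @ [i + 1, i, i + 1] @ b"
| flip: "u \<sim>\<^sub>b v \<Longrightarrow> v \<sim>\<^sub>b u"
| chain: "u \<sim>\<^sub>b v \<Longrightarrow> v \<sim>\<^sub>b w \<Longrightarrow> u \<sim>\<^sub>b w"

declare braid_eq.same [simp]
lemmas [trans] = braid_eq.chain

lemma braid_eq_append:
  assumes "u \<sim>\<^sub>b v"
  shows "a @ u @ b \<sim>\<^sub>b a @ v @ b"
  using assms
proof (induction)
  case (far i j c d)
  then show ?case using braid_eq.far[of i j "a @ c" "d @ b"] by simp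
next
  case (braid c i d)
  then show ?case using braid_eq.braid[of "a @ c" i "d @ b"] by simp
qed (auto intro: braid_eq.flip braid_eq.chain)

lemma braid_eq_Cons: "u \<sim>\<^sub>b v \<Longrightarrow> i # u \<sim>\<^sub>b i # v"
  using braid_eq_append[of u v "[i]" "[]"] by simp

lemma braid_eq_prefix: "u \<sim>\<^sub>b v \<Longrightarrow> a @ u \<sim>\<^sub>b a @ v"
  using braid_eq_append[of u v a "[]"] by simp

lemma braid_eq_suffix: "u \<sim>\<^sub>b v \<Longrightarrow> u @ b \<sim>\<^sub>b v @ b"
  using braid_eq_append[of u v "[]" b] by simp

lemma braid_eq_length: "u \<sim>\<^sub>b v \<Longrightarrow> length u = length v"
  by (induction rule: braid_eq.induct) auto

lemma braid_eq_set: "u \<sim>\<^sub>b v \<Longrightarrow> set u = set v"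
  by (induction rule: braid_eq.induct) auto

lemma perm_of_word_simps [simp]:
  "perm_of_word [] = id"
  "perm_of_word (i # u) = Transposition.transpose i (i + 1) \<circ> perm_of_word u"
  by (simp_all add: perm_of_word_def)

lemma perm_of_word_append: "perm_of_word (u @ v) = perm_of_word u \<circ> perm_of_word v"
  by (induction u) (simp_all add: comp_assoc)

lemma perm_of_word_braid_eq: "u \<sim>\<^sub>b v \<Longrightarrow> perm_of_word u = perm_of_word v"
proof (induction rule: braid_eq.induct)
  case (far i j a b)
  then have "Transposition.transpose i (i + 1) \<circ> Transposition.transpose j (j + 1)
      = Transposition.transpose j (j + 1) \<circ> Transposition.transpose i (i + 1)"
    by (auto simp: fun_eq_iff transpose_def)
  then have "perm_of_word [i, j] = perm_of_word [j, i]" by simp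
  then show ?case by (simp only: perm_of_word_append)
next
  case (braid a i b)
  have "perm_of_word [i, i + 1, i] = perm_of_word [i + 1, i, i + 1]"
    by (auto simp: fun_eq_iff transpose_def)
  then show ?case by (simp only: perm_of_word_append)
qed auto

lemma perm_of_word_permutes:
  "set u \<subseteq> {1..<r} \<Longrightarrow> perm_of_word u permutes {1..r}"
proof (induction u)
  case (Cons i u)
  then have "Transposition.transpose i (i + 1) permutes {1..r}"
    by (intro permutes_swap_id) auto
  moreover have "perm_of_word u permutes {1..r}" using Cons by simp
  ultimately show ?case by (simp only: perm_of_word_simps permutes_compose)
qed (simp only: perm_of_word_simps permutes_id)

lemma bij_perm_of_word: "bij (perm_of_word u)"
proof (induction u)
  case (Cons i u)
  then show ?case by (simp only: perm_of_word_simps bij_comp bij_transpose)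
qed (simp only: perm_of_word_simps bij_id)

lemma upt_Cons_append:
  assumes "i < m"
  shows "[i..<m] = i # [i+1..<m]"
  using assms by (simp add: upt_conv_Cons)

lemma braid_eq_far:
  assumes "i + 1 < j"
  shows "i # [j..<m] \<sim>\<^sub>b [j..<m] @ [i]"
proof (induction m)
  case (Suc m)
  show ?case
  proof (cases "j \<le> m")
    case True
    have "i # [j..<Suc m] = (i # [j..<m]) @ [m]" using True by simp
    also have "\<dots> \<sim>\<^sub>b ([j..<m] @ [i]) @ [m]"
      by (rule braid_eq_suffix) (rule Suc)
    also have "\<dots> = [j..<m] @ [i, m] @ []" by simp
    also have "\<dots> \<sim>\<^sub>b [j..<m] @ [m, i] @ []"
      by (rule braid_eq.far) (use assms True in auto)
    also have "\<dots> = [j..<Suc m] @ [i]" using True by simp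
    finally show ?thesis .
  qed simp
qed simp

lemma braid_eq_left:
  assumes "i > m" "i > 0"
  shows "i # [j..<m] \<sim>\<^sub>b [j..<m] @ [i]"
  using assms(1)
proof (induction m)
  case (Suc m)
  show ?case
  proof (cases "j \<le> m")
    case True
    have "i # [j..<Suc m] = (i # [j..<m]) @ [m]" using True by simp
    also have "\<dots> \<sim>\<^sub>b ([j..<m] @ [i]) @ [m]"
      by (rule braid_eq_suffix) (use Suc in auto)
    also have "\<dots> = [j..<m] @ [i, m] @ []" by simp
    also have "\<dots> \<sim>\<^sub>b [j..<m] @ [m, i] @ []"
      by (rule braid_eq.far) (use Suc in auto)
    also have "\<dots> = [j..<Suc m] @ [i]" using True by simp
    finally show ?thesis .
  qed simp
qed simp

text \<open>
  The word \<open>[j..<m]\<close> is a cycle, and conjugation by it shifts \<open>s\<^sub>i\<^sub>-\<^sub>1\<close> to \<open>s\<^sub>i\<close>; braid moves suffice to see this.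
\<close>

lemma braid_eq_shift:
  assumes "j < i" "i < m"
  shows "i # [j..<m] \<sim>\<^sub>b [j..<m] @ [i - 1]"
proof -
  obtain k where i: "i = Suc k" using assms by (cases i) auto
  have split: "[j..<m] = [j..<k] @ [k, k + 1] @ [k + 2..<m]"
    using assms upt_add_eq_append[of j k "m - k"] upt_Cons_append[of k m] upt_Cons_append[of "k+1" m]
    by (simp add: i)
  have "i # [j..<m] = (i # [j..<k]) @ [k, k + 1] @ [k + 2..<m]" by (simp add: split)
  also have "\<dots> \<sim>\<^sub>b ([j..<k] @ [i]) @ [k, k + 1] @ [k + 2..<m]"
    by (rule braid_eq_suffix, rule braid_eq_left) (simp_all add: i)
  also have "\<dots> = [j..<k] @ [k + 1, k, k + 1] @ [k + 2..<m]" by (simp add: i)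
  also have "\<dots> \<sim>\<^sub>b [j..<k] @ [k, k + 1, k] @ [k + 2..<m]"
    by (rule braid_eq.flip, rule braid_eq.braid)
  also have "\<dots> = ([j..<k] @ [k, k + 1]) @ (k # [k + 2..<m])" by simp
  also have "\<dots> \<sim>\<^sub>b ([j..<k] @ [k, k + 1]) @ ([k + 2..<m] @ [k])"
    by (rule braid_eq_prefix, rule braid_eq_far) simp
  also have "\<dots> = [j..<m] @ [i - 1]" by (simp add: split i)
  finally show ?thesis .
qed

text \<open>
  A permutation of \<open>{1..m + 1}\<close> factors uniquely as a minimal coset representative, determined by the
  image \<open>j\<close> of \<open>m + 1\<close>, and a permutation of \<open>{1..m}\<close>.
\<close>

fun normal_words :: "nat \<Rightarrow> nat list set" where
  "normal_words 0 = {[]}"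
| "normal_words (Suc m) = (\<lambda>(j, u). [j..<Suc m] @ u) ` ({1..Suc m} \<times> normal_words m)"

lemma normal_words_letters: "u \<in> normal_words m \<Longrightarrow> set u \<subseteq> {1..<m}"
proof (induction m arbitrary: u)
  case (Suc m)
  then show ?case by fastforce
qed simp

lemma finite_normal_words [simp]: "finite (normal_words m)"
  by (induction m) auto

lemma Nil_in_normal_words: "[] \<in> normal_words m"
proof (induction m)
  case (Suc m)
  show ?case using Suc by (auto intro!: image_eqI[where x = "(Suc m, [])"])
qed simp

lemma normal_words_Suc_I: "1 \<le> j \<Longrightarrow> j \<le> Suc m \<Longrightarrow> u \<in> normal_words m \<Longrightarrow>
    [j..<Suc m] @ u \<in> normal_words (Suc m)"
  by (auto intro!: image_eqI[where x = "(j, u)"])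

lemma perm_of_word_fixes: "set u \<subseteq> {1..<m} \<Longrightarrow> m < k \<Longrightarrow> perm_of_word u k = k"
  using perm_of_word_permutes permutes_not_in[of "perm_of_word u" "{1..m}" k] by auto

lemma perm_of_word_upt: "j \<le> m \<Longrightarrow> perm_of_word [j..<m] m = j"
proof (induction "m - j" arbitrary: j)
  case (Suc d)
  then have "[j..<m] = j # [j+1..<m]" by (intro upt_Cons_append) auto
  moreover have "perm_of_word [j+1..<m] m = j + 1" using Suc by (intro Suc(1)) auto
  ultimately show ?case by simp
qed simp

lemma perm_of_normal_word_last:
  assumes "u \<in> normal_words m" "j \<le> Suc m"
  shows "perm_of_word ([j..<Suc m] @ u) (Suc m) = j"
  using perm_of_word_fixes[OF normal_words_letters[OF assms(1)], of "Suc m"]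
    perm_of_word_upt[OF assms(2)]
  by (simp add: perm_of_word_append del: upt_Suc)

lemma inj_on_perm_of_word: "inj_on perm_of_word (normal_words m)"
proof (induction m)
  case (Suc m)
  show ?case
  proof (rule inj_onI)
    fix u v assume uv: "u \<in> normal_words (Suc m)" "v \<in> normal_words (Suc m)"
      "perm_of_word u = perm_of_word v"
    obtain i u' where u: "u = [i..<Suc m] @ u'" "u' \<in> normal_words m" "i \<le> Suc m"
      using uv(1) by auto
    obtain j v' where v: "v = [j..<Suc m] @ v'" "v' \<in> normal_words m" "j \<le> Suc m"
      using uv(2) by auto
    have ij: "i = j"
      using perm_of_normal_word_last[OF u(2,3)] perm_of_normal_word_last[OF v(2,3)] uv(3)
      by (simp add: u(1) v(1))
    have "perm_of_word [i..<Suc m] \<circ> perm_of_word u' = perm_of_word [i..<Suc m] \<circ> perm_of_word v'"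
      using uv(3) by (simp add: u(1) v(1) ij perm_of_word_append del: upt_Suc)
    then have "perm_of_word u' x = perm_of_word v' x" for x
      using injD[OF bij_is_inj[OF bij_perm_of_word]] by (metis comp_apply)
    then have "perm_of_word u' = perm_of_word v'" by blast
    then have "u' = v'" using Suc u v by (auto dest: inj_onD)
    then show "u = v" by (simp add: u v ij)
  qed
qed simp

lemma perm_of_word_image: "perm_of_word ` normal_words m = {w. w permutes {1..m}}"
proof (induction m)
  case 0
  then show ?case by auto
next
  case (Suc m)
  show ?case
  proof (intro equalityI subsetI)
    fix w assume "w \<in> perm_of_word ` normal_words (Suc m)"
    then show "w \<in> {w. w permutes {1..Suc m}}"
      using perm_of_word_permutes normal_words_letters by blast
  next
    fix w assume "w \<in> {w. w permutes {1..Suc m}}"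
    then have w: "w permutes {1..Suc m}" by simp
    define j where "j = w (Suc m)"
    have j: "1 \<le> j" "j \<le> Suc m" using permutes_in_image[OF w, of "Suc m"] by (auto simp: j_def)
    let ?c = "perm_of_word [j..<Suc m]"
    have c: "?c permutes {1..Suc m}" using j by (intro perm_of_word_permutes) auto
    have v: "Hilbert_Choice.inv ?c \<circ> w permutes {1..Suc m}"
      using permutes_compose[OF w permutes_inv[OF c]] .
    have "Hilbert_Choice.inv ?c j = Suc m"
      using perm_of_word_upt[OF j(2)] permutes_inverses(2)[OF c, of "Suc m"] by (simp del: upt_Suc)
    then have fx: "(Hilbert_Choice.inv ?c \<circ> w) (Suc m) = Suc m" by (simp add: j_def)
    have "Hilbert_Choice.inv ?c \<circ> w permutes {1..m}"
    proof (rule permutes_superset[OF v])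
      fix x assume "x \<in> {1..Suc m} - {1..m}"
      then have "x = Suc m" by auto
      then show "(Hilbert_Choice.inv ?c \<circ> w) x = x" using fx by simp
    qed
    then obtain u where u: "u \<in> normal_words m" "perm_of_word u = Hilbert_Choice.inv ?c \<circ> w"
      using Suc by (metis (mono_tags, lifting) imageE mem_Collect_eq)
    have "perm_of_word ([j..<Suc m] @ u) = ?c \<circ> (Hilbert_Choice.inv ?c \<circ> w)"
      by (simp add: perm_of_word_append u del: upt_Suc)
    also have "\<dots> = w" using permutes_inv_o(1)[OF c] by (simp add: comp_assoc[symmetric])
    finally show "w \<in> perm_of_word ` normal_words (Suc m)"
      using normal_words_Suc_I[OF j u(1)] by (metis imageI)
  qed
qed

text \<open>
  The exchange step. In the first case multiplication by \<open>s\<^sub>i\<close> lengthens the word, in the second it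
  shortens it. Through the quadratic relation both cases keep the span of the \<open>T\<^sub>u\<close> stable.
\<close>

lemma normal_words_Cons:
  assumes "u \<in> normal_words m" "1 \<le> i" "i < m"
  shows "\<exists>u'\<in>normal_words m. i # u \<sim>\<^sub>b u' \<or> u \<sim>\<^sub>b i # u'"
  using assms
proof (induction m arbitrary: i u)
  case (Suc m)
  obtain j v where u: "u = [j..<Suc m] @ v" "v \<in> normal_words m" "1 \<le> j" "j \<le> Suc m"
    using Suc.prems(1) by auto
  have step: ?case if k: "i # [j..<Suc m] \<sim>\<^sub>b [j..<Suc m] @ [k]" "1 \<le> k" "k < m" for k
  proof -
    have iu: "i # u \<sim>\<^sub>b [j..<Suc m] @ (k # v)"
      using braid_eq_suffix[OF k(1), of v] by (simp add: u)
    obtain v' where v': "v' \<in> normal_words m" "k # v \<sim>\<^sub>b v' \<or> v \<sim>\<^sub>b k # v'"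
      using Suc.IH[OF u(2) k(2,3)] by blast
    have mem: "[j..<Suc m] @ v' \<in> normal_words (Suc m)"
      using u v' by (intro normal_words_Suc_I)
    from v'(2) show ?thesis
    proof
      assume "k # v \<sim>\<^sub>b v'"
      then have "i # u \<sim>\<^sub>b [j..<Suc m] @ v'" using iu braid_eq.chain braid_eq_prefix by blast
      then show ?thesis using mem by blast
    next
      assume "v \<sim>\<^sub>b k # v'"
      then have "u \<sim>\<^sub>b [j..<Suc m] @ (k # v')" unfolding u(1) by (rule braid_eq_prefix)
      also have "\<dots> = ([j..<Suc m] @ [k]) @ v'" by simp
      also have "\<dots> \<sim>\<^sub>b (i # [j..<Suc m]) @ v'"
        by (rule braid_eq_suffix, rule braid_eq.flip, rule k(1))
      finally have "u \<sim>\<^sub>b i # ([j..<Suc m] @ v')" by simp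
      then show ?thesis using mem by blast
    qed
  qed
  consider "i + 1 < j" | "j = i + 1" | "i = j" | "j < i" by linarith
  then show ?case
  proof cases
    case 1
    show ?thesis by (rule step[OF braid_eq_far[OF 1]]) (use Suc.prems u 1 in auto)
  next
    case 2
    have "i # u = [i..<Suc m] @ v" using upt_Cons_append[of i "Suc m"] Suc.prems
      by (simp add: u 2 del: upt_Suc)
    moreover have "[i..<Suc m] @ v \<in> normal_words (Suc m)"
      using Suc.prems u by (intro normal_words_Suc_I) auto
    ultimately show ?thesis by (metis braid_eq.same)
  next
    case 3
    have "u = i # ([i + 1..<Suc m] @ v)" using upt_Cons_append[of i "Suc m"] Suc.prems
      by (simp add: u 3 del: upt_Suc)
    moreover have "[i + 1..<Suc m] @ v \<in> normal_words (Suc m)"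
      using Suc.prems u by (intro normal_words_Suc_I) auto
    ultimately show ?thesis by (metis braid_eq.same)
  next
    case 4
    show ?thesis by (rule step[OF braid_eq_shift[OF 4]]) (use Suc.prems u 4 in auto)
  qed
qed simp

text \<open>
  A letter that shortens the normal form makes the given word strictly longer than its normal form from
  then on, so that equality of lengths forces all steps to be of the first kind.
\<close>

lemma normal_form_exists:
  assumes "set is \<subseteq> {1..<m}"
  shows "\<exists>u\<in>normal_words m. perm_of_word u = perm_of_word is \<and> length u \<le> length is \<and>
    (length u = length is \<longrightarrow> is \<sim>\<^sub>b u)"
  using assms
proof (induction "is")
  case Nil
  then show ?case using Nil_in_normal_words by (intro bexI[of _ "[]"]) auto
next
  case (Cons i js)
  then obtain u where u: "u \<in> normal_words m" "perm_of_word u = perm_of_word js"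
      "length u \<le> length js" "length u = length js \<longrightarrow> js \<sim>\<^sub>b u"
    by auto
  obtain u' where u': "u' \<in> normal_words m" "i # u \<sim>\<^sub>b u' \<or> u \<sim>\<^sub>b i # u'"
    using normal_words_Cons[OF u(1), of i] Cons.prems by auto
  from u'(2) show ?case
  proof
    assume *: "i # u \<sim>\<^sub>b u'"
    have "i # js \<sim>\<^sub>b u'" if "length u' = length (i # js)"
    proof -
      have "js \<sim>\<^sub>b u" using u(4) that braid_eq_length[OF *] by simp
      then show ?thesis using * braid_eq.chain braid_eq_Cons by blast
    qed
    then show ?case
      using u'(1) u(2,3) perm_of_word_braid_eq[OF *] braid_eq_length[OF *]
      by (intro bexI[of _ u']) auto
  next
    assume *: "u \<sim>\<^sub>b i # u'"
    have "perm_of_word u' = Transposition.transpose i (i + 1) \<circ> perm_of_word u"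
      using perm_of_word_braid_eq[OF *] by (simp add: comp_assoc[symmetric])
    then show ?case
      using u'(1) u(2,3) braid_eq_length[OF *] by (intro bexI[of _ u']) auto
  qed
qed

lemma normal_word_shortest:
  assumes "u \<in> normal_words m" "set is \<subseteq> {1..<m}" "perm_of_word is = perm_of_word u"
  shows "length u \<le> length is" "length is = length u \<Longrightarrow> is \<sim>\<^sub>b u"
proof -
  obtain v where v: "v \<in> normal_words m" "perm_of_word v = perm_of_word is" "length v \<le> length is"
    "length v = length is \<longrightarrow> is \<sim>\<^sub>b v"
    using normal_form_exists[OF assms(2)] by auto
  then have "v = u" using assms inj_on_perm_of_word[of m] by (metis inj_onD)
  then show "length u \<le> length is" "length is = length u \<Longrightarrow> is \<sim>\<^sub>b u" using v by auto
qed

text \<open>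
  Matsumoto's theorem, in the form needed for the reduced expression selected in the definition of \<open>T\<^sub>w\<close>.
\<close>

lemma reduced_expression_braid_eq:
  assumes "u \<in> normal_words m"
  shows "(SOME is. reduced_expression m (perm_of_word u) is) \<sim>\<^sub>b u"
proof -
  have "reduced_expression m (perm_of_word u) u"
    using normal_word_shortest(1)[OF assms] normal_words_letters[OF assms]
    by (auto simp: reduced_expression_def)
  then have r: "reduced_expression m (perm_of_word u) (SOME is. reduced_expression m (perm_of_word u) is)"
    by (rule someI)
  then show ?thesis
    using normal_words_letters[OF assms]
    by (intro normal_word_shortest(2)[OF assms])
      (auto simp: reduced_expression_def intro!: antisym normal_word_shortest(1)[OF assms])
qed

section \<open>A faithful model\<close>

subsection \<open>Additive operators\<close>

text \<open>
  The functions on which these operators act are thought of as functions on the orbit of a generic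
  point under permutations of its coordinates.
\<close>

typedef (overloaded) ('p, 'l::field) oper =
  "{F :: ('p \<Rightarrow> 'l) \<Rightarrow> 'p \<Rightarrow> 'l. \<forall>f g. F (\<lambda>p. f p + g p) = (\<lambda>p. F f p + F g p)}"
  morphisms app Oper
  by (intro exI[of _ "\<lambda>f. f"]) simp

setup_lifting type_definition_oper

instantiation oper :: (type, field) ring_1
begin

lift_definition zero_oper :: "('a, 'b) oper" is "\<lambda>f p. 0" by simp
lift_definition one_oper :: "('a, 'b) oper" is "\<lambda>f. f" by simp
lift_definition plus_oper :: "('a, 'b) oper \<Rightarrow> ('a, 'b) oper \<Rightarrow> ('a, 'b) oper"
  is "\<lambda>F G f p. F f p + G f p" by (simp add: algebra_simps)
lift_definition minus_oper :: "('a, 'b) oper \<Rightarrow> ('a, 'b) oper \<Rightarrow> ('a, 'b) oper"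
  is "\<lambda>F G f p. F f p - G f p" by (simp add: algebra_simps)
lift_definition uminus_oper :: "('a, 'b) oper \<Rightarrow> ('a, 'b) oper"
  is "\<lambda>F f p. - F f p" by (simp add: algebra_simps)
lift_definition times_oper :: "('a, 'b) oper \<Rightarrow> ('a, 'b) oper \<Rightarrow> ('a, 'b) oper"
  is "\<lambda>F G f. F (G f)" by simp

instance
proof
  show "(0 :: ('a, 'b) oper) \<noteq> 1"
    by transfer (auto simp: fun_eq_iff intro!: exI[of _ "\<lambda>_. 1"])
qed (transfer; simp add: fun_eq_iff algebra_simps)+

end

lemma app_simps [simp]:
  "app 0 f p = 0" "app 1 f p = f p"
  "app (A + B) f p = app A f p + app B f p"
  "app (A - B) f p = app A f p - app B f p"
  "app (- A) f p = - app A f p"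
  "app (A * B) f p = app A (app B f) p"
  by (transfer; simp)+

lemma app_sum [simp]: "app (sum F S) f p = (\<Sum>i\<in>S. app (F i) f p)"
  by (induction S rule: infinite_finite_induct) simp_all

lemma oper_eqI: "(\<And>f p. app A f p = app B f p) \<Longrightarrow> A = B"
  by (metis app_inject ext)

lift_definition diag :: "('p \<Rightarrow> 'l::field) \<Rightarrow> ('p, 'l) oper" is "\<lambda>d f p. d p * f p"
  by (simp add: algebra_simps)

lift_definition shift :: "'p::times \<Rightarrow> ('p, 'l::field) oper" is "\<lambda>w f v. f (v * w)"
  by simp

lemma app_diag [simp]: "app (diag d) f p = d p * f p"
  by transfer simp

lemma app_shift [simp]: "app (shift w) f v = f (v * w)"
  by transfer simp

subsection \<open>Renaming variables\<close>

unbundle permutation_syntax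

abbreviation adj :: "nat \<Rightarrow> nat perm"
  where "adj i \<equiv> \<langle>i \<leftrightarrow> i + 1\<rangle>"

definition rename :: "nat perm \<Rightarrow> 'k::field laurent \<Rightarrow> 'k laurent"
  where "rename v = lin_ext lconst (\<lambda>\<alpha>. lmon (Poly_Mapping.map_key (apply (inverse v)) \<alpha>))"

lemma inj_apply: "inj (apply (v :: 'a perm))"
  using bij_apply[of v] by (rule bij_is_inj)

lemma rename_add: "rename v (a + b) = rename v a + rename v b"
  and rename_diff: "rename v (a - b) = rename v a - rename v b"
  and rename_minus: "rename v (- a) = - rename v a"
  and rename_zero [simp]: "rename v 0 = 0"
  by (simp_all add: rename_def lconst.lin_ext_add lconst.lin_ext_diff lconst.lin_ext_minus)

lemma rename_mult: "rename v (a * b) = rename v a * rename v b"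
  unfolding rename_def
  by (rule lconst.lin_ext_mult) (simp_all add: map_key_plus inj_apply lmon_add mult.commute)

lemma rename_lmon: "rename v (lmon \<alpha>) = lmon (Poly_Mapping.map_key (apply (inverse v)) \<alpha>)"
  by (simp only: rename_def lmon_def lconst.lin_ext_single) (simp add: lconst.sc_one)

lemma rename_lconst [simp]: "rename v (lconst c) = lconst c"
proof -
  have "rename v (lconst c) = rename v (Poly_Mapping.single 0 c)"
    by (simp add: lconst_def)
  also have "\<dots> = lconst c"
    by (simp only: rename_def lconst.lin_ext_single) (simp add: inj_apply)
  finally show ?thesis .
qed

lemma rename_one [simp]: "rename v 1 = 1"
  using rename_lconst[of v 1] by (simp only: lconst.sc_one)

lemma map_key_single_perm:
  "Poly_Mapping.map_key (apply (inverse v)) (Poly_Mapping.single i k) = Poly_Mapping.single (v \<langle>$\<rangle> i) k"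
proof -
  have "inverse v \<langle>$\<rangle> (v \<langle>$\<rangle> i) = i"
    by (simp add: apply_inverse inv_f_f[OF inj_apply])
  then show ?thesis using map_key_single[OF inj_apply[of "inverse v"], of "v \<langle>$\<rangle> i" k] by simp
qed

lemma rename_lvar [simp]: "rename v (lvar i) = lvar (v \<langle>$\<rangle> i)"
  by (simp add: lvar_def rename_lmon map_key_single_perm)

lemma rename_linv [simp]: "rename v (linv i) = linv (v \<langle>$\<rangle> i)"
  by (simp add: linv_def rename_lmon map_key_single_perm)

lemma rename_rename: "rename v (rename w a) = rename (v * w) a"
  by (induction a rule: laurent_induct) (simp_all add: rename_add rename_mult apply_times)

lemma rename_id [simp]: "rename 1 a = a"
  by (induction a rule: laurent_induct) (simp_all add: rename_add rename_mult)

lemma rename_eq_0_iff [simp]: "rename v a = 0 \<longleftrightarrow> a = 0"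
  using rename_rename[of "inverse v" v a] by (auto simp: perm.left_inverse)

lemma rename_wall [simp]: "rename v (wall q i j) = wall q (v \<langle>$\<rangle> i) (v \<langle>$\<rangle> j)"
  by (simp add: wall_def rename_diff rename_mult)

lemma rename_wall_prod:
  "rename v (wall_prod q S) = wall_prod q (map_prod (apply v) (apply v) ` S)"
proof -
  have "rename v (\<Prod>x\<in>S. f x) = (\<Prod>x\<in>S. rename v (f x))" for f :: "nat \<times> nat \<Rightarrow> 'a::field laurent"
    by (induction S rule: infinite_finite_induct) (simp_all add: rename_mult)
  moreover have "inj_on (map_prod (apply v) (apply v)) S"
    by (rule inj_on_subset[OF prod.inj_map[OF inj_apply inj_apply]]) simp
  ultimately show ?thesis
    by (simp add: wall_prod_def prod.reindex case_prod_beta)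
qed

subsection \<open>The operators\<close>

type_synonym 'k model = "(nat perm, 'k laurent fract) oper"

text \<open>
  The value of \<open>a\<close> at the point \<open>(X\<^bsub>v 1\<^esub>, X\<^bsub>v 2\<^esub>, \<dots>)\<close> of the orbit.
\<close>

definition ev :: "nat perm \<Rightarrow> 'k::field laurent \<Rightarrow> 'k laurent fract"
  where "ev v a = Fraction_Field.Fract (rename v a) 1"

lemma ev_simps [simp]:
  "ev v (a + b) = ev v a + ev v b" "ev v (a - b) = ev v a - ev v b"
  "ev v (- a) = - ev v a" "ev v (a * b) = ev v a * ev v b"
  "ev v 0 = 0" "ev v 1 = 1"
  by (simp_all add: ev_def rename_add rename_diff rename_minus rename_mult
      Zero_fract_def One_fract_def)

lemma ev_eq_iff: "ev v a = ev v b \<longleftrightarrow> a = b"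
proof -
  have "ev v a = ev v b \<longleftrightarrow> rename v (a - b) = 0"
    by (simp add: ev_def eq_fract rename_diff del: rename_eq_0_iff)
  then show ?thesis by simp
qed

lemma ev_rename: "ev v (rename w a) = ev (v * w) a"
  by (simp add: ev_def rename_rename)

lemma ev_lvar_s:
  "ev (v * adj i) (lvar i) = ev v (lvar (i + 1))"
  "ev (v * adj i) (lvar (i + 1)) = ev v (lvar i)"
  "j \<noteq> i \<Longrightarrow> j \<noteq> i + 1 \<Longrightarrow> ev (v * adj i) (lvar j) = ev v (lvar j)"
  by (simp_all add: ev_def apply_times)

lemma ev_lconst: "ev v (lconst c) = ev 1 (lconst c)"
  by (simp add: ev_def)

definition \<iota> :: "'k::field laurent \<Rightarrow> 'k model"
  where "\<iota> a = diag (\<lambda>v. ev v a)"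

lemma app_\<iota> [simp]: "app (\<iota> a) f v = ev v a * f v"
  by (simp add: \<iota>_def)

lemma \<iota>_add: "\<iota> (a + b) = \<iota> a + \<iota> b"
  and \<iota>_diff: "\<iota> (a - b) = \<iota> a - \<iota> b"
  and \<iota>_minus: "\<iota> (- a) = - \<iota> a"
  and \<iota>_mult: "\<iota> (a * b) = \<iota> a * \<iota> b"
  and \<iota>_one: "\<iota> 1 = 1"
  by (intro oper_eqI; simp add: algebra_simps)+

lemma \<iota>_cancel:
  assumes "a \<noteq> 0" "\<iota> a * F = 0"
  shows "F = 0"
proof (rule oper_eqI)
  fix f v
  have "app (\<iota> a * F) f v = 0" by (simp only: assms(2) app_simps)
  moreover have "ev v a \<noteq> 0" using assms(1) ev_eq_iff[of v a 0] by simp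
  ultimately show "app F f v = app 0 f v" by simp
qed

lemma shift_\<iota>: "shift w * \<iota> a = \<iota> (rename w a) * shift w"
  by (rule oper_eqI) (simp add: ev_rename)

text \<open>
  With \<open>uc\<close> below, the coefficients of the Demazure--Lusztig operator
  \<open>T = tc \<cdot> s + uc\<close>; here \<open>a\<close> and \<open>b\<close> stand for \<open>X\<^sub>i\<close> and \<open>X\<^sub>i\<^sub>+\<^sub>1\<close>.
\<close>

definition tc :: "'l::field \<Rightarrow> 'l \<Rightarrow> 'l \<Rightarrow> 'l"
  where "tc q a b = (q * a - b) / (a - b)"

definition uc :: "'l::field \<Rightarrow> 'l \<Rightarrow> 'l \<Rightarrow> 'l"
  where "uc q a b = (1 - q) * b / (a - b)"

definition opT :: "'k::field \<Rightarrow> nat \<Rightarrow> 'k model"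
  where "opT q i =
    diag (\<lambda>v. tc (ev 1 (lconst q)) (ev v (lvar i)) (ev v (lvar (i + 1)))) * shift (adj i) +
    diag (\<lambda>v. uc (ev 1 (lconst q)) (ev v (lvar i)) (ev v (lvar (i + 1))))"

lemma app_opT: "app (opT q i) f v =
    tc (ev 1 (lconst q)) (ev v (lvar i)) (ev v (lvar (i + 1))) * f (v * adj i) +
    uc (ev 1 (lconst q)) (ev v (lvar i)) (ev v (lvar (i + 1))) * f v"
  by (simp add: opT_def)

lemma swap_cancel_left [simp]: "v * \<langle>i \<leftrightarrow> j\<rangle> * \<langle>i \<leftrightarrow> j\<rangle> = v"
  by (simp add: mult.assoc)

lemma adj_far: "i + 1 < j \<or> j + 1 < i \<Longrightarrow> adj i * adj j = adj j * adj i"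
  by transfer (auto simp: fun_eq_iff transpose_def)

lemma adj_braid: "adj i * adj (i + 1) * adj i = adj (i + 1) * adj i * adj (i + 1)"
  by transfer (auto simp: fun_eq_iff transpose_def)

lemma tc_uc_quadratic:
  assumes "a \<noteq> b"
  shows "tc q a b * tc q b a + uc q a b * uc q a b = (q - 1) * uc q a b + q"
    and "tc q a b * uc q b a + uc q a b * tc q a b = (q - 1) * tc q a b"
  using assms unfolding uc_def tc_def
  by (simp_all add: divide_simps) (simp_all add: algebra_simps)

text \<open>
  Expanding both sides of the braid relation and comparing the values at the six permutations of three
  coordinates leaves exactly these identities.
\<close>

lemma uc_braid:
  assumes "a \<noteq> b" "a \<noteq> c" "b \<noteq> c"
  shows "uc q a c * uc q b a + uc q a b * uc q b c = uc q b c * uc q a c"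
    and "uc q a b * uc q a c = uc q a c * uc q c b + uc q b c * uc q a b"
    and "tc q a b * uc q a c * tc q b a + uc q a b * uc q b c * uc q a b =
      tc q b c * uc q a c * tc q c b + uc q b c * uc q a b * uc q b c"
proof -
  show "uc q a c * uc q b a + uc q a b * uc q b c = uc q b c * uc q a c"
    and "uc q a b * uc q a c = uc q a c * uc q c b + uc q b c * uc q a b"
    using assms unfolding uc_def by (simp_all add: divide_simps) (simp_all add: algebra_simps)
  define x y z where "x = uc q a b" and "y = uc q b c" and "z = uc q a c"
  have e: "x * y = z * (x + y + 1 - q)"
    using assms unfolding uc_def x_def y_def z_def
    by (simp add: divide_simps) (simp add: algebra_simps)
  have t: "tc q a b * tc q b a = (q - 1) * x + q - x * x"
    "tc q b c * tc q c b = (q - 1) * y + q - y * y"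
    using tc_uc_quadratic(1)[OF assms(1), of q] tc_uc_quadratic(1)[OF assms(3), of q]
    by (simp_all add: x_def y_def eq_diff_eq)
  have "z * (tc q a b * tc q b a) + x * y * x - (z * (tc q b c * tc q c b) + x * y * y)
      = (x - y) * (x * y - z * (x + y + 1 - q))"
    unfolding t by (simp add: algebra_simps)
  also have "\<dots> = 0" by (simp add: e)
  finally show "tc q a b * uc q a c * tc q b a + uc q a b * uc q b c * uc q a b =
      tc q b c * uc q a c * tc q c b + uc q b c * uc q a b * uc q b c"
    by (simp add: mult_ac flip: x_def y_def z_def)
qed

lemma opT_quadratic: "opT q i * opT q i = \<iota> (lconst (q - 1)) * opT q i + \<iota> (lconst q)"
proof (rule oper_eqI)
  fix f :: "nat perm \<Rightarrow> 'a laurent fract" and v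
  let ?a = "ev v (lvar i) :: 'a laurent fract" and ?b = "ev v (lvar (i + 1)) :: 'a laurent fract" and ?q = "ev 1 (lconst q)"
  have "?a \<noteq> ?b" by (simp add: ev_eq_iff lvar_inject)
  note c = tc_uc_quadratic[OF this, of ?q]
  have "app (opT q i * opT q i) f v =
      (tc ?q ?a ?b * tc ?q ?b ?a + uc ?q ?a ?b * uc ?q ?a ?b) * f v
      + (tc ?q ?a ?b * uc ?q ?b ?a + uc ?q ?a ?b * tc ?q ?a ?b) * f (v * adj i)"
    by (simp add: app_opT ev_lvar_s[simplified] algebra_simps)
  also have "\<dots> = (?q - 1) * (tc ?q ?a ?b * f (v * adj i) + uc ?q ?a ?b * f v) + ?q * f v"
    unfolding c by (simp add: algebra_simps)
  also have "?q - 1 = ev v (lconst (q - 1))"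
    by (simp add: lconst.sc_diff lconst.sc_one ev_lconst[of v])
  finally show "app (opT q i * opT q i) f v
      = app (\<iota> (lconst (q - 1)) * opT q i + \<iota> (lconst q)) f v"
    by (simp add: app_opT ev_lconst[of v])
qed

lemma opT_far:
  assumes "i + 1 < j \<or> j + 1 < i"
  shows "opT q i * opT q j = opT q j * opT q i"
proof (rule oper_eqI)
  fix f :: "nat perm \<Rightarrow> 'a laurent fract" and v
  have v: "v * adj i * adj j = v * adj j * adj i" using adj_far[OF assms] by (metis mult.assoc)
  show "app (opT q i * opT q j) f v = app (opT q j * opT q i) f v"
    using assms v by (auto simp: app_opT ev_lvar_s[simplified] algebra_simps)
qed

lemma opT_braid: "opT q i * opT q (i + 1) * opT q i = opT q (i + 1) * opT q i * opT q (i + 1)"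
proof (rule oper_eqI)
  fix f :: "nat perm \<Rightarrow> 'a laurent fract" and v
  define a b c :: "'a laurent fract" where abc: "a = ev v (lvar i)" "b = ev v (lvar (i + 1))" "c = ev v (lvar (i + 2))"
  define Q where "Q = ev 1 (lconst q)"
  define t u where "t = tc Q" and "u = uc Q"
  have ne: "a \<noteq> b" "a \<noteq> c" "b \<noteq> c" by (simp_all add: abc ev_eq_iff lvar_inject)
  note br = uc_braid[OF ne, of Q, folded t_def u_def]
  define f1 f2 f12 f21 where "f1 = f (v * adj i)" and "f2 = f (v * adj (i + 1))"
    and "f12 = f (v * adj i * adj (i + 1))" and "f21 = f (v * adj (i + 1) * adj i)"
  define f0 where "f0 = f (v * adj i * adj (i + 1) * adj i)"
  have f0': "f (v * adj (i + 1) * adj i * adj (i + 1)) = f0"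
    using adj_braid[of i] by (simp add: f0_def mult.assoc)
  have coords:
    "ev (v * adj i) (lvar i) = b" "ev (v * adj i) (lvar (i + 1)) = a" "ev (v * adj i) (lvar (i + 2)) = c"
    "ev (v * adj (i + 1)) (lvar i) = a" "ev (v * adj (i + 1)) (lvar (i + 1)) = c"
    "ev (v * adj (i + 1)) (lvar (i + 2)) = b"
    by (simp_all add: abc ev_lvar_s[simplified])
  have coords2:
    "ev (v * adj i * adj (i + 1)) (lvar i) = b" "ev (v * adj i * adj (i + 1)) (lvar (i + 1)) = c"
    "ev (v * adj (i + 1) * adj i) (lvar (i + 1)) = a" "ev (v * adj (i + 1) * adj i) (lvar (i + 2)) = b"
    by (simp_all add: abc ev_lvar_s[simplified])
  have T1: "app (opT q i) g v' = t (ev v' (lvar i)) (ev v' (lvar (i + 1))) * g (v' * adj i)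
      + u (ev v' (lvar i)) (ev v' (lvar (i + 1))) * g v'" for g v'
    unfolding app_opT t_def u_def Q_def ..
  have T2: "app (opT q (i + 1)) g v' = t (ev v' (lvar (i + 1))) (ev v' (lvar (i + 2))) * g (v' * adj (i + 1))
      + u (ev v' (lvar (i + 1))) (ev v' (lvar (i + 2))) * g v'" for g v'
    unfolding app_opT t_def u_def Q_def by (simp add: numeral_2_eq_2)
  have L: "app (opT q i * opT q (i + 1) * opT q i) f v =
      t a b * (t a c * (t b c * f0 + u b c * f12) + u a c * (t b a * f v + u b a * f1))
      + u a b * (t b c * (t a c * f21 + u a c * f2) + u b c * (t a b * f1 + u a b * f v))"
    unfolding app_simps T1 T2 coords coords2 abc[symmetric] swap_cancel_left f0_def f12_def f21_def f1_def f2_def ..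
  have R: "app (opT q (i + 1) * opT q i * opT q (i + 1)) f v =
      t b c * (t a c * (t a b * f0 + u a b * f21) + u a c * (t c b * f v + u c b * f2))
      + u b c * (t a b * (t a c * f12 + u a c * f1) + u a b * (t b c * f2 + u b c * f v))"
    unfolding app_simps T1 T2 coords coords2 abc[symmetric] swap_cancel_left f0' f12_def f21_def f1_def f2_def ..
  have "app (opT q i * opT q (i + 1) * opT q i) f v =
      t a b * t a c * t b c * f0 + t a b * t a c * u b c * f12 + u a b * t b c * t a c * f21
      + t a b * (u a c * u b a + u a b * u b c) * f1 + t b c * (u a b * u a c) * f2
      + (t a b * u a c * t b a + u a b * u b c * u a b) * f v"
    unfolding L by (simp add: algebra_simps)
  also have "\<dots> = app (opT q (i + 1) * opT q i * opT q (i + 1)) f v"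
    unfolding R br by (simp add: algebra_simps)
  finally show "app (opT q i * opT q (i + 1) * opT q i) f v
      = app (opT q (i + 1) * opT q i * opT q (i + 1)) f v" .
qed

lemma uc_swap:
  assumes "a \<noteq> b"
  shows "uc q a b * a = b * uc q a b + (1 - q) * b"
  using assms unfolding uc_def by (simp add: divide_simps) (simp add: algebra_simps)

lemma ev_lconst_1_minus: "ev v (lconst (1 - q)) = 1 - ev 1 (lconst q)"
  by (simp add: lconst.sc_diff lconst.sc_one ev_lconst[of v])

lemma opT_\<iota>_lvar:
  "opT q i * \<iota> (lvar i) = \<iota> (lvar (i + 1)) * opT q i + \<iota> (lconst (1 - q) * lvar (i + 1))"
proof (rule oper_eqI)
  fix f :: "nat perm \<Rightarrow> 'a laurent fract" and v
  let ?a = "ev v (lvar i) :: 'a laurent fract" and ?b = "ev v (lvar (i + 1)) :: 'a laurent fract" and ?q = "ev 1 (lconst q)"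
  have "?a \<noteq> ?b" by (simp add: ev_eq_iff lvar_inject)
  note c = uc_swap[OF this, of ?q]
  have "app (opT q i * \<iota> (lvar i)) f v = tc ?q ?a ?b * ?b * f (v * adj i) + uc ?q ?a ?b * ?a * f v"
    by (simp add: app_opT ev_lvar_s[simplified])
  also have "\<dots> = app (\<iota> (lvar (i + 1)) * opT q i + \<iota> (lconst (1 - q) * lvar (i + 1))) f v"
    unfolding c by (simp add: app_opT ev_lconst_1_minus algebra_simps)
  finally show "app (opT q i * \<iota> (lvar i)) f v
    = app (\<iota> (lvar (i + 1)) * opT q i + \<iota> (lconst (1 - q) * lvar (i + 1))) f v" .
qed

lemma opT_\<iota>_sym:
  assumes "rename (adj i) a = a"
  shows "opT q i * \<iota> a = \<iota> a * opT q i"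
proof -
  have "ev (v * adj i) a = ev v a" for v using ev_rename[of v "adj i" a] assms by simp
  then show ?thesis by (intro oper_eqI) (simp add: app_opT algebra_simps)
qed

text \<open>
  The intertwiner: it permutes Laurent polynomials past itself without a correction term, and its
  square is a product of two walls.
\<close>

definition op\<tau> :: "'k::field \<Rightarrow> nat \<Rightarrow> 'k model"
  where "op\<tau> q i = \<iota> (wall q (i + 1) i) * shift (adj i)"

lemma op\<tau>_\<iota>: "op\<tau> q i * \<iota> a = \<iota> (rename (adj i) a) * op\<tau> q i"
proof -
  have "op\<tau> q i * \<iota> a = \<iota> (wall q (i + 1) i) * \<iota> (rename (adj i) a) * shift (adj i)"
    by (simp add: op\<tau>_def mult.assoc shift_\<iota>)
  also have "\<iota> (wall q (i + 1) i) * \<iota> (rename (adj i) a) = \<iota> (rename (adj i) a) * \<iota> (wall q (i + 1) i)"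
    by (metis \<iota>_mult mult.commute)
  finally show ?thesis by (simp add: op\<tau>_def mult.assoc)
qed

lemma op\<tau>_square: "op\<tau> q i * op\<tau> q i = \<iota> (wall q (i + 1) i * wall q i (i + 1))"
proof (rule oper_eqI)
  fix f :: "nat perm \<Rightarrow> 'a laurent fract" and v
  show "app (op\<tau> q i * op\<tau> q i) f v = app (\<iota> (wall q (i + 1) i * wall q i (i + 1))) f v"
    by (simp add: op\<tau>_def flip: ev_rename)
qed

lemma op\<tau>_eq:
  "op\<tau> q i = \<iota> (lvar i - lvar (i + 1)) * opT q i - \<iota> (lconst (1 - q) * lvar (i + 1))"
proof (rule oper_eqI)
  fix f :: "nat perm \<Rightarrow> 'a laurent fract" and v
  let ?a = "ev v (lvar i) :: 'a laurent fract" and ?b = "ev v (lvar (i + 1)) :: 'a laurent fract" and ?q = "ev 1 (lconst q)"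
  have "?a \<noteq> ?b" by (simp add: ev_eq_iff lvar_inject)
  then have "(?a - ?b) * tc ?q ?a ?b = ?q * ?a - ?b" "(?a - ?b) * uc ?q ?a ?b = (1 - ?q) * ?b"
    by (simp_all add: tc_def uc_def)
  then have "app (\<iota> (lvar i - lvar (i + 1)) * opT q i) f v
      = (?q * ?a - ?b) * f (v * adj i) + (1 - ?q) * ?b * f v"
    by (simp add: app_opT distrib_left flip: mult.assoc)
  then show "app (op\<tau> q i) f v
      = app (\<iota> (lvar i - lvar (i + 1)) * opT q i - \<iota> (lconst (1 - q) * lvar (i + 1))) f v"
    by (simp add: op\<tau>_def wall_def ev_lconst_1_minus ev_lconst[of v])
qed

subsection \<open>Independence\<close>

definition opTw :: "'k::field \<Rightarrow> nat list \<Rightarrow> 'k model"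
  where "opTw q u = prod_list (map (opT q) u)"

lemma opTw_simps [simp]:
  "opTw q [] = 1" "opTw q (i # u) = opT q i * opTw q u"
  "opTw q (u @ u') = opTw q u * opTw q u'"
  by (simp_all add: opTw_def)

lemma opTw_braid_eq: "u \<sim>\<^sub>b u' \<Longrightarrow> opTw q u = opTw q u'"
proof (induction rule: braid_eq.induct)
  case (far i j a b)
  then have "opTw q [i, j] = opTw q [j, i]" using opT_far by simp
  then show ?case by (simp only: opTw_simps(3))
next
  case (braid a i b)
  have "opTw q [i, i + 1, i] = opTw q [i + 1, i, i + 1]"
    using opT_braid[of q i] by (simp add: mult.assoc)
  then show ?case by (simp only: opTw_simps(3))
qed auto

definition perm_word :: "nat list \<Rightarrow> nat perm"
  where "perm_word u = prod_list (map adj u)"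

lemma perm_word_simps [simp]:
  "perm_word [] = 1" "perm_word (i # u) = adj i * perm_word u"
  by (simp_all add: perm_word_def)

lemma apply_perm_word: "apply (perm_word u) = perm_of_word u"
proof (induction u)
  case (Cons i u)
  have "apply (adj i) = Transposition.transpose i (i + 1)"
    by transfer simp
  then show ?case using Cons by (simp add: apply_times)
qed (simp add: apply_one)

lemma perm_word_eq_iff: "perm_word u = perm_word u' \<longleftrightarrow> perm_of_word u = perm_of_word u'"
  by (metis apply_perm_word perm_eqI)

text \<open>
  Every \<open>T\<^sub>i\<close> either moves the argument by \<open>s\<^sub>i\<close> or leaves it in place. The full product of moves gives the
  leading term, and its coefficient is a product of values \<open>tc\<close>, which do not vanish at a generic
  point; all other terms evaluate \<open>f\<close> at permutations with shorter expressions.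
\<close>

lemma opTw_leading_term:
  assumes "q \<noteq> 0" "set u \<subseteq> {1..<r}"
  shows "\<exists>c. c \<noteq> 0 \<and> (\<forall>f. (\<forall>w. set w \<subseteq> {1..<r} \<longrightarrow> length w < length u \<longrightarrow> f (v * perm_word w) = 0)
    \<longrightarrow> app (opTw q u) f v = c * f (v * perm_word u))"
  using assms(2)
proof (induction u arbitrary: v)
  case Nil
  then show ?case by (intro exI[of _ 1]) simp
next
  case (Cons i u)
  obtain c where c: "c \<noteq> 0" "\<And>f. (\<forall>w. set w \<subseteq> {1..<r} \<longrightarrow> length w < length u \<longrightarrow>
      f (v * adj i * perm_word w) = 0) \<Longrightarrow> app (opTw q u) f (v * adj i) = c * f (v * adj i * perm_word u)"
    using Cons.IH[of "v * adj i"] Cons.prems by auto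
  obtain d where d: "\<And>f. (\<forall>w. set w \<subseteq> {1..<r} \<longrightarrow> length w < length u \<longrightarrow>
      f (v * perm_word w) = 0) \<Longrightarrow> app (opTw q u) f v = d * f (v * perm_word u)"
    using Cons.IH[of v] Cons.prems by auto
  let ?t = "tc (ev 1 (lconst q)) (ev v (lvar i)) (ev v (lvar (i + 1)))"
  let ?u = "uc (ev 1 (lconst q)) (ev v (lvar i)) (ev v (lvar (i + 1)))"
  have "wall q (i + 1) i \<noteq> 0" by (rule wall_neq_0) (use assms in auto)
  then have "ev v (wall q (i + 1) i) \<noteq> 0" using ev_eq_iff[of v _ 0] by auto
  moreover have "ev v (lvar i) \<noteq> ev v (lvar (i + 1))" by (simp add: ev_eq_iff lvar_inject)
  ultimately have t: "?t \<noteq> 0" by (simp add: tc_def wall_def ev_lconst[of v])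
  have "app (opTw q (i # u)) f v = ?t * c * f (v * perm_word (i # u))"
    if f: "\<forall>w. set w \<subseteq> {1..<r} \<longrightarrow> length w < length (i # u) \<longrightarrow> f (v * perm_word w) = 0" for f
  proof -
    have "f (v * adj i * perm_word w) = 0" if "set w \<subseteq> {1..<r}" "length w < length u" for w
      using f[rule_format, of "i # w"] that Cons.prems by (simp add: mult.assoc)
    then have 1: "app (opTw q u) f (v * adj i) = c * f (v * adj i * perm_word u)"
      by (intro c(2)) auto
    have "app (opTw q u) f v = d * f (v * perm_word u)"
      using f by (intro d) auto
    also have "f (v * perm_word u) = 0" using f Cons.prems by auto
    finally show ?thesis using 1 by (simp add: app_opT mult.assoc)
  qed
  then show ?case using t c(1) by (intro exI[of _ "?t * c"]) auto
qed

text \<open>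
  Triangularity: a longest word with non-zero coefficient is isolated by evaluating on the indicator
  function of its permutation.
\<close>

lemma opTw_independent:
  assumes "q \<noteq> 0" and zero: "(\<Sum>u\<in>normal_words r. \<iota> (a u) * opTw q u) = 0" and u: "u \<in> normal_words r"
  shows "a u = 0"
proof (rule ccontr)
  let ?N = "{u \<in> normal_words r. a u \<noteq> 0}"
  assume "a u \<noteq> 0"
  then have N: "?N \<noteq> {}" using u by auto
  have fin: "finite ?N" by simp
  \<comment> \<open>A longest word among those with non-zero coefficient.\<close>
  have "Max (length ` ?N) \<in> length ` ?N" using N fin by (intro Max_in) auto
  then obtain u0 where u0': "u0 \<in> ?N" "Max (length ` ?N) = length u0" by auto
  have u0: "u0 \<in> normal_words r" "a u0 \<noteq> 0" "\<And>w. w \<in> ?N \<Longrightarrow> length w \<le> length u0"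
    using u0' fin Max_ge[of "length ` ?N"] by auto
  define f :: "nat perm \<Rightarrow> 'a laurent fract"
    where "f p = (if p = perm_word u0 then 1 else 0)" for p
  have supp: "f (1 * perm_word w) = 0" if "set w \<subseteq> {1..<r}" "length w < length u0" for w
    using normal_word_shortest(1)[OF u0(1) that(1)] that(2)
    by (auto simp: f_def perm_word_eq_iff)
  have tm: "\<exists>c. c \<noteq> 0 \<and> app (opTw q w) f 1 = c * f (perm_word w)" if w: "w \<in> ?N" for w
  proof -
    obtain c where "c \<noteq> 0" and
      c: "\<forall>f. (\<forall>x. set x \<subseteq> {1..<r} \<longrightarrow> length x < length w \<longrightarrow> f (1 * perm_word x) = 0)
        \<longrightarrow> app (opTw q w) f 1 = c * f (1 * perm_word w)"
      using opTw_leading_term[OF assms(1) normal_words_letters[of w r], of 1] w by auto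
    moreover have "\<forall>x. set x \<subseteq> {1..<r} \<longrightarrow> length x < length w \<longrightarrow> f (1 * perm_word x) = 0"
      using supp u0(3)[OF w] by (meson order_less_le_trans)
    ultimately show ?thesis by (metis mult_1)
  qed
  obtain c where c: "c \<noteq> 0" "app (opTw q u0) f 1 = c * f (perm_word u0)"
    using tm[of u0] u0 by auto
  have "app (\<Sum>u\<in>normal_words r. \<iota> (a u) * opTw q u) f 1
      = (\<Sum>u\<in>normal_words r. ev 1 (a u) * app (opTw q u) f 1)" by simp
  also have "\<dots> = (\<Sum>u\<in>{u0}. ev 1 (a u) * app (opTw q u) f 1)"
  proof (rule sum.mono_neutral_right)
    show "\<forall>w\<in>normal_words r - {u0}. ev 1 (a w) * app (opTw q w) f 1 = 0"
    proof
      fix w assume w: "w \<in> normal_words r - {u0}"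
      show "ev 1 (a w) * app (opTw q w) f 1 = 0"
      proof (cases "a w = 0")
        case False
        have "perm_word w \<noteq> perm_word u0"
          using w u0(1) inj_on_perm_of_word[of r] by (auto simp: perm_word_eq_iff dest: inj_onD)
        then show ?thesis using tm[of w] w False by (auto simp: f_def)
      qed simp
    qed
  qed (use u0 in auto)
  also have "\<dots> = ev 1 (a u0) * c" by (simp add: c f_def)
  finally have "ev 1 (a u0) * c = 0" by (simp only: zero app_simps)
  then show False using c(1) u0(2) ev_eq_iff[of 1 "a u0" 0] by simp
qed

section \<open>The Bernstein basis\<close>

subsection \<open>The free algebra\<close>

lemma free_algebra_simps [simp]:
  "p \<in> carrier (free_algebra G) \<longleftrightarrow> (\<forall>w\<in>Poly_Mapping.keys p. set (letters w) \<subseteq> G)"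
  "p \<otimes>\<^bsub>free_algebra G\<^esub> p' = p * p'" "\<one>\<^bsub>free_algebra G\<^esub> = 1"
  "p \<oplus>\<^bsub>free_algebra G\<^esub> p' = p + p'" "\<zero>\<^bsub>free_algebra G\<^esub> = 0"
  by (simp_all add: free_algebra_def)

lemma letters_plus [simp]: "letters (u + v) = letters u @ letters v"
  by (simp add: plus_free_monoid_def)

lemma letters_zero [simp]: "letters 0 = []"
  by (simp add: zero_free_monoid_def)

lemma free_algebra_closed:
  "p \<in> carrier (free_algebra G) \<Longrightarrow> p' \<in> carrier (free_algebra G) \<Longrightarrow> p + p' \<in> carrier (free_algebra G)"
  "p \<in> carrier (free_algebra G) \<Longrightarrow> p' \<in> carrier (free_algebra G) \<Longrightarrow> p * p' \<in> carrier (free_algebra G)"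
  "p \<in> carrier (free_algebra G) \<Longrightarrow> - p \<in> carrier (free_algebra G)"
  "p \<in> carrier (free_algebra G) \<Longrightarrow> p' \<in> carrier (free_algebra G) \<Longrightarrow> p - p' \<in> carrier (free_algebra G)"
  "1 \<in> carrier (free_algebra G)" "0 \<in> carrier (free_algebra G)" "const c \<in> carrier (free_algebra G)"
  "g \<in> G \<Longrightarrow> var g \<in> carrier (free_algebra G)"
proof -
  show add: "p + p' \<in> carrier (free_algebra G)"
    if "p \<in> carrier (free_algebra G)" "p' \<in> carrier (free_algebra G)" for p p'
    using that Poly_Mapping.keys_add[of p p'] by (auto simp: subset_iff)
  show "p * p' \<in> carrier (free_algebra G)"
    if "p \<in> carrier (free_algebra G)" "p' \<in> carrier (free_algebra G)"
    unfolding free_algebra_simps(1)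
  proof
    fix w assume "w \<in> Poly_Mapping.keys (p * p')"
    then obtain a b where "w = a + b" "a \<in> Poly_Mapping.keys p" "b \<in> Poly_Mapping.keys p'"
      using Poly_Mapping.keys_mult[of p p'] by blast
    then show "set (letters w) \<subseteq> G" using that by simp
  qed
  show minus: "- p \<in> carrier (free_algebra G)" if "p \<in> carrier (free_algebra G)" for p
    using that by (auto simp: in_keys_iff)
  show "p - p' \<in> carrier (free_algebra G)"
    if "p \<in> carrier (free_algebra G)" "p' \<in> carrier (free_algebra G)"
    using add[OF that(1) minus[OF that(2)]] by simp
qed (auto simp: const_def var_def split: if_splits)

lemma ring_free_algebra: "ring (free_algebra G)"
proof (rule ringI)
  note [simp del] = free_algebra_simps(1) and [simp] = free_algebra_closed
  show "abelian_group (free_algebra G)"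
  proof (rule abelian_groupI)
    fix p assume "p \<in> carrier (free_algebra G)"
    then show "\<exists>p'\<in>carrier (free_algebra G). p' \<oplus>\<^bsub>free_algebra G\<^esub> p = \<zero>\<^bsub>free_algebra G\<^esub>"
      by (intro bexI[of _ "- p"]) simp_all
  qed (simp_all add: add_ac)
  show "monoid (free_algebra G)"
    by (rule monoidI) (simp_all add: mult.assoc)
qed (simp_all add: distrib_right distrib_left del: free_algebra_simps(1))

lemma const_scalars: "scalars const"
  by standard (simp_all add: const_def single_add mult_single)

interpretation const: scalars const
  by (rule const_scalars)

lemma const_commute:  "const c * p = p * const c"
proof (induction p rule: poly_mapping_single_induct)
  case (single m d)
  show ?case by (simp add: const_def mult_single mult.commute)
qed (simp add: distrib_left distrib_right)

lemma const_left_commute: "const c * (p * p') = p * (const c * p')"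
  by (metis const_commute mult.assoc)

lemma free_alg_single: "Poly_Mapping.single w c = const c * Poly_Mapping.single w 1"
  by (simp add: const_def mult_single)

lemma free_alg_word_Cons: "Poly_Mapping.single (Word (g # w)) 1 = var g * Poly_Mapping.single (Word w) 1"
  by (simp add: var_def mult_single plus_free_monoid_def)

subsection \<open>Evaluation in the model\<close>

definition gen_op :: "'k::field \<Rightarrow> hecke_gen \<Rightarrow> 'k model"
  where "gen_op q g = (case g of GenT i \<Rightarrow> opT q i | GenX i \<Rightarrow> \<iota> (lvar i) | GenXinv i \<Rightarrow> \<iota> (linv i))"

definition \<rho> :: "'k::field \<Rightarrow> (hecke_gen, 'k) free_alg \<Rightarrow> 'k model"
  where "\<rho> q = lin_ext (\<lambda>c. \<iota> (lconst c)) (\<lambda>w. prod_list (map (gen_op q) (letters w)))"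

interpretation \<iota>_lconst: scalars "\<lambda>c. \<iota> (lconst c)"
  by standard (simp_all add: lconst.sc_add lconst.sc_mult lconst.sc_one \<iota>_add \<iota>_mult \<iota>_one)

lemma \<rho>_add: "\<rho> q (a + b) = \<rho> q a + \<rho> q b"
  and \<rho>_diff: "\<rho> q (a - b) = \<rho> q a - \<rho> q b"
  and \<rho>_minus: "\<rho> q (- a) = - \<rho> q a"
  and \<rho>_zero: "\<rho> q 0 = 0"
  and \<rho>_sum: "\<rho> q (sum f A) = (\<Sum>i\<in>A. \<rho> q (f i))"
  by (simp_all add: \<rho>_def \<iota>_lconst.lin_ext_add \<iota>_lconst.lin_ext_diff \<iota>_lconst.lin_ext_minus
      \<iota>_lconst.lin_ext_sum)

lemma \<iota>_commute: "\<iota> a * \<iota> b = \<iota> b * \<iota> a"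
  by (metis \<iota>_mult mult.commute)

lemma gen_op_const: "\<iota> (lconst c) * gen_op q g = gen_op q g * \<iota> (lconst c)"
  by (cases g) (simp_all add: gen_op_def \<iota>_commute opT_\<iota>_sym)

lemma \<rho>_mult: "\<rho> q (a * b) = \<rho> q a * \<rho> q b"
  unfolding \<rho>_def
proof (rule \<iota>_lconst.lin_ext_mult)
  fix c and w :: "hecke_gen free_monoid"
  show "\<iota> (lconst c) * prod_list (map (gen_op q) (letters w))
      = prod_list (map (gen_op q) (letters w)) * \<iota> (lconst c)"
  proof (induction "letters w" arbitrary: w)
    case (Cons g l)
    have l: "\<iota> (lconst c) * prod_list (map (gen_op q) l) = prod_list (map (gen_op q) l) * \<iota> (lconst c)"
      using Cons(1)[of "Word l"] by simp
    have "\<iota> (lconst c) * (gen_op q g * prod_list (map (gen_op q) l))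
        = gen_op q g * prod_list (map (gen_op q) l) * \<iota> (lconst c)"
      by (simp add: mult.assoc l[symmetric]) (simp add: gen_op_const flip: mult.assoc)
    then show ?case by (simp add: Cons(2)[symmetric])
  qed simp
qed simp

lemma \<rho>_const [simp]: "\<rho> q (const c) = \<iota> (lconst c)"
  unfolding const_def \<rho>_def by (simp add: \<iota>_lconst.lin_ext_single)

lemma \<rho>_one [simp]: "\<rho> q 1 = 1"
  using \<rho>_const[of q 1] by (simp only: const.sc_one lconst.sc_one \<iota>_one)

lemma \<rho>_var [simp]: "\<rho> q (var g) = gen_op q g"
  unfolding var_def \<rho>_def by (simp add: \<iota>_lconst.lin_ext_single lconst.sc_one \<iota>_one)

subsection \<open>Congruence modulo the relations\<close>

locale hecke_parameters =
  fixes r :: nat and q :: "'k::field"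
  assumes q_neq_0: "q \<noteq> 0"
begin

abbreviation F :: "(hecke_gen, 'k) free_alg ring" where "F \<equiv> free_algebra (hecke_gens r)"
abbreviation FA :: "(hecke_gen, 'k) free_alg set" where "FA \<equiv> carrier F"

definition I :: "(hecke_gen, 'k) free_alg set" where "I = genideal F (hecke_rels r q)"

lemma closed [simp]:
  "p \<in> FA \<Longrightarrow> p' \<in> FA \<Longrightarrow> p + p' \<in> FA" "p \<in> FA \<Longrightarrow> p' \<in> FA \<Longrightarrow> p * p' \<in> FA"
  "p \<in> FA \<Longrightarrow> - p \<in> FA" "p \<in> FA \<Longrightarrow> p' \<in> FA \<Longrightarrow> p - p' \<in> FA"
  "1 \<in> FA" "0 \<in> FA" "const c \<in> FA"
  "1 \<le> i \<Longrightarrow> i < r \<Longrightarrow> tT i \<in> FA"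
  "1 \<le> j \<Longrightarrow> j \<le> r \<Longrightarrow> tX j \<in> FA" "1 \<le> j \<Longrightarrow> j \<le> r \<Longrightarrow> tY j \<in> FA"
  by (simp_all add: free_algebra_closed hecke_gens_def del: free_algebra_simps(1))

declare free_algebra_simps(1) [simp del]

lemma rels_closed: "hecke_rels r q \<subseteq> FA"
  unfolding hecke_rels_def by auto

sublocale F: ring F
  by (rule ring_free_algebra)

sublocale I: ideal I F
  unfolding I_def by (rule F.genideal_ideal) (rule rels_closed)

lemma rel_in_I: "p \<in> hecke_rels r q \<Longrightarrow> p \<in> I"
  unfolding I_def using F.genideal_self[OF rels_closed] by auto

lemma I_closed:
  "a \<in> I \<Longrightarrow> b \<in> I \<Longrightarrow> a + b \<in> I" "a \<in> I \<Longrightarrow> p \<in> FA \<Longrightarrow> p * a \<in> I"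
  "a \<in> I \<Longrightarrow> p \<in> FA \<Longrightarrow> a * p \<in> I" "0 \<in> I" "a \<in> I \<Longrightarrow> a \<in> FA"
  using I.a_closed[of a b] I.I_l_closed[of a p] I.I_r_closed[of a p] I.zero_closed I.a_subset by auto

lemma I_minus: "a \<in> I \<Longrightarrow> - a \<in> I"
  using I_closed(2)[of a "- 1"] by simp

lemma I_diff: "a \<in> I \<Longrightarrow> b \<in> I \<Longrightarrow> a - b \<in> I"
  using I_closed(1)[of a "- b"] I_minus[of b] by simp

definition cong :: "(hecke_gen, 'k) free_alg \<Rightarrow> (hecke_gen, 'k) free_alg \<Rightarrow> bool" (infix "\<approx>\<^sub>I" 50)
  where "a \<approx>\<^sub>I b \<longleftrightarrow> a \<in> FA \<and> b \<in> FA \<and> a - b \<in> I"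

lemma cong_refl: "a \<in> FA \<Longrightarrow> a \<approx>\<^sub>I a"
  by (simp add: cong_def I_closed)

lemma cong_sym: "a \<approx>\<^sub>I b \<Longrightarrow> b \<approx>\<^sub>I a"
  using I_minus[of "a - b"] by (auto simp: cong_def)

lemma cong_trans [trans]: "a \<approx>\<^sub>I b \<Longrightarrow> b \<approx>\<^sub>I c \<Longrightarrow> a \<approx>\<^sub>I c"
  using I_closed(1)[of "a - b" "b - c"] by (auto simp: cong_def)

lemma cong_closed: "a \<approx>\<^sub>I b \<Longrightarrow> a \<in> FA" "a \<approx>\<^sub>I b \<Longrightarrow> b \<in> FA"
  by (simp_all add: cong_def)

lemma cong_add: "a \<approx>\<^sub>I b \<Longrightarrow> c \<approx>\<^sub>I d \<Longrightarrow> a + c \<approx>\<^sub>I b + d"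
  using I_closed(1)[of "a - b" "c - d"] by (auto simp: cong_def algebra_simps)

lemma cong_mult:
  assumes "a \<approx>\<^sub>I b" "c \<approx>\<^sub>I d"
  shows "a * c \<approx>\<^sub>I b * d"
proof -
  have "(a - b) * c \<in> I" "b * (c - d) \<in> I"
    using assms by (simp_all add: cong_def I_closed)
  then have "(a - b) * c + b * (c - d) \<in> I" by (rule I_closed(1))
  also have "(a - b) * c + b * (c - d) = a * c - b * d" by (simp add: algebra_simps)
  finally show ?thesis using assms by (simp add: cong_def)
qed

lemma cong_mult_left: "c \<approx>\<^sub>I d \<Longrightarrow> a \<in> FA \<Longrightarrow> a * c \<approx>\<^sub>I a * d"
  by (rule cong_mult[OF cong_refl])

lemma cong_mult_right: "a \<approx>\<^sub>I b \<Longrightarrow> c \<in> FA \<Longrightarrow> a * c \<approx>\<^sub>I b * c"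
  by (rule cong_mult[OF _ cong_refl])

lemma congI: "a - b \<in> hecke_rels r q \<Longrightarrow> a \<in> FA \<Longrightarrow> b \<in> FA \<Longrightarrow> a \<approx>\<^sub>I b"
  by (simp add: cong_def rel_in_I)

lemma T_quadratic:
  assumes "1 \<le> i" "i < r"
  shows "tT i * tT i \<approx>\<^sub>I const (q - 1) * tT i + const q"
proof -
  have i: "i \<in> {1..<r}" using assms by simp
  have "tT i * tT i - (const (q - 1) * tT i + const q) = (tT i + 1) * (tT i - const q)"
    by (simp add: const.sc_diff const.sc_one algebra_simps const_commute[of q "tT i"])
  also have "\<dots> \<in> hecke_rels r q" unfolding hecke_rels_def using i by blast
  finally show ?thesis using assms by (intro congI) auto
qed

lemma T_far:
  assumes "1 \<le> i" "i < r" "1 \<le> j" "j < r" "i + 1 < j \<or> j + 1 < i"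
  shows "tT i * tT j \<approx>\<^sub>I tT j * tT i"
proof (rule congI)
  have "i \<in> {1..<r}" "j \<in> {1..<r}" using assms by auto
  then show "tT i * tT j - tT j * tT i \<in> hecke_rels r q"
    unfolding hecke_rels_def using assms(5) by blast
qed (use assms in auto)

lemma T_braid:
  assumes "1 \<le> i" "i + 1 < r"
  shows "tT i * tT (i + 1) * tT i \<approx>\<^sub>I tT (i + 1) * tT i * tT (i + 1)"
proof (rule congI)
  show "tT i * tT (i + 1) * tT i - tT (i + 1) * tT i * tT (i + 1) \<in> hecke_rels r q"
    unfolding hecke_rels_def using assms by blast
qed (use assms in auto)

lemma X_Y:
  assumes "1 \<le> i" "i \<le> r"
  shows "tX i * tY i \<approx>\<^sub>I 1" "tY i * tX i \<approx>\<^sub>I 1"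
proof -
  have "i \<in> {1..r}" using assms by simp
  then have "tX i * tY i - 1 \<in> hecke_rels r q" "tY i * tX i - 1 \<in> hecke_rels r q"
    unfolding hecke_rels_def by blast+
  then show "tX i * tY i \<approx>\<^sub>I 1" "tY i * tX i \<approx>\<^sub>I 1" using assms by (auto intro!: congI)
qed

lemma X_X:
  assumes "1 \<le> i" "i \<le> r" "1 \<le> j" "j \<le> r"
  shows "tX i * tX j \<approx>\<^sub>I tX j * tX i"
proof (rule congI)
  have "i \<in> {1..r}" "j \<in> {1..r}" using assms by auto
  then show "tX i * tX j - tX j * tX i \<in> hecke_rels r q" unfolding hecke_rels_def by blast
qed (use assms in auto)

lemma X_T_far:
  assumes "1 \<le> i" "i < r" "1 \<le> j" "j \<le> r" "j \<noteq> i" "j \<noteq> i + 1"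
  shows "tX j * tT i \<approx>\<^sub>I tT i * tX j"
proof (rule congI)
  have "i \<in> {1..<r}" "j \<in> {1..r}" using assms by auto
  then show "tX j * tT i - tT i * tX j \<in> hecke_rels r q"
    unfolding hecke_rels_def using assms(5,6) by blast
qed (use assms in auto)

lemma T_X_T:
  assumes "1 \<le> i" "i < r"
  shows "tT i * tX i * tT i \<approx>\<^sub>I const q * tX (i + 1)"
proof (rule congI)
  have "i \<in> {1..<r}" using assms by auto
  then show "tT i * tX i * tT i - const q * tX (i + 1) \<in> hecke_rels r q"
    unfolding hecke_rels_def by blast
qed (use assms in auto)

text \<open>
  Commutation with \<open>x\<close> passes to its inverse; this yields the relations for \<open>X\<^sub>i\<^sup>-\<^sup>1\<close> from those for \<open>X\<^sub>i\<close>.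
\<close>

lemma commute_inverse:
  assumes xy: "x * y \<approx>\<^sub>I 1" "y * x \<approx>\<^sub>I 1" and xz: "x * z \<approx>\<^sub>I z * x"
    and cl: "x \<in> FA" "y \<in> FA" "z \<in> FA"
  shows "y * z \<approx>\<^sub>I z * y"
proof -
  have "y * z * (x * y) \<approx>\<^sub>I y * z * 1" using cl by (intro cong_mult_left xy) simp_all
  then have "y * z \<approx>\<^sub>I y * (z * x) * y" using cong_sym by (simp add: mult.assoc)
  also have "\<dots> \<approx>\<^sub>I y * (x * z) * y" using cl by (intro cong_mult_right cong_mult_left cong_sym[OF xz]) simp_all
  also have "\<dots> = (y * x) * (z * y)" by (simp add: mult.assoc)
  also have "\<dots> \<approx>\<^sub>I 1 * (z * y)" using cl by (intro cong_mult_right xy) simp_all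
  finally show ?thesis by simp
qed

lemma X_Y_commute:
  assumes "1 \<le> i" "i \<le> r" "1 \<le> j" "j \<le> r"
  shows "tY i * tX j \<approx>\<^sub>I tX j * tY i" "tY i * tY j \<approx>\<^sub>I tY j * tY i"
proof -
  have *: "tY i * tX j \<approx>\<^sub>I tX j * tY i" if "1 \<le> i" "i \<le> r" "1 \<le> j" "j \<le> r" for i j
    by (rule commute_inverse[OF X_Y[OF that(1,2)] X_X[OF that]]) (use that in auto)
  show "tY i * tX j \<approx>\<^sub>I tX j * tY i" by (rule *[OF assms])
  show "tY i * tY j \<approx>\<^sub>I tY j * tY i"
    by (rule commute_inverse[OF X_Y[OF assms(1,2)] cong_sym[OF *[OF assms(3,4,1,2)]]]) (use assms in auto)
qed

lemma const_cancel:
  assumes "const q * a \<approx>\<^sub>I const q * b" "a \<in> FA" "b \<in> FA"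
  shows "a \<approx>\<^sub>I b"
proof -
  have "const (inverse q) * (const q * a) \<approx>\<^sub>I const (inverse q) * (const q * b)"
    by (rule cong_mult_left[OF assms(1)]) simp
  moreover have "const (inverse q) * (const q * c) = c" for c :: "(hecke_gen, 'k) free_alg"
  proof -
    have "const (inverse q) * const q = (1 :: (hecke_gen, 'k) free_alg)"
      using q_neq_0 by (simp add: const.sc_one flip: const.sc_mult)
    then show ?thesis by (simp flip: mult.assoc)
  qed
  ultimately show ?thesis by simp
qed

text \<open>
  The Bernstein relations. Multiply \<open>T\<^sub>iX\<^sub>iT\<^sub>i = qX\<^sub>i\<^sub>+\<^sub>1\<close> by \<open>T\<^sub>i\<close> on the right or on the left, use the quadratic
  relation, and divide by \<open>q\<close>.
\<close>

lemma T_X: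
  assumes i: "1 \<le> i" "i < r"
  shows "tT i * tX i \<approx>\<^sub>I tX (i + 1) * tT i + const (1 - q) * tX (i + 1)"
    and "tT i * tX (i + 1) \<approx>\<^sub>I tX i * tT i - const (1 - q) * tX (i + 1)"
proof -
  define t x x' :: "(hecke_gen, 'k) free_alg" where "t = tT i" and "x = tX i" and "x' = tX (i + 1)"
  have cl: "t \<in> FA" "x \<in> FA" "x' \<in> FA" using i by (auto simp: t_def x_def x'_def)
  have A: "t * x * t - const q * x' \<in> I" using T_X_T[OF i] by (simp add: cong_def t_def x_def x'_def)
  have B: "t * t - (const (q - 1) * t + const q) \<in> I" using T_quadratic[OF i] by (simp add: cong_def t_def)
  note cc = const_commute[of q t] const_commute[of q x] const_commute[of q x']
    const_left_commute[of q t] const_left_commute[of q x] const_left_commute[of q x']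
  have "(t * x * t - const q * x') * t - t * x * (t * t - (const (q - 1) * t + const q))
      - const (q - 1) * (t * x * t - const q * x') \<in> I"
    by (intro I_diff I_closed(2)[OF A] I_closed(2)[OF B] I_closed(3)[OF A] I_closed(3)[OF B]) (simp_all add: cl)
  also have "(t * x * t - const q * x') * t - t * x * (t * t - (const (q - 1) * t + const q))
      - const (q - 1) * (t * x * t - const q * x')
      = const q * (t * x) - const q * (x' * t + const (1 - q) * x')"
    by (simp add: const.sc_diff const.sc_one algebra_simps cc)
  finally have "const q * (t * x) \<approx>\<^sub>I const q * (x' * t + const (1 - q) * x')"
    using cl by (simp add: cong_def)
  then show "tT i * tX i \<approx>\<^sub>I tX (i + 1) * tT i + const (1 - q) * tX (i + 1)"
    using const_cancel cl by (simp add: t_def x_def x'_def)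
  have "t * (t * x * t - const q * x') - (t * t - (const (q - 1) * t + const q)) * (x * t)
      - const (q - 1) * (t * x * t - const q * x') \<in> I"
    by (intro I_diff I_closed(2)[OF A] I_closed(2)[OF B] I_closed(3)[OF A] I_closed(3)[OF B]) (simp_all add: cl)
  also have "t * (t * x * t - const q * x') - (t * t - (const (q - 1) * t + const q)) * (x * t)
      - const (q - 1) * (t * x * t - const q * x')
      = const q * (x * t - const (1 - q) * x') - const q * (t * x')"
    by (simp add: const.sc_diff const.sc_one algebra_simps cc)
  finally have "const q * (x * t - const (1 - q) * x') \<approx>\<^sub>I const q * (t * x')"
    using cl by (simp add: cong_def)
  then show "tT i * tX (i + 1) \<approx>\<^sub>I tX i * tT i - const (1 - q) * tX (i + 1)"
    using const_cancel[THEN cong_sym] cl by (simp add: t_def x_def x'_def)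
qed

lemma T_Y:
  assumes i: "1 \<le> i" "i < r"
  shows "tT i * tY i \<approx>\<^sub>I tY (i + 1) * tT i - const (1 - q) * tY i"
    and "tT i * tY (i + 1) \<approx>\<^sub>I tY i * tT i + const (1 - q) * tY i"
proof -
  define t x x' y y' :: "(hecke_gen, 'k) free_alg"
    where "t = tT i" and "x = tX i" and "x' = tX (i + 1)" and "y = tY i" and "y' = tY (i + 1)"
  note defs = t_def x_def x'_def y_def y'_def
  have cl: "t \<in> FA" "x \<in> FA" "x' \<in> FA" "y \<in> FA" "y' \<in> FA" using i by (auto simp: defs)
  have xy: "x * y - 1 \<in> I" "y * x - 1 \<in> I" "x' * y' - 1 \<in> I" "y' * x' - 1 \<in> I"
    using X_Y[of i] X_Y[of "i + 1"] i by (auto simp: defs cong_def)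
  note cc = const_commute[of q t] const_commute[of q y] const_commute[of q x] const_commute[of q x'] const_commute[of q y']
    const_left_commute[of q t] const_left_commute[of q x] const_left_commute[of q x']
    const_left_commute[of q y] const_left_commute[of q y']
  have A: "t * x - (x' * t + const (1 - q) * x') \<in> I" and B: "t * x' - (x * t - const (1 - q) * x') \<in> I"
    using T_X[OF i] by (auto simp: defs cong_def)
  have "y' * (t * x - (x' * t + const (1 - q) * x')) * y - y' * t * (x * y - 1)
      + (y' * x' - 1) * (t * y) + const (1 - q) * ((y' * x' - 1) * y) \<in> I"
    by (intro I_diff I_closed(1) I_closed(2)[OF xy(1)] I_closed(3)[OF xy(4)] I_closed(2)[OF I_closed(3)[OF xy(4)]]
        I_closed(3)[OF I_closed(2)[OF A]]) (simp_all add: cl)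
  also have "y' * (t * x - (x' * t + const (1 - q) * x')) * y - y' * t * (x * y - 1)
      + (y' * x' - 1) * (t * y) + const (1 - q) * ((y' * x' - 1) * y)
      = (y' * t - const (1 - q) * y) - t * y"
    by (simp add: const.sc_diff const.sc_one algebra_simps cc)
  finally have "y' * t - const (1 - q) * y \<approx>\<^sub>I t * y" using cl by (simp add: cong_def)
  then show "tT i * tY i \<approx>\<^sub>I tY (i + 1) * tT i - const (1 - q) * tY i"
    unfolding defs by (rule cong_sym)
  have "y * (t * x' - (x * t - const (1 - q) * x')) * y' - y * t * (x' * y' - 1)
      + (y * x - 1) * (t * y') - const (1 - q) * (y * (x' * y' - 1)) \<in> I"
    by (intro I_diff I_closed(1) I_closed(2)[OF xy(3)] I_closed(3)[OF xy(2)] I_closed(2)[OF I_closed(2)[OF xy(3)]]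
        I_closed(3)[OF I_closed(2)[OF B]]) (simp_all add: cl)
  also have "y * (t * x' - (x * t - const (1 - q) * x')) * y' - y * t * (x' * y' - 1)
      + (y * x - 1) * (t * y') - const (1 - q) * (y * (x' * y' - 1))
      = (y * t + const (1 - q) * y) - t * y'"
    by (simp add: const.sc_diff const.sc_one algebra_simps cc)
  finally have "y * t + const (1 - q) * y \<approx>\<^sub>I t * y'" using cl by (simp add: cong_def)
  then show "tT i * tY (i + 1) \<approx>\<^sub>I tY i * tT i + const (1 - q) * tY i"
    unfolding defs by (rule cong_sym)
qed

lemma Y_T_far:
  assumes "1 \<le> i" "i < r" "1 \<le> j" "j \<le> r" "j \<noteq> i" "j \<noteq> i + 1"
  shows "tY j * tT i \<approx>\<^sub>I tT i * tY j"
  by (rule commute_inverse[OF X_Y[OF assms(3,4)] X_T_far[OF assms]]) (use assms in auto)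

end

subsection \<open>Laurent polynomials inside the free algebra\<close>

definition restr :: "nat list \<Rightarrow> (nat \<Rightarrow>\<^sub>0 int) \<Rightarrow> (nat \<Rightarrow>\<^sub>0 int)"
  where "restr js \<alpha> = (\<Sum>j\<leftarrow>js. Poly_Mapping.single j (Poly_Mapping.lookup \<alpha> j))"

lemma restr_simps [simp]:
  "restr [] \<alpha> = 0"
  "restr (j # js) \<alpha> = Poly_Mapping.single j (Poly_Mapping.lookup \<alpha> j) + restr js \<alpha>"
  by (simp_all add: restr_def)

lemma restr_add: "restr js (\<alpha> + \<beta>) = restr js \<alpha> + restr js \<beta>"
  by (induction js) (simp_all add: lookup_add single_add add_ac)

lemma lookup_restr:
  "distinct js \<Longrightarrow> Poly_Mapping.lookup (restr js \<alpha>) j = (if j \<in> set js then Poly_Mapping.lookup \<alpha> j else 0)"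
  by (induction js) (auto simp: lookup_add lookup_single when_def)

context hecke_parameters
begin

definition vars :: "nat list" where "vars = [1..<Suc r]"

lemma vars [simp]: "set vars = {1..r}" "distinct vars"
  by (auto simp: vars_def)

text \<open>
  Setting the variables outside \<open>{1..r}\<close> to \<open>1\<close>. The fixed points are the Laurent polynomials that come
  from the Hecke algebra.
\<close>

definition res :: "'k laurent \<Rightarrow> 'k laurent"
  where "res = lin_ext lconst (\<lambda>\<alpha>. lmon (restr vars \<alpha>))"

lemma res_add: "res (a + b) = res a + res b"
  and res_diff: "res (a - b) = res a - res b"
  and res_zero [simp]: "res 0 = 0"
  by (simp_all add: res_def lconst.lin_ext_add lconst.lin_ext_diff)

lemma res_mult: "res (a * b) = res a * res b"
  unfolding res_def by (rule lconst.lin_ext_mult) (simp_all only: restr_add lmon_add mult.commute)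

lemma res_single: "res (Poly_Mapping.single \<alpha> c) = Poly_Mapping.single (restr vars \<alpha>) c"
  by (simp only: res_def lconst.lin_ext_single) (simp only: single_eq_lconst_lmon)

lemma res_lconst [simp]: "res (lconst c) = lconst c"
  unfolding lconst_def res_single by (rule arg_cong2[where f = Poly_Mapping.single])
    (rule poly_mapping_eqI, simp_all add: lookup_restr)

lemma res_one [simp]: "res 1 = 1"
  using res_lconst[of 1] by (simp only: lconst.sc_one)

lemma res_lvar [simp]:
  assumes "1 \<le> i" "i \<le> r"
  shows "res (lvar i) = lvar i"
proof -
  have "restr vars (Poly_Mapping.single i 1) = Poly_Mapping.single i 1"
    by (rule poly_mapping_eqI) (use assms in \<open>auto simp: lookup_restr lookup_single when_def\<close>)
  then show ?thesis by (simp only: lvar_def lmon_def res_single)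
qed

lemma res_res [simp]: "res (res a) = res a"
proof -
  have e: "restr vars (restr vars \<alpha>) = restr vars \<alpha>" for \<alpha>
    by (rule poly_mapping_eqI) (auto simp: lookup_restr)
  show ?thesis
    by (rule additive_eq_on_singles[of "\<lambda>a. res (res a)" res]) (simp_all only: res_add res_single e)
qed

definition xpow :: "nat \<Rightarrow> int \<Rightarrow> (hecke_gen, 'k) free_alg"
  where "xpow j k = (if 0 \<le> k then tX j ^ nat k else tY j ^ nat (- k))"

definition xmon :: "nat list \<Rightarrow> (nat \<Rightarrow>\<^sub>0 int) \<Rightarrow> (hecke_gen, 'k) free_alg"
  where "xmon js \<alpha> = prod_list (map (\<lambda>j. xpow j (Poly_Mapping.lookup \<alpha> j)) js)"

text \<open>
  A linear section of the evaluation on Laurent polynomials: monomials become words with the variables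
  in increasing order. Modulo the relations it is compatible with multiplication by \<open>X\<^sub>i\<close> and \<open>X\<^sub>i\<^sup>-\<^sup>1\<close>.
\<close>

definition \<kappa> :: "'k laurent \<Rightarrow> (hecke_gen, 'k) free_alg"
  where "\<kappa> = lin_ext const (xmon vars)"

lemma power_closed: "p \<in> FA \<Longrightarrow> p ^ n \<in> FA"
  by (induction n) simp_all

lemma xpow_closed [simp]: "1 \<le> j \<Longrightarrow> j \<le> r \<Longrightarrow> xpow j k \<in> FA"
  by (simp add: xpow_def power_closed)

lemma xmon_closed: "set js \<subseteq> {1..r} \<Longrightarrow> xmon js \<alpha> \<in> FA"
  by (induction js) (simp_all add: xmon_def)

lemma xmon_vars_closed [simp]: "xmon vars \<alpha> \<in> FA"
  by (rule xmon_closed) auto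

lemma \<kappa>_add: "\<kappa> (a + b) = \<kappa> a + \<kappa> b"
  and \<kappa>_zero [simp]: "\<kappa> 0 = 0"
  by (simp_all add: \<kappa>_def const.lin_ext_add)

lemma \<kappa>_single: "\<kappa> (Poly_Mapping.single \<alpha> c) = const c * xmon vars \<alpha>"
  by (simp only: \<kappa>_def const.lin_ext_single)

lemma \<kappa>_closed [simp]: "\<kappa> a \<in> FA"
  by (induction a rule: poly_mapping_single_induct) (simp_all add: \<kappa>_single \<kappa>_add)

lemma \<kappa>_one [simp]: "\<kappa> 1 = 1"
proof -
  have "xmon js 0 = 1" for js by (induction js) (simp_all add: xmon_def xpow_def)
  then show ?thesis using \<kappa>_single[of 0 1] by (simp add: const.sc_one)
qed

lemma \<kappa>_const_mult: "\<kappa> (lconst c * a) = const c * \<kappa> a"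
proof (induction a rule: poly_mapping_single_induct)
  case (single \<alpha> d)
  have "lconst c * Poly_Mapping.single \<alpha> d = Poly_Mapping.single \<alpha> (c * d)"
    by (simp add: lconst_def mult_single)
  then show ?case by (simp only: \<kappa>_single const.sc_mult mult.assoc)
qed (simp add: distrib_left \<kappa>_add)

lemma \<kappa>_res: "\<kappa> (res a) = \<kappa> a"
proof -
  have e: "xmon vars (restr vars \<alpha>) = xmon vars \<alpha>" for \<alpha>
    unfolding xmon_def
    by (rule arg_cong[where f = prod_list], rule map_cong)
      (simp_all add: lookup_restr)
  show ?thesis
    by (rule additive_eq_on_singles[of "\<lambda>a. \<kappa> (res a)" \<kappa>])
      (simp_all only: \<kappa>_add res_add res_single \<kappa>_single e)
qed

lemma \<rho>_power: "\<rho> q (p ^ n) = \<rho> q p ^ n"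
  by (induction n) (simp_all add: \<rho>_mult)

lemma \<iota>_power: "\<iota> (a ^ n) = \<iota> a ^ n"
  by (induction n) (simp_all add: \<iota>_mult \<iota>_one)

lemma lmon_power: "lmon (Poly_Mapping.single j k) ^ n = lmon (Poly_Mapping.single j (int n * k))"
  by (induction n) (simp_all add: algebra_simps single_add lmon_add)

lemma \<rho>_xpow: "\<rho> q (xpow j k) = \<iota> (lmon (Poly_Mapping.single j k))"
proof (cases "0 \<le> k")
  case True
  have "\<rho> q (xpow j k) = \<iota> (lvar j ^ nat k)"
    using True by (simp add: xpow_def \<rho>_power gen_op_def \<iota>_power)
  also have "lvar j ^ nat k = (lmon (Poly_Mapping.single j k) :: 'k laurent)"
    using True by (simp add: lvar_def lmon_power)
  finally show ?thesis .
next
  case False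
  have "\<rho> q (xpow j k) = \<iota> (linv j ^ nat (- k))"
    using False by (simp add: xpow_def \<rho>_power gen_op_def \<iota>_power)
  also have "linv j ^ nat (- k) = (lmon (Poly_Mapping.single j k) :: 'k laurent)"
    using False by (simp add: linv_def lmon_power)
  finally show ?thesis .
qed

lemma \<rho>_\<kappa>: "\<rho> q (\<kappa> a) = \<iota> (res a)"
proof -
  have mon: "\<rho> q (xmon js \<alpha>) = \<iota> (lmon (restr js \<alpha>))" for js \<alpha>
    by (induction js) (simp_all add: xmon_def \<rho>_mult \<rho>_xpow \<iota>_mult lmon_add \<iota>_one)
  have single: "\<iota> (Poly_Mapping.single \<alpha> c) = \<iota> (lconst c) * \<iota> (lmon \<alpha>)" for \<alpha> and c :: 'k
    by (simp only: single_eq_lconst_lmon \<iota>_mult)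
  show ?thesis
    by (rule additive_eq_on_singles[of "\<lambda>a. \<rho> q (\<kappa> a)" "\<lambda>a. \<iota> (res a)"])
      (simp_all only: \<kappa>_add \<rho>_add res_add \<iota>_add \<kappa>_single \<rho>_mult \<rho>_const mon res_single single)
qed

lemma XY_comm:
  assumes "1 \<le> i" "i \<le> r" "1 \<le> j" "j \<le> r"
  shows "tX i * xpow j k \<approx>\<^sub>I xpow j k * tX i"
proof -
  have pow: "tX i * p ^ n \<approx>\<^sub>I p ^ n * tX i" if p: "tX i * p \<approx>\<^sub>I p * tX i" "p \<in> FA" for p n
  proof (induction n)
    case 0
    show ?case using assms by (simp add: cong_refl)
  next
    case (Suc n)
    have "tX i * p ^ Suc n = (tX i * p) * p ^ n" by (simp add: mult.assoc)
    also have "\<dots> \<approx>\<^sub>I (p * tX i) * p ^ n"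
      by (rule cong_mult_right[OF p(1)]) (simp add: power_closed p)
    also have "\<dots> = p * (tX i * p ^ n)" by (simp add: mult.assoc)
    also have "\<dots> \<approx>\<^sub>I p * (p ^ n * tX i)"
      by (rule cong_mult_left[OF Suc p(2)])
    also have "\<dots> = p ^ Suc n * tX i" by (simp add: mult.assoc)
    finally show ?case .
  qed
  show ?thesis unfolding xpow_def
    using pow[OF X_X[OF assms]] pow[OF cong_sym[OF X_Y_commute(1)[OF assms(3,4,1,2)]]] assms
    by auto
qed

lemma X_xpow:
  assumes "1 \<le> i" "i \<le> r"
  shows "tX i * xpow i k \<approx>\<^sub>I xpow i (k + 1)"
proof (cases "0 \<le> k")
  case True
  then have "tX i * xpow i k = xpow i (k + 1)" by (simp add: xpow_def nat_add_distrib)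
  then show ?thesis using assms by (simp add: cong_refl)
next
  case False
  define n where "n = nat (- k - 1)"
  have k: "k = - int (Suc n)" using False by (simp add: n_def)
  have "tX i * xpow i k = (tX i * tY i) * tY i ^ n" by (simp add: xpow_def k mult.assoc nat_add_distrib)
  also have "\<dots> \<approx>\<^sub>I 1 * tY i ^ n"
    by (rule cong_mult_right[OF X_Y(1)[OF assms]], rule power_closed) (use assms in simp)
  also have "1 * tY i ^ n = xpow i (k + 1)" by (cases n) (simp_all add: xpow_def k nat_add_distrib)
  finally show ?thesis .
qed

lemma X_xmon:
  assumes "distinct js" "set js \<subseteq> {1..r}" "i \<in> set js"
  shows "tX i * xmon js \<alpha> \<approx>\<^sub>I xmon js (\<alpha> + Poly_Mapping.single i 1)"
  using assms
proof (induction js)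
  case (Cons j js)
  let ?\<alpha> = "\<alpha> + Poly_Mapping.single i 1"
  have cl: "xmon js \<alpha> \<in> FA" "xpow j k \<in> FA" for k using Cons.prems by (simp_all add: xmon_closed)
  have i: "1 \<le> i" "i \<le> r" "1 \<le> j" "j \<le> r" using Cons.prems by auto
  have e: "xmon (j # js) \<beta> = xpow j (Poly_Mapping.lookup \<beta> j) * xmon js \<beta>" for \<beta>
    by (simp add: xmon_def)
  show ?case
  proof (cases "i = j")
    case True
    have "xmon js ?\<alpha> = xmon js \<alpha>"
      using Cons.prems True unfolding xmon_def
      by (intro arg_cong[where f = prod_list] map_cong) (auto simp: lookup_add lookup_single when_def)
    moreover have "tX i * xpow i (Poly_Mapping.lookup \<alpha> i) * xmon js \<alpha>
        \<approx>\<^sub>I xpow i (Poly_Mapping.lookup \<alpha> i + 1) * xmon js \<alpha>"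
      by (rule cong_mult_right[OF X_xpow[OF i(1,2)] cl(1)])
    ultimately show ?thesis by (simp add: e True lookup_add mult.assoc)
  next
    case False
    then have IH: "tX i * xmon js \<alpha> \<approx>\<^sub>I xmon js ?\<alpha>" using Cons by auto
    have "tX i * xmon (j # js) \<alpha> = tX i * xpow j (Poly_Mapping.lookup \<alpha> j) * xmon js \<alpha>"
      by (simp add: e mult.assoc)
    also have "\<dots> \<approx>\<^sub>I xpow j (Poly_Mapping.lookup \<alpha> j) * tX i * xmon js \<alpha>"
      by (rule cong_mult_right[OF XY_comm[OF i] cl(1)])
    also have "\<dots> = xpow j (Poly_Mapping.lookup \<alpha> j) * (tX i * xmon js \<alpha>)"
      by (simp add: mult.assoc)
    also have "\<dots> \<approx>\<^sub>I xpow j (Poly_Mapping.lookup \<alpha> j) * xmon js ?\<alpha>"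
      by (rule cong_mult_left[OF IH cl(2)])
    also have "\<dots> = xmon (j # js) ?\<alpha>" using False by (simp add: e lookup_add lookup_single)
    finally show ?thesis .
  qed
qed simp

lemma X_\<kappa>:
  assumes "1 \<le> i" "i \<le> r"
  shows "tX i * \<kappa> a \<approx>\<^sub>I \<kappa> (lvar i * a)"
proof (induction a rule: poly_mapping_single_induct)
  case (single \<alpha> c)
  have "tX i * \<kappa> (Poly_Mapping.single \<alpha> c) = const c * (tX i * xmon vars \<alpha>)"
    by (simp only: \<kappa>_single const_left_commute)
  also have "\<dots> \<approx>\<^sub>I const c * xmon vars (\<alpha> + Poly_Mapping.single i 1)"
    by (rule cong_mult_left, rule X_xmon) (use assms in auto)
  also have "\<dots> = \<kappa> (lvar i * Poly_Mapping.single \<alpha> c)"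
    by (simp only: \<kappa>_single lvar_def lmon_def mult_single add.commute mult_1)
  finally show ?case .
qed (simp add: distrib_left \<kappa>_add cong_add)

lemma Y_\<kappa>:
  assumes "1 \<le> i" "i \<le> r"
  shows "tY i * \<kappa> a \<approx>\<^sub>I \<kappa> (linv i * a)"
proof -
  have "tX i * \<kappa> (linv i * a) \<approx>\<^sub>I \<kappa> (lvar i * (linv i * a))"
    by (rule X_\<kappa>[OF assms])
  also have "lvar i * (linv i * a) = a" by (metis lvar_linv mult.assoc mult_1)
  finally have *: "tX i * \<kappa> (linv i * a) \<approx>\<^sub>I \<kappa> a" .
  have "tY i * \<kappa> a \<approx>\<^sub>I tY i * (tX i * \<kappa> (linv i * a))"
    by (rule cong_mult_left[OF cong_sym[OF *]]) (use assms in simp)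
  also have "\<dots> = tY i * tX i * \<kappa> (linv i * a)" by (simp add: mult.assoc)
  also have "\<dots> \<approx>\<^sub>I 1 * \<kappa> (linv i * a)"
    by (rule cong_mult_right[OF X_Y(2)[OF assms]]) simp
  finally show ?thesis by simp
qed

text \<open>
  The elements \<open>p\<close> of the commutative part past which \<open>T\<^sub>i\<close> can be moved. The first conjunct makes the
  property inductive: the correction terms in \<open>T\<^sub>iX\<^sub>jp\<close> are multiples of \<open>p\<close> itself.
\<close>

definition movable :: "nat \<Rightarrow> (hecke_gen, 'k) free_alg \<Rightarrow> bool"
  where "movable i p \<longleftrightarrow> (\<exists>b. p \<approx>\<^sub>I \<kappa> b) \<and> (\<exists>a' a''. tT i * p \<approx>\<^sub>I \<kappa> a' * tT i + \<kappa> a'')"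

lemma movable_step:
  assumes i: "1 \<le> i" "i < r" and p: "movable i p"
    and g: "g \<in> FA" "\<And>a. \<exists>b. g * \<kappa> a \<approx>\<^sub>I \<kappa> b"
    and g': "g' \<in> FA" "\<And>a. \<exists>b. g' * \<kappa> a \<approx>\<^sub>I \<kappa> b"
    and g'': "g'' \<in> FA" "\<And>a. \<exists>b. g'' * \<kappa> a \<approx>\<^sub>I \<kappa> b"
    and eq: "tT i * g \<approx>\<^sub>I g' * tT i + g''"
  shows "movable i (g * p)"
proof -
  obtain b a1 a2 where b: "p \<approx>\<^sub>I \<kappa> b" and a: "tT i * p \<approx>\<^sub>I \<kappa> a1 * tT i + \<kappa> a2"
    using p by (auto simp: movable_def)
  have pcl: "p \<in> FA" using cong_closed[OF b] by simp
  have Tcl: "tT i \<in> FA" using i by simp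
  obtain c where c: "g * \<kappa> b \<approx>\<^sub>I \<kappa> c" using g by blast
  have gp: "g * p \<approx>\<^sub>I \<kappa> c" using cong_trans[OF cong_mult_left[OF b g(1)] c] .
  obtain c1 where c1: "g' * \<kappa> a1 \<approx>\<^sub>I \<kappa> c1" using g' by blast
  obtain c2 where c2: "g' * \<kappa> a2 \<approx>\<^sub>I \<kappa> c2" using g' by blast
  obtain c3 where c3: "g'' * \<kappa> b \<approx>\<^sub>I \<kappa> c3" using g'' by blast
  have "tT i * (g * p) = (tT i * g) * p" by (simp add: mult.assoc)
  also have "\<dots> \<approx>\<^sub>I (g' * tT i + g'') * p" by (rule cong_mult_right[OF eq pcl])
  also have "\<dots> = g' * (tT i * p) + g'' * p" by (simp add: algebra_simps)
  also have "\<dots> \<approx>\<^sub>I g' * (\<kappa> a1 * tT i + \<kappa> a2) + g'' * \<kappa> b"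
    by (rule cong_add[OF cong_mult_left[OF a g'(1)] cong_mult_left[OF b g''(1)]])
  also have "\<dots> = (g' * \<kappa> a1) * tT i + (g' * \<kappa> a2 + g'' * \<kappa> b)" by (simp add: algebra_simps)
  also have "\<dots> \<approx>\<^sub>I \<kappa> c1 * tT i + (\<kappa> c2 + \<kappa> c3)"
    by (rule cong_add[OF cong_mult_right[OF c1 Tcl] cong_add[OF c2 c3]])
  also have "\<kappa> c2 + \<kappa> c3 = \<kappa> (c2 + c3)" by (simp add: \<kappa>_add)
  finally show ?thesis using gp unfolding movable_def by blast
qed

lemma scaled_\<kappa>:
  assumes "\<And>a. \<exists>b. g * \<kappa> a \<approx>\<^sub>I \<kappa> b"
  shows "\<exists>b. (const c * g) * \<kappa> a \<approx>\<^sub>I \<kappa> b"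
proof -
  obtain b where "g * \<kappa> a \<approx>\<^sub>I \<kappa> b" using assms by blast
  then have "const c * (g * \<kappa> a) \<approx>\<^sub>I const c * \<kappa> b" by (rule cong_mult_left) simp
  then show ?thesis by (metis \<kappa>_const_mult mult.assoc)
qed

lemma minus_scaled_\<kappa>:
  assumes "\<And>a. \<exists>b. g * \<kappa> a \<approx>\<^sub>I \<kappa> b"
  shows "\<exists>b. (- (const c * g)) * \<kappa> a \<approx>\<^sub>I \<kappa> b"
  using scaled_\<kappa>[OF assms, of "- c" a] by (simp add: const.sc_minus)

lemma movable_X:
  assumes i: "1 \<le> i" "i < r" and j: "1 \<le> j" "j \<le> r" and p: "movable i p"
  shows "movable i (tX j * p)" "movable i (tY j * p)"
proof -
  have X: "\<And>a. \<exists>b. tX k * \<kappa> a \<approx>\<^sub>I \<kappa> b" if "1 \<le> k" "k \<le> r" for k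
    using X_\<kappa>[OF that] by blast
  have Y: "\<And>a. \<exists>b. tY k * \<kappa> a \<approx>\<^sub>I \<kappa> b" if "1 \<le> k" "k \<le> r" for k
    using Y_\<kappa>[OF that] by blast
  have Z: "\<And>a. \<exists>b. 0 * \<kappa> a \<approx>\<^sub>I \<kappa> b" using cong_refl[of 0] by (intro exI[of _ 0]) simp
  have i': "1 \<le> i + 1" "i + 1 \<le> r" "i \<le> r" using i by auto
  note step = movable_step[OF i p]
  note Ti = T_X(1)[OF i] T_X(2)[OF i, unfolded diff_conv_add_uminus]
    T_Y(1)[OF i, unfolded diff_conv_add_uminus] T_Y(2)[OF i]
  consider "j = i" | "j = i + 1" | "j \<noteq> i" "j \<noteq> i + 1" by blast
  then show "movable i (tX j * p)"
  proof cases
    case 1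
    show ?thesis unfolding 1
      by (rule step[OF _ X _ X _ scaled_\<kappa>[OF X] Ti(1)]) (use i i' in simp_all)
  next
    case 2
    show ?thesis unfolding 2
      by (rule step[OF _ X _ X _ minus_scaled_\<kappa>[OF X] Ti(2)]) (use i i' in simp_all)
  next
    case 3
    show ?thesis
      by (rule step[OF _ X _ X _ Z]) (use i i' j cong_sym[OF X_T_far[OF i j 3]] in simp_all)
  qed
  consider "j = i" | "j = i + 1" | "j \<noteq> i" "j \<noteq> i + 1" by blast
  then show "movable i (tY j * p)"
  proof cases
    case 1
    show ?thesis unfolding 1
      by (rule step[OF _ Y _ Y _ minus_scaled_\<kappa>[OF Y] Ti(3)]) (use i i' in simp_all)
  next
    case 2
    show ?thesis unfolding 2
      by (rule step[OF _ Y _ Y _ scaled_\<kappa>[OF Y] Ti(4)]) (use i i' in simp_all)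
  next
    case 3
    show ?thesis
      by (rule step[OF _ Y _ Y _ Z]) (use i i' j cong_sym[OF Y_T_far[OF i j 3]] in simp_all)
  qed
qed

lemma movable_one: "1 \<le> i \<Longrightarrow> i < r \<Longrightarrow> movable i 1"
  unfolding movable_def
  using cong_refl[of 1] cong_refl[of "tT i"]
  by (intro conjI exI[of _ 1] exI[of _ "1 :: 'k laurent"] exI[of _ "0 :: 'k laurent"]) simp_all

lemma movable_xmon:
  assumes "1 \<le> i" "i < r" "set js \<subseteq> {1..r}"
  shows "movable i (xmon js \<alpha>)"
  using assms(3)
proof (induction js)
  case Nil
  then show ?case using movable_one[OF assms(1,2)] by (simp add: xmon_def)
next
  case (Cons j js)
  have pow: "movable i (tX j ^ n * p) \<and> movable i (tY j ^ n * p)" if "movable i p" for n p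
    by (induction n) (use that movable_X[OF assms(1,2)] Cons.prems in \<open>simp_all add: mult.assoc\<close>)
  have "movable i (xmon js \<alpha>)" using Cons by simp
  then show ?case using pow by (auto simp: xmon_def xpow_def)
qed

lemma T_\<kappa>:
  assumes i: "1 \<le> i" "i < r"
  shows "\<exists>a' a''. tT i * \<kappa> a \<approx>\<^sub>I \<kappa> a' * tT i + \<kappa> a''"
proof (induction a rule: poly_mapping_single_induct)
  case (single \<alpha> c)
  have "movable i (xmon vars \<alpha>)" by (rule movable_xmon[OF i]) auto
  then obtain a' a'' where *: "tT i * xmon vars \<alpha> \<approx>\<^sub>I \<kappa> a' * tT i + \<kappa> a''"
    by (auto simp: movable_def)
  have "tT i * \<kappa> (Poly_Mapping.single \<alpha> c) = const c * (tT i * xmon vars \<alpha>)"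
    by (simp only: \<kappa>_single const_left_commute)
  also have "\<dots> \<approx>\<^sub>I const c * (\<kappa> a' * tT i + \<kappa> a'')" by (rule cong_mult_left[OF *]) simp
  also have "\<dots> = \<kappa> (lconst c * a') * tT i + \<kappa> (lconst c * a'')"
    by (simp add: \<kappa>_const_mult distrib_left mult.assoc)
  finally show ?case by blast
next
  case (add a b)
  then obtain a1 a2 b1 b2 where "tT i * \<kappa> a \<approx>\<^sub>I \<kappa> a1 * tT i + \<kappa> a2"
    "tT i * \<kappa> b \<approx>\<^sub>I \<kappa> b1 * tT i + \<kappa> b2" by blast
  then have "tT i * \<kappa> a + tT i * \<kappa> b \<approx>\<^sub>I (\<kappa> a1 * tT i + \<kappa> a2) + (\<kappa> b1 * tT i + \<kappa> b2)"
    by (rule cong_add)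
  then have "tT i * \<kappa> (a + b) \<approx>\<^sub>I \<kappa> (a1 + b1) * tT i + \<kappa> (a2 + b2)"
    by (simp add: \<kappa>_add algebra_simps)
  then show ?case by blast
qed

subsection \<open>Spanning\<close>

definition Tw :: "nat list \<Rightarrow> (hecke_gen, 'k) free_alg"
  where "Tw u = prod_list (map tT u)"

lemma Tw_simps [simp]: "Tw [] = 1" "Tw (i # u) = tT i * Tw u" "Tw (u @ v) = Tw u * Tw v"
  by (simp_all add: Tw_def)

lemma Tw_closed: "set u \<subseteq> {1..<r} \<Longrightarrow> Tw u \<in> FA"
  by (induction u) simp_all

lemma Tw_normal_closed [simp]: "u \<in> normal_words r \<Longrightarrow> Tw u \<in> FA"
  by (rule Tw_closed[OF normal_words_letters])

lemma \<rho>_Tw: "\<rho> q (Tw u) = opTw q u"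
  by (induction u) (simp_all add: \<rho>_mult gen_op_def)

lemma Tw_braid_eq:
  "u \<sim>\<^sub>b v \<Longrightarrow> set u \<subseteq> {1..<r} \<Longrightarrow> Tw u \<approx>\<^sub>I Tw v"
proof (induction rule: braid_eq.induct)
  case (same u)
  then show ?case by (simp add: cong_refl Tw_closed)
next
  case (far i j a b)
  have "Tw a * (tT i * tT j) * Tw b \<approx>\<^sub>I Tw a * (tT j * tT i) * Tw b"
    using far by (intro cong_mult_right[OF cong_mult_left[OF T_far]]) (simp_all add: Tw_closed)
  then show ?case by (simp add: mult.assoc)
next
  case (braid a i b)
  have "Tw a * (tT i * tT (i + 1) * tT i) * Tw b \<approx>\<^sub>I Tw a * (tT (i + 1) * tT i * tT (i + 1)) * Tw b"
    using braid by (intro cong_mult_right[OF cong_mult_left[OF T_braid]]) (simp_all add: Tw_closed)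
  then show ?case by (simp add: mult.assoc)
next
  case (flip u v)
  then have "Tw u \<approx>\<^sub>I Tw v" using braid_eq_set[OF flip(1)] by simp
  then show ?case by (rule cong_sym)
next
  case (chain u v w)
  have "Tw u \<approx>\<^sub>I Tw v" "Tw v \<approx>\<^sub>I Tw w"
    using chain braid_eq_set[OF chain(1)] by simp_all
  then show ?case by (rule cong_trans)
qed

definition spanned :: "(hecke_gen, 'k) free_alg \<Rightarrow> bool"
  where "spanned p \<longleftrightarrow> (\<exists>a. p \<approx>\<^sub>I (\<Sum>u\<in>normal_words r. \<kappa> (a u) * Tw u))"

lemma spanned_cong:
  assumes "p \<approx>\<^sub>I p'" "spanned p'"
  shows "spanned p"
proof -
  obtain a where "p' \<approx>\<^sub>I (\<Sum>u\<in>normal_words r. \<kappa> (a u) * Tw u)"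
    using assms(2) by (auto simp: spanned_def)
  then show ?thesis unfolding spanned_def using cong_trans[OF assms(1)] by (intro exI[of _ a])
qed

lemma spanned_add: "spanned p \<Longrightarrow> spanned p' \<Longrightarrow> spanned (p + p')"
proof -
  assume "spanned p" "spanned p'"
  then obtain a b where "p \<approx>\<^sub>I (\<Sum>u\<in>normal_words r. \<kappa> (a u) * Tw u)"
    "p' \<approx>\<^sub>I (\<Sum>u\<in>normal_words r. \<kappa> (b u) * Tw u)" by (auto simp: spanned_def)
  then have "p + p' \<approx>\<^sub>I (\<Sum>u\<in>normal_words r. \<kappa> (a u) * Tw u) + (\<Sum>u\<in>normal_words r. \<kappa> (b u) * Tw u)"
    by (rule cong_add)
  also have "\<dots> = (\<Sum>u\<in>normal_words r. \<kappa> (a u + b u) * Tw u)"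
    by (simp add: \<kappa>_add distrib_right sum.distrib)
  finally show "spanned (p + p')"
    unfolding spanned_def by (intro exI[of _ "\<lambda>u. a u + b u"])
qed

lemma spanned_basis:
  assumes "u \<in> normal_words r"
  shows "spanned (\<kappa> a * Tw u)"
proof -
  have "(\<Sum>v\<in>normal_words r. \<kappa> (if v = u then a else 0) * Tw v) = (\<Sum>v\<in>{u}. \<kappa> a * Tw v)"
    by (rule sum.mono_neutral_cong_right) (use assms in auto)
  then have "\<kappa> a * Tw u \<approx>\<^sub>I (\<Sum>v\<in>normal_words r. \<kappa> (if v = u then a else 0) * Tw v)"
    using assms by (simp add: cong_refl)
  then show ?thesis unfolding spanned_def by (intro exI[of _ "\<lambda>v. if v = u then a else 0"])
qed

lemma spanned_zero: "spanned 0"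
  using spanned_basis[OF Nil_in_normal_words, of 0] by simp

lemma spanned_sum: "finite A \<Longrightarrow> (\<And>i. i \<in> A \<Longrightarrow> spanned (f i)) \<Longrightarrow> spanned (sum f A)"
  by (induction A rule: finite_induct) (simp_all add: spanned_zero spanned_add)

lemma spanned_left:
  assumes g: "g \<in> FA" "\<And>a u. u \<in> normal_words r \<Longrightarrow> spanned (g * (\<kappa> a * Tw u))" and p: "spanned p"
  shows "spanned (g * p)"
proof -
  obtain a where "p \<approx>\<^sub>I (\<Sum>u\<in>normal_words r. \<kappa> (a u) * Tw u)" using p by (auto simp: spanned_def)
  then have "g * p \<approx>\<^sub>I g * (\<Sum>u\<in>normal_words r. \<kappa> (a u) * Tw u)" by (rule cong_mult_left) (rule g)
  moreover have "spanned (g * (\<Sum>u\<in>normal_words r. \<kappa> (a u) * Tw u))"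
    unfolding sum_distrib_left by (rule spanned_sum) (simp_all add: g)
  ultimately show ?thesis by (rule spanned_cong)
qed

lemma spanned_\<kappa>_T_Tw:
  assumes i: "1 \<le> i" "i < r" and u: "u \<in> normal_words r"
  shows "spanned (\<kappa> a * (tT i * Tw u))"
proof -
  have sets: "set u \<subseteq> {1..<r}" by (rule normal_words_letters[OF u])
  obtain v where v: "v \<in> normal_words r" "i # u \<sim>\<^sub>b v \<or> u \<sim>\<^sub>b i # v"
    using normal_words_Cons[OF u i] by blast
  from v(2) show ?thesis
  proof
    assume "i # u \<sim>\<^sub>b v"
    then have "Tw (i # u) \<approx>\<^sub>I Tw v" by (rule Tw_braid_eq) (use sets i in auto)
    then have "\<kappa> a * Tw (i # u) \<approx>\<^sub>I \<kappa> a * Tw v" by (rule cong_mult_left) simp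
    then have "\<kappa> a * (tT i * Tw u) \<approx>\<^sub>I \<kappa> a * Tw v" by simp
    then show ?thesis by (rule spanned_cong[OF _ spanned_basis[OF v(1)]])
  next
    assume "u \<sim>\<^sub>b i # v"
    then have uv: "Tw u \<approx>\<^sub>I tT i * Tw v" using Tw_braid_eq[of u "i # v"] sets by simp
    have "tT i * Tw u \<approx>\<^sub>I tT i * (tT i * Tw v)" by (rule cong_mult_left[OF uv]) (use i in simp)
    also have "\<dots> = (tT i * tT i) * Tw v" by (simp add: mult.assoc)
    also have "\<dots> \<approx>\<^sub>I (const (q - 1) * tT i + const q) * Tw v"
      by (rule cong_mult_right[OF T_quadratic[OF i]]) (simp add: v)
    also have "\<dots> = const (q - 1) * (tT i * Tw v) + const q * Tw v" by (simp add: algebra_simps)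
    also have "\<dots> \<approx>\<^sub>I const (q - 1) * Tw u + const q * Tw v"
      by (rule cong_add[OF cong_mult_left[OF cong_sym[OF uv]] cong_refl]) (simp_all add: v)
    finally have "\<kappa> a * (tT i * Tw u) \<approx>\<^sub>I \<kappa> a * (const (q - 1) * Tw u + const q * Tw v)"
      by (rule cong_mult_left) simp
    also have "\<dots> = \<kappa> (lconst (q - 1) * a) * Tw u + \<kappa> (lconst q * a) * Tw v"
      by (simp add: \<kappa>_const_mult distrib_left const_left_commute mult.assoc)
    finally show ?thesis
      by (rule spanned_cong) (intro spanned_add spanned_basis u v)
  qed
qed

lemma spanned_gen:
  assumes "g \<in> hecke_gens r" "spanned p"
  shows "spanned (var g * p)"
proof -
  consider i where "g = GenT i" "1 \<le> i" "i < r" | i where "g = GenX i" "1 \<le> i" "i \<le> r"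
    | i where "g = GenXinv i" "1 \<le> i" "i \<le> r"
    using assms(1) by (auto simp: hecke_gens_def)
  then show ?thesis
  proof cases
    case 1
    show ?thesis unfolding 1(1)
    proof (rule spanned_left[OF _ _ assms(2)])
      fix a u assume u: "u \<in> normal_words r"
      obtain a' a'' where a: "tT i * \<kappa> a \<approx>\<^sub>I \<kappa> a' * tT i + \<kappa> a''" using T_\<kappa>[OF 1(2,3)] by blast
      have "tT i * \<kappa> a * Tw u \<approx>\<^sub>I (\<kappa> a' * tT i + \<kappa> a'') * Tw u"
        by (rule cong_mult_right[OF a]) (simp add: u)
      then have "tT i * (\<kappa> a * Tw u) \<approx>\<^sub>I \<kappa> a' * (tT i * Tw u) + \<kappa> a'' * Tw u"
        by (simp add: algebra_simps)
      then show "spanned (tT i * (\<kappa> a * Tw u))"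
        by (rule spanned_cong) (intro spanned_add spanned_\<kappa>_T_Tw spanned_basis u 1)
    qed (use 1 in simp)
  next
    case 2
    show ?thesis unfolding 2(1)
    proof (rule spanned_left[OF _ _ assms(2)])
      fix a u assume u: "u \<in> normal_words r"
      have "tX i * \<kappa> a * Tw u \<approx>\<^sub>I \<kappa> (lvar i * a) * Tw u"
        by (rule cong_mult_right[OF X_\<kappa>[OF 2(2,3)]]) (simp add: u)
      then show "spanned (tX i * (\<kappa> a * Tw u))"
        unfolding mult.assoc by (rule spanned_cong[OF _ spanned_basis[OF u]])
    qed (use 2 in simp)
  next
    case 3
    show ?thesis unfolding 3(1)
    proof (rule spanned_left[OF _ _ assms(2)])
      fix a u assume u: "u \<in> normal_words r"
      have "tY i * \<kappa> a * Tw u \<approx>\<^sub>I \<kappa> (linv i * a) * Tw u"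
        by (rule cong_mult_right[OF Y_\<kappa>[OF 3(2,3)]]) (simp add: u)
      then show "spanned (tY i * (\<kappa> a * Tw u))"
        unfolding mult.assoc by (rule spanned_cong[OF _ spanned_basis[OF u]])
    qed (use 3 in simp)
  qed
qed

lemma spanned_const:
  assumes "spanned p"
  shows "spanned (const c * p)"
proof (rule spanned_left[OF _ _ assms])
  fix a u assume u: "u \<in> normal_words r"
  show "spanned (const c * (\<kappa> a * Tw u))"
    using spanned_basis[OF u, of "lconst c * a"] by (simp add: \<kappa>_const_mult mult.assoc)
qed simp

lemma spanned_all:
  assumes "p \<in> FA"
  shows "spanned p"
proof -
  have word: "spanned (Poly_Mapping.single (Word l) 1)" if "set l \<subseteq> hecke_gens r" for l
    using that
  proof (induction l)
    case Nil
    have "Poly_Mapping.single (Word []) 1 = (1 :: (hecke_gen, 'k) free_alg)"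
      by (metis single_one zero_free_monoid_def)
    then show ?case using spanned_basis[OF Nil_in_normal_words, of 1] by simp
  next
    case (Cons g l)
    then show ?case by (simp add: free_alg_word_Cons spanned_gen)
  qed
  have "p = (\<Sum>w\<in>Poly_Mapping.keys p. Poly_Mapping.single w (Poly_Mapping.lookup p w))"
    by (rule poly_mapping_eqI) (auto simp: lookup_sum lookup_single when_def in_keys_iff)
  moreover have "spanned (\<Sum>w\<in>Poly_Mapping.keys p. Poly_Mapping.single w (Poly_Mapping.lookup p w))"
  proof (rule spanned_sum)
    fix w assume "w \<in> Poly_Mapping.keys p"
    then have "set (letters w) \<subseteq> hecke_gens r" using assms by (simp add: free_algebra_simps(1))
    then have "spanned (Poly_Mapping.single w 1)" using word[of "letters w"] by simp
    then show "spanned (Poly_Mapping.single w (Poly_Mapping.lookup p w))"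
      by (subst free_alg_single) (rule spanned_const)
  qed simp
  ultimately show ?thesis by simp
qed

subsection \<open>The kernel of the evaluation\<close>

lemma opT_lvar_opT: "opT q i * \<iota> (lvar i) * opT q i = \<iota> (lconst q) * \<iota> (lvar (i + 1))"
proof -
  have "opT q i * \<iota> (lvar i) * opT q i
      = \<iota> (lvar (i + 1)) * (opT q i * opT q i) + \<iota> (lvar (i + 1)) * \<iota> (lconst (1 - q)) * opT q i"
    by (simp only: opT_\<iota>_lvar distrib_right mult.commute[of "lconst (1 - q)"] \<iota>_mult mult.assoc)
  also have "\<dots> = \<iota> (lvar (i + 1)) * \<iota> (lconst q)"
    by (simp add: opT_quadratic \<iota>_lconst.sc_diff \<iota>_lconst.sc_one algebra_simps)
  finally show ?thesis by (simp only: \<iota>_commute)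
qed

lemma \<rho>_rel:
  assumes "p \<in> hecke_rels r q"
  shows "\<rho> q p = 0"
proof -
  have quadratic: "(opT q i + 1) * (opT q i - \<iota> (lconst q)) = 0" for i
  proof -
    have "opT q i * \<iota> (lconst q) = \<iota> (lconst q) * opT q i" by (rule opT_\<iota>_sym) simp
    then show ?thesis by (simp add: algebra_simps opT_quadratic \<iota>_lconst.sc_diff \<iota>_lconst.sc_one)
  qed
  have XY: "\<iota> (lvar i :: 'k laurent) * \<iota> (linv i) = 1" "\<iota> (linv i :: 'k laurent) * \<iota> (lvar i) = 1" for i
    using \<iota>_mult[of "lvar i :: 'k laurent" "linv i"] by (simp_all add: \<iota>_one \<iota>_commute[of "linv i"])
  have XT: "\<iota> (lvar j) * opT q i = opT q i * \<iota> (lvar j)" if "j \<noteq> i" "j \<noteq> i + 1" for i j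
    by (rule opT_\<iota>_sym[symmetric]) (use that in simp)
  note ev = \<rho>_mult \<rho>_diff \<rho>_add \<rho>_one \<rho>_const \<rho>_var gen_op_def hecke_gen.case
  have
    "\<rho> q ((tT i + 1) * (tT i - const q)) = 0"
    "i + 1 < j \<or> j + 1 < i \<Longrightarrow> \<rho> q (tT i * tT j - tT j * tT i) = 0"
    "\<rho> q (tT i * tT (i + 1) * tT i - tT (i + 1) * tT i * tT (i + 1)) = 0"
    "\<rho> q (tX i * tY i - 1) = 0" "\<rho> q (tY i * tX i - 1) = 0"
    "\<rho> q (tX i * tX j - tX j * tX i) = 0"
    "\<rho> q (tT i * tX i * tT i - const q * tX (i + 1)) = 0"
    "j \<noteq> i \<Longrightarrow> j \<noteq> i + 1 \<Longrightarrow> \<rho> q (tX j * tT i - tT i * tX j) = 0" for i j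
    unfolding ev
    using quadratic[of i] opT_far[of i j q] opT_braid[of q i] XY[of i] opT_lvar_opT[of i]
      \<iota>_commute[of "lvar i :: 'k laurent" "lvar j"] XT[of j i]
    by (simp_all only: diff_self simp_thms)
  note zero = this
  from assms show ?thesis
    unfolding hecke_rels_def
    by (elim UnE CollectE exE conjE; simp only: zero simp_thms)
qed

lemma \<rho>_I: "p \<in> I \<Longrightarrow> \<rho> q p = 0"
proof -
  have "ideal {p \<in> FA. \<rho> q p = 0} F"
  proof (rule idealI[OF ring_free_algebra])
    show "subgroup {p \<in> FA. \<rho> q p = 0} (add_monoid F)"
    proof (rule group.subgroupI)
      show "group (add_monoid F)" by (rule F.add.is_group)
      fix a assume a: "a \<in> {p \<in> FA. \<rho> q p = 0}"
      have "\<ominus>\<^bsub>F\<^esub> a = - a" by (rule F.minus_equality) (use a in simp_all)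
      then have "inv\<^bsub>add_monoid F\<^esub> a = - a" by (simp only: a_inv_def)
      then show "inv\<^bsub>add_monoid F\<^esub> a \<in> {p \<in> FA. \<rho> q p = 0}"
        using a by (simp only: mem_Collect_eq \<rho>_minus closed) simp
    qed (auto simp: \<rho>_add intro!: exI[of _ 0] simp: \<rho>_zero)
  qed (auto simp: \<rho>_mult)
  then have "I \<subseteq> {p \<in> FA. \<rho> q p = 0}"
    unfolding I_def by (rule F.genideal_minimal) (use rels_closed \<rho>_rel in auto)
  then show "p \<in> I \<Longrightarrow> \<rho> q p = 0" by auto
qed

lemma \<rho>_cong: "p \<approx>\<^sub>I p' \<Longrightarrow> \<rho> q p = \<rho> q p'"
  using \<rho>_I[of "p - p'"] by (simp add: cong_def \<rho>_diff)

text \<open>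
  Faithfulness: an element of the kernel is congruent to a combination of the \<open>T\<^sub>u\<close>, and independence of
  the operators forces its coefficients to vanish.
\<close>

lemma \<rho>_eq_0_iff:
  assumes "p \<in> FA"
  shows "\<rho> q p = 0 \<longleftrightarrow> p \<in> I"
proof
  assume zero: "\<rho> q p = 0"
  obtain a where a: "p \<approx>\<^sub>I (\<Sum>u\<in>normal_words r. \<kappa> (a u) * Tw u)"
    using spanned_all[OF assms] by (auto simp: spanned_def)
  have "(\<Sum>u\<in>normal_words r. \<iota> (res (a u)) * opTw q u) = 0"
    using \<rho>_cong[OF a] zero by (simp add: \<rho>_sum \<rho>_mult \<rho>_\<kappa> \<rho>_Tw)
  then have "res (a u) = 0" if "u \<in> normal_words r" for u
    using opTw_independent[OF q_neq_0 _ that, of "\<lambda>u. res (a u)"] by simp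
  then have "\<kappa> (a u) = 0" if "u \<in> normal_words r" for u
    using \<kappa>_res[of "a u"] that by simp
  then have "p \<approx>\<^sub>I 0" using a by simp
  then show "p \<in> I" by (simp add: cong_def)
qed (rule \<rho>_I)

definition H :: "'k model set" where "H = \<rho> q ` FA"

text \<open>
  Freeness of the Hecke algebra over the Laurent polynomials, read inside the operators.
\<close>

lemma H_expand:
  assumes "h \<in> H"
  shows "\<exists>a. (\<forall>u. res (a u) = a u) \<and> h = (\<Sum>u\<in>normal_words r. \<iota> (a u) * opTw q u)"
proof -
  obtain p where p: "p \<in> FA" "h = \<rho> q p" using assms by (auto simp: H_def)
  obtain a where a: "p \<approx>\<^sub>I (\<Sum>u\<in>normal_words r. \<kappa> (a u) * Tw u)"
    using spanned_all[OF p(1)] by (auto simp: spanned_def)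
  have "h = (\<Sum>u\<in>normal_words r. \<iota> (res (a u)) * opTw q u)"
    using \<rho>_cong[OF a] p by (simp add: \<rho>_sum \<rho>_mult \<rho>_\<kappa> \<rho>_Tw)
  then show ?thesis by (intro exI[of _ "\<lambda>u. res (a u)"]) simp
qed

lemma H_closed:
  "a \<in> H \<Longrightarrow> b \<in> H \<Longrightarrow> a + b \<in> H" "a \<in> H \<Longrightarrow> b \<in> H \<Longrightarrow> a - b \<in> H" "a \<in> H \<Longrightarrow> b \<in> H \<Longrightarrow> a * b \<in> H"
  "0 \<in> H" "1 \<in> H" "1 \<le> i \<Longrightarrow> i < r \<Longrightarrow> opT q i \<in> H"
proof -
  show "a + b \<in> H" if ab: "a \<in> H" "b \<in> H"
  proof -
    obtain p p' where "p \<in> FA" "p' \<in> FA" "a = \<rho> q p" "b = \<rho> q p'"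
      using ab by (auto simp: H_def)
    then show ?thesis unfolding H_def by (intro image_eqI[of _ _ "p + p'"]) (simp_all add: \<rho>_add)
  qed
  show "a - b \<in> H" if ab: "a \<in> H" "b \<in> H"
  proof -
    obtain p p' where "p \<in> FA" "p' \<in> FA" "a = \<rho> q p" "b = \<rho> q p'"
      using ab by (auto simp: H_def)
    then show ?thesis unfolding H_def by (intro image_eqI[of _ _ "p - p'"]) (simp_all add: \<rho>_diff)
  qed
  show "a * b \<in> H" if ab: "a \<in> H" "b \<in> H"
  proof -
    obtain p p' where "p \<in> FA" "p' \<in> FA" "a = \<rho> q p" "b = \<rho> q p'"
      using ab by (auto simp: H_def)
    then show ?thesis unfolding H_def by (intro image_eqI[of _ _ "p * p'"]) (simp_all add: \<rho>_mult)
  qed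
  show "0 \<in> H" unfolding H_def by (rule image_eqI[of _ _ 0]) (simp_all add: \<rho>_zero)
  show "1 \<in> H" unfolding H_def by (rule image_eqI[of _ _ 1]) simp_all
  show "opT q i \<in> H" if "1 \<le> i" "i < r"
    unfolding H_def by (rule image_eqI[of _ _ "tT i"]) (use that in \<open>simp_all add: gen_op_def\<close>)
qed

lemma H_\<iota>: "res a = a \<Longrightarrow> \<iota> a \<in> H"
  unfolding H_def by (rule image_eqI[of _ _ "\<kappa> a"]) (simp_all add: \<rho>_\<kappa>)

lemma H_sum: "(\<And>i. i \<in> A \<Longrightarrow> f i \<in> H) \<Longrightarrow> sum f A \<in> H"
  by (induction A rule: infinite_finite_induct) (simp_all add: H_closed)

lemma H_opTw: "set u \<subseteq> {1..<r} \<Longrightarrow> opTw q u \<in> H"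
  by (induction u) (simp_all add: H_closed)

end

section \<open>Laurent polynomials in the ideal of a symmetriser\<close>

text \<open>
  The two-sided ideal of the subring \<open>A\<close> generated by \<open>x\<close>.
\<close>

inductive_set bispan :: "'a::ring_1 set \<Rightarrow> 'a \<Rightarrow> 'a set" for A x where
  gen: "u \<in> A \<Longrightarrow> v \<in> A \<Longrightarrow> u * x * v \<in> bispan A x"
| zero: "0 \<in> bispan A x"
| add: "y \<in> bispan A x \<Longrightarrow> z \<in> bispan A x \<Longrightarrow> y + z \<in> bispan A x"

lemma bispan_left:
  assumes "\<And>u v. u \<in> A \<Longrightarrow> v \<in> A \<Longrightarrow> u * v \<in> A" "y \<in> bispan A x" "a \<in> A"
  shows "a * y \<in> bispan A x"
  using assms(2)
proof induction
  case (gen u v)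
  have "(a * u) * x * v \<in> bispan A x" by (rule bispan.gen) (use assms gen in auto)
  then show ?case by (simp add: mult.assoc)
qed (simp_all add: distrib_left bispan.zero bispan.add)

lemma bispan_right:
  assumes "\<And>u v. u \<in> A \<Longrightarrow> v \<in> A \<Longrightarrow> u * v \<in> A" "y \<in> bispan A x" "a \<in> A"
  shows "y * a \<in> bispan A x"
  using assms(2)
proof induction
  case (gen u v)
  have "u * x * (v * a) \<in> bispan A x" by (rule bispan.gen) (use assms gen in auto)
  then show ?case by (simp add: mult.assoc)
qed (simp_all add: distrib_right bispan.zero bispan.add)

lemma bispan_mono:
  assumes "y \<in> bispan A x" "A \<subseteq> B"
  shows "y \<in> bispan B x"
  using assms
proof induction
  case (gen u v)
  then show ?case by (intro bispan.gen) auto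
qed (simp_all add: bispan.zero bispan.add)

lemma apply_swap_swap [simp]: "\<langle>i \<leftrightarrow> j\<rangle> \<langle>$\<rangle> (\<langle>i \<leftrightarrow> j\<rangle> \<langle>$\<rangle> k) = k"
  by transfer simp

context hecke_parameters
begin

subsection \<open>The symmetriser\<close>

definition symm :: "nat \<Rightarrow> 'k model"
  where "symm m = (\<Sum>u\<in>normal_words m. opTw q u)"

lemma symm_Suc: "symm (Suc m) = (\<Sum>j\<in>{1..Suc m}. opTw q [j..<Suc m] * symm m)"
proof -
  have inj: "inj_on (\<lambda>(j, u). [j..<Suc m] @ u) ({1..Suc m} \<times> normal_words m)"
  proof (rule inj_onI, clarify)
    fix i u j v
    assume "i \<in> {1..Suc m}" "u \<in> normal_words m" "j \<in> {1..Suc m}" "v \<in> normal_words m"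
      and eq: "[i..<Suc m] @ u = [j..<Suc m] @ v"
    then have "i = j" using perm_of_normal_word_last[of u m i] perm_of_normal_word_last[of v m j] by simp
    then show "i = j \<and> u = v" using eq by simp
  qed
  have "symm (Suc m) = (\<Sum>(j, u)\<in>{1..Suc m} \<times> normal_words m. opTw q [j..<Suc m] * opTw q u)"
    unfolding symm_def normal_words.simps sum.reindex[OF inj]
    by (rule sum.cong) (auto simp del: upt_Suc)
  also have "\<dots> = (\<Sum>j\<in>{1..Suc m}. opTw q [j..<Suc m] * symm m)"
    by (simp only: symm_def sum.cartesian_product[symmetric] sum_distrib_left)
  finally show ?thesis .
qed

abbreviation Q :: "'k model" where "Q \<equiv> \<iota> (lconst q)"

lemma opT_square: "opT q i * opT q i = (Q - 1) * opT q i + Q"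
  using opT_quadratic[of q i] by (simp add: \<iota>_lconst.sc_diff \<iota>_lconst.sc_one)

lemma opT_Q: "opT q i * Q = Q * opT q i"
  by (rule opT_\<iota>_sym) simp

lemma opTw_Q: "opTw q u * Q = Q * opTw q u"
proof (induction u)
  case (Cons i u)
  have "opTw q (i # u) * Q = opT q i * (opTw q u * Q)" by (simp add: mult.assoc)
  also have "\<dots> = opT q i * Q * opTw q u" by (simp only: Cons mult.assoc)
  finally show ?case by (simp only: opT_Q opTw_simps mult.assoc)
qed simp

text \<open>
  The terms for \<open>j = i\<close> and \<open>j = i + 1\<close> are exchanged by \<open>T\<^sub>i\<close> up to the quadratic relation; in every other
  term \<open>T\<^sub>i\<close> passes to the right of the coset representative, where induction applies.
\<close>

lemma opT_symm: "1 \<le> i \<Longrightarrow> i < m \<Longrightarrow> opT q i * symm m = Q * symm m"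
proof (induction m arbitrary: i)
  case (Suc m)
  let ?f = "\<lambda>j. opTw q [j..<Suc m] * symm m"
  \<comment> \<open>The index \<open>k\<close> is \<open>i - 1\<close> or \<open>i\<close>, depending on the position of \<open>i\<close> relative to \<open>j\<close>.\<close>
  have move: "opT q i * ?f j = Q * ?f j" if "j \<in> {1..Suc m} - {i, i + 1}" for j
  proof -
    have "\<exists>k. i # [j..<Suc m] \<sim>\<^sub>b [j..<Suc m] @ [k] \<and> 1 \<le> k \<and> k < m"
    proof (cases "j < i")
      case True
      then show ?thesis using braid_eq_shift[OF True, of "Suc m"] Suc.prems that
        by (intro exI[of _ "i - 1"]) auto
    next
      case False
      then have "i + 1 < j" using that by auto
      then show ?thesis using braid_eq_far[of i j "Suc m"] Suc.prems that
        by (intro exI[of _ i]) auto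
    qed
    then obtain k where k: "i # [j..<Suc m] \<sim>\<^sub>b [j..<Suc m] @ [k]" "1 \<le> k" "k < m" by blast
    have "opT q i * ?f j = opTw q (i # [j..<Suc m]) * symm m" by (simp add: mult.assoc del: upt_Suc)
    also have "\<dots> = opTw q [j..<Suc m] * (opT q k * symm m)"
      by (simp add: opTw_braid_eq[OF k(1)] mult.assoc del: opTw_simps(2) upt_Suc)
        (simp add: mult.assoc del: upt_Suc)
    also have "\<dots> = Q * ?f j"
      by (simp add: Suc.IH[OF k(2,3)] opTw_Q flip: mult.assoc del: upt_Suc)
    finally show ?thesis .
  qed
  have up: "opT q i * ?f (i + 1) = ?f i"
    using upt_Cons_append[of i "Suc m"] Suc.prems by (simp add: mult.assoc del: upt_Suc)
  have down: "opT q i * ?f i = (Q - 1) * ?f i + Q * ?f (i + 1)"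
  proof -
    have "opT q i * ?f i = opT q i * opT q i * ?f (i + 1)" using up by (simp add: mult.assoc)
    also have "\<dots> = (Q - 1) * (opT q i * ?f (i + 1)) + Q * ?f (i + 1)"
      by (simp only: opT_square distrib_right mult.assoc)
    finally show ?thesis by (simp only: up)
  qed
  have split: "sum g {1..Suc m} = g i + g (i + 1) + sum g ({1..Suc m} - {i, i + 1})"
    for g :: "nat \<Rightarrow> 'k model"
  proof -
    have "sum g {1..Suc m} = sum g {i, i + 1} + sum g ({1..Suc m} - {i, i + 1})"
      using sum.subset_diff[of "{i, i + 1}" "{1..Suc m}" g] Suc.prems by (auto simp: add.commute)
    then show ?thesis by simp
  qed
  have "opT q i * symm (Suc m) = opT q i * ?f i + opT q i * ?f (i + 1)
      + (\<Sum>j\<in>{1..Suc m} - {i, i + 1}. opT q i * ?f j)"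
    by (simp only: symm_Suc split distrib_left sum_distrib_left)
  also have "\<dots> = Q * ?f i + Q * ?f (i + 1) + (\<Sum>j\<in>{1..Suc m} - {i, i + 1}. Q * ?f j)"
    unfolding up down using move by (simp add: left_diff_distrib)
  also have "\<dots> = Q * symm (Suc m)"
    by (simp only: symm_Suc split distrib_left sum_distrib_left)
  finally show ?case .
qed simp

lemma opT_\<iota>_lvar_Suc:
  "opT q i * \<iota> (lvar (i + 1)) = \<iota> (lvar i) * opT q i - \<iota> (lconst (1 - q) * lvar (i + 1))"
proof -
  have "opT q i * \<iota> (lvar i + lvar (i + 1)) = \<iota> (lvar i + lvar (i + 1)) * opT q i"
    by (rule opT_\<iota>_sym) (simp add: rename_add add.commute)
  then show ?thesis using opT_\<iota>_lvar[of q i]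
    by (simp add: \<iota>_add distrib_left distrib_right algebra_simps)
qed

lemma opTw_\<iota>:
  assumes "\<And>i. i \<in> set u \<Longrightarrow> rename (adj i) a = a"
  shows "opTw q u * \<iota> a = \<iota> a * opTw q u"
  using assms
proof (induction u)
  case (Cons i u)
  have "opTw q (i # u) * \<iota> a = opT q i * (opTw q u * \<iota> a)" by (simp add: mult.assoc)
  also have "\<dots> = opT q i * \<iota> a * opTw q u" using Cons by (simp add: mult.assoc)
  also have "opT q i * \<iota> a = \<iota> a * opT q i" by (rule opT_\<iota>_sym, rule Cons.prems) simp
  finally show ?case by (simp add: mult.assoc)
qed simp

lemma symm_\<iota>:
  assumes "\<And>i. 1 \<le> i \<Longrightarrow> i < m \<Longrightarrow> rename (adj i) a = a"
  shows "symm m * \<iota> a = \<iota> a * symm m"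
proof -
  have "opTw q u * \<iota> a = \<iota> a * opTw q u" if "u \<in> normal_words m" for u
    using normal_words_letters[OF that] assms by (intro opTw_\<iota>) auto
  then show ?thesis by (simp add: symm_def sum_distrib_left sum_distrib_right)
qed

subsection \<open>Eliminating cosets\<close>

text \<open>
  The parabolic subalgebra generated by \<open>T\<^sub>1, \<dots>, T\<^sub>m\<^sub>-\<^sub>1\<close> and all \<open>X\<^sub>j\<close>. Laurent polynomials that are symmetric
  in the first \<open>m\<close> variables commute with it and can be moved inside products \<open>u * symm m * v\<close>.
\<close>

inductive_set PH :: "nat \<Rightarrow> 'k model set" for m where
  T: "1 \<le> i \<Longrightarrow> i < m \<Longrightarrow> opT q i \<in> PH m"
| \<iota>: "res a = a \<Longrightarrow> \<iota> a \<in> PH m"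
| mult: "x \<in> PH m \<Longrightarrow> y \<in> PH m \<Longrightarrow> x * y \<in> PH m"

lemma PH_mono: "x \<in> PH m \<Longrightarrow> m \<le> m' \<Longrightarrow> x \<in> PH m'"
proof (induction rule: PH.induct)
  case (T i)
  then show ?case by (intro PH.T) simp_all
next
  case (\<iota> a)
  then show ?case by (intro PH.\<iota>)
next
  case (mult x y)
  then show ?case by (intro PH.mult[of x _ y]) simp_all
qed

lemma PH_subset_H: "x \<in> PH m \<Longrightarrow> m \<le> r \<Longrightarrow> x \<in> H"
  by (induction rule: PH.induct) (simp_all add: H_closed H_\<iota>)

lemma PH_one: "1 \<in> PH m"
  using PH.\<iota>[of 1 m] by (simp add: \<iota>_one)

lemma bispan_PH_left: "y \<in> bispan (PH m) x \<Longrightarrow> a \<in> PH m \<Longrightarrow> a * y \<in> bispan (PH m) x"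
  by (rule bispan_left) (simp_all add: PH.mult)

lemma bispan_PH_right: "y \<in> bispan (PH m) x \<Longrightarrow> a \<in> PH m \<Longrightarrow> y * a \<in> bispan (PH m) x"
  by (rule bispan_right) (simp_all add: PH.mult)

text \<open>
  For fixed \<open>M\<close> these operators commute, and they preserve two-sided ideals. On \<open>symm m\<close> with \<open>m < M\<close>, which
  commutes with \<open>X\<^sub>M\<close>, the operator is multiplication by \<open>X\<^sub>M - X\<^sub>i\<close>.
\<close>

definition \<Lambda> :: "nat \<Rightarrow> nat \<Rightarrow> 'k model \<Rightarrow> 'k model"
  where "\<Lambda> M i y = y * \<iota> (lvar M) - \<iota> (lvar i) * y"

lemma \<Lambda>_diff: "\<Lambda> M i (y - z) = \<Lambda> M i y - \<Lambda> M i z"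
  and \<Lambda>_add: "\<Lambda> M i (y + z) = \<Lambda> M i y + \<Lambda> M i z"
  by (simp_all add: \<Lambda>_def algebra_simps)

lemma \<Lambda>_\<iota>: "\<Lambda> M i (\<iota> (lconst c) * y) = \<iota> (lconst c) * \<Lambda> M i y"
  by (simp add: \<Lambda>_def algebra_simps \<iota>_commute[of "lvar i"] flip: mult.assoc)

lemma \<Lambda>_opT:
  assumes "i \<noteq> j" "i \<noteq> j + 1"
  shows "\<Lambda> M i (opT q j * y) = opT q j * \<Lambda> M i y"
proof -
  have "opT q j * \<iota> (lvar i) = \<iota> (lvar i) * opT q j" by (rule opT_\<iota>_sym) (use assms in simp)
  then show ?thesis by (simp add: \<Lambda>_def right_diff_distrib flip: mult.assoc)
qed

text \<open>
  The composite depends only on \<open>X\<^sub>j + X\<^sub>j\<^sub>+\<^sub>1\<close> and \<open>X\<^sub>jX\<^sub>j\<^sub>+\<^sub>1\<close>, which commute with \<open>T\<^sub>j\<close>.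
\<close>

lemma \<Lambda>_\<Lambda>_opT: "\<Lambda> M j (\<Lambda> M (j + 1) (opT q j * y)) = opT q j * \<Lambda> M j (\<Lambda> M (j + 1) y)"
proof -
  let ?v = "\<iota> (lvar M)" and ?e = "\<iota> (lvar j + lvar (j + 1))" and ?p = "\<iota> (lvar j * lvar (j + 1))"
  have e: "\<Lambda> M j (\<Lambda> M (j + 1) y) = y * ?v * ?v - ?e * y * ?v + ?p * y" for y
    by (simp add: \<Lambda>_def \<iota>_add \<iota>_mult algebra_simps)
  have "opT q j * ?e = ?e * opT q j" "opT q j * ?p = ?p * opT q j"
    by (rule opT_\<iota>_sym; simp add: rename_add rename_mult add.commute mult.commute)+
  then show ?thesis unfolding e by (simp add: distrib_left right_diff_distrib flip: mult.assoc)
qed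

lemma \<Lambda>_symm:
  assumes "m < M"
  shows "\<Lambda> M i (\<iota> a * symm m) = \<iota> ((lvar M - lvar i) * a) * symm m"
proof -
  have "symm m * \<iota> (lvar M) = \<iota> (lvar M) * symm m" by (rule symm_\<iota>) (use assms in simp)
  then have "\<Lambda> M i (\<iota> a * symm m) = \<iota> a * \<iota> (lvar M) * symm m - \<iota> (lvar i) * \<iota> a * symm m"
    by (simp add: \<Lambda>_def mult.assoc)
  also have "\<dots> = \<iota> ((lvar M - lvar i) * a) * symm m"
    by (simp only: \<iota>_commute[of a] \<iota>_mult \<iota>_diff left_diff_distrib)
  finally show ?thesis .
qed

text \<open>
  A partial symmetriser of \<open>\<SS>\<^sub>m\<^sub>+\<^sub>1\<close>: for \<open>j = 1\<close> it is \<open>symm (Suc m)\<close>, for \<open>j = m + 1\<close> it is \<open>symm m\<close>.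
\<close>

definition coset_sum :: "nat \<Rightarrow> nat \<Rightarrow> 'k model"
  where "coset_sum m j = (\<Sum>i\<in>{j..Suc m}. opTw q [i..<Suc m] * symm m)"

lemma coset_sum_top: "coset_sum m (Suc m) = symm m"
  by (simp add: coset_sum_def)

lemma coset_sum_step: "j \<le> Suc m \<Longrightarrow> coset_sum m j = opTw q [j..<Suc m] * symm m + coset_sum m (Suc j)"
  unfolding coset_sum_def by (subst sum.atLeast_Suc_atMost) simp_all

lemma coset_sum_rec:
  assumes "1 \<le> j" "j < m"
  shows "coset_sum m j = opT q j * coset_sum m (j + 1) + coset_sum m (j + 1) - Q * coset_sum m (j + 2)"
proof -
  have far: "opT q j * (opTw q [i..<Suc m] * symm m) = Q * (opTw q [i..<Suc m] * symm m)"
    if "i \<in> {j + 2..Suc m}" for i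
  proof -
    have k: "j # [i..<Suc m] \<sim>\<^sub>b [i..<Suc m] @ [j]" by (rule braid_eq_far) (use that in auto)
    have "opT q j * (opTw q [i..<Suc m] * symm m) = opTw q (j # [i..<Suc m]) * symm m"
      by (simp add: mult.assoc del: upt_Suc)
    also have "\<dots> = opTw q [i..<Suc m] * (opT q j * symm m)"
      by (simp add: opTw_braid_eq[OF k] mult.assoc del: opTw_simps(2) upt_Suc)
        (simp add: mult.assoc del: upt_Suc)
    also have "\<dots> = Q * (opTw q [i..<Suc m] * symm m)"
      by (simp add: opT_symm[OF assms] opTw_Q flip: mult.assoc del: upt_Suc)
    finally show ?thesis .
  qed
  have up: "opT q j * (opTw q [j + 1..<Suc m] * symm m) = opTw q [j..<Suc m] * symm m"
    using upt_Cons_append[of j "Suc m"] assms by (simp add: mult.assoc del: upt_Suc)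
  have "opT q j * coset_sum m (j + 2) = Q * coset_sum m (j + 2)"
    unfolding coset_sum_def sum_distrib_left by (rule sum.cong[OF refl far])
  then have "opT q j * coset_sum m (j + 1) = opTw q [j..<Suc m] * symm m + Q * coset_sum m (j + 2)"
    using coset_sum_step[of "j + 1" m] assms up by (simp add: distrib_left del: upt_Suc)
  then show ?thesis using coset_sum_step[of j m] assms by (simp del: upt_Suc)
qed

definition gfac :: "nat \<Rightarrow> nat \<Rightarrow> 'k laurent"
  where "gfac m j = (\<Prod>i\<in>{j..m}. wall q i (Suc m))"

lemma gfac_step: "j \<le> m \<Longrightarrow> gfac m j = wall q j (Suc m) * gfac m (Suc j)"
  unfolding gfac_def by (simp add: prod.atLeast_Suc_atMost)

lemma gfac_top: "gfac m (Suc m) = 1"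
  by (simp add: gfac_def)

lemma rename_prod: "rename v (prod f A) = (\<Prod>i\<in>A. rename v (f i))"
  by (induction A rule: infinite_finite_induct) (simp_all add: rename_mult)

definition \<Lambda>s :: "nat \<Rightarrow> nat \<Rightarrow> 'k model \<Rightarrow> 'k model"
  where "\<Lambda>s m j y = foldr (\<Lambda> (Suc m)) [j..<Suc m] y"

lemma \<Lambda>s_step: "j \<le> m \<Longrightarrow> \<Lambda>s m j y = \<Lambda> (Suc m) j (\<Lambda>s m (Suc j) y)"
  using upt_Cons_append[of j "Suc m"] by (simp add: \<Lambda>s_def del: upt_Suc)

lemma \<Lambda>s_top: "\<Lambda>s m (Suc m) y = y"
  by (simp add: \<Lambda>s_def)

lemma \<Lambda>s_linear:
  "\<Lambda>s m j (y - z) = \<Lambda>s m j y - \<Lambda>s m j z" "\<Lambda>s m j (y + z) = \<Lambda>s m j y + \<Lambda>s m j z"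
  "\<Lambda>s m j (Q * y) = Q * \<Lambda>s m j y"
proof -
  have "foldr (\<Lambda> M) is (y - z) = foldr (\<Lambda> M) is y - foldr (\<Lambda> M) is z"
    "foldr (\<Lambda> M) is (y + z) = foldr (\<Lambda> M) is y + foldr (\<Lambda> M) is z"
    "foldr (\<Lambda> M) is (Q * y) = Q * foldr (\<Lambda> M) is y" for M "is"
    by (induction "is") (simp_all add: \<Lambda>_diff \<Lambda>_add \<Lambda>_\<iota>)
  then show "\<Lambda>s m j (y - z) = \<Lambda>s m j y - \<Lambda>s m j z" "\<Lambda>s m j (y + z) = \<Lambda>s m j y + \<Lambda>s m j z"
    "\<Lambda>s m j (Q * y) = Q * \<Lambda>s m j y"
    by (simp_all only: \<Lambda>s_def)
qed

lemma \<Lambda>s_opT: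
  assumes "k + 1 < j"
  shows "\<Lambda>s m j (opT q k * y) = opT q k * \<Lambda>s m j y"
proof -
  have *: "foldr (\<Lambda> M) is (opT q k * y) = opT q k * foldr (\<Lambda> M) is y" if "\<forall>i\<in>set is. k + 1 < i" for M "is"
    using that by (induction "is") (simp_all add: \<Lambda>_opT)
  show ?thesis unfolding \<Lambda>s_def by (rule *) (use assms in auto)
qed

text \<open>
  On \<open>symm m\<close> the operator \<open>T\<^sub>j\<close> acts by the scalar \<open>q\<close>, so that moving it through a Laurent polynomial that is
  linear in \<open>X\<^sub>j\<close> leaves a Laurent polynomial.
\<close>

lemma opT_move_symm:
  assumes S: "rename (adj j) S = S" and R: "rename (adj j) R = R" and j: "1 \<le> j" "j < m"
  shows "opT q j * \<iota> (S + R * lvar j) * symm m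
    = \<iota> (lconst q * S + R * lvar (j + 1)) * symm m"
proof -
  let ?T = "opT q j" and ?a = "lvar j :: 'k laurent" and ?b = "lvar (j + 1) :: 'k laurent"
    and ?c = "lconst q" and ?x = "symm m"
  have c: "lconst (1 - q) = 1 - ?c" by (simp add: lconst.sc_diff lconst.sc_one)
  have "?T * \<iota> (S + R * ?a) = ?T * \<iota> S + ?T * \<iota> R * \<iota> ?a"
    by (simp only: \<iota>_add \<iota>_mult distrib_left mult.assoc)
  also have "\<dots> = \<iota> S * ?T + \<iota> R * (?T * \<iota> ?a)"
    by (simp only: opT_\<iota>_sym[OF S] opT_\<iota>_sym[OF R] mult.assoc)
  also have "\<dots> = \<iota> S * ?T + \<iota> R * (\<iota> ?b * ?T + \<iota> ((1 - ?c) * ?b))"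
    by (simp only: opT_\<iota>_lvar c)
  finally have "?T * \<iota> (S + R * ?a) * ?x
      = \<iota> S * (?T * ?x) + \<iota> R * (\<iota> ?b * (?T * ?x) + \<iota> ((1 - ?c) * ?b) * ?x)"
    by (simp only: distrib_right distrib_left mult.assoc)
  also have "?T * ?x = Q * ?x" by (rule opT_symm[OF j])
  also have "\<iota> S * (Q * ?x) + \<iota> R * (\<iota> ?b * (Q * ?x) + \<iota> ((1 - ?c) * ?b) * ?x)
      = \<iota> (S * ?c + R * (?b * ?c + (1 - ?c) * ?b)) * ?x"
    by (simp only: \<iota>_add \<iota>_mult distrib_right distrib_left mult.assoc)
  also have "S * ?c + R * (?b * ?c + (1 - ?c) * ?b) = ?c * S + R * ?b"
    by (simp add: algebra_simps)
  finally show ?thesis .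
qed

text \<open>
  The heart of the matter. The recursion \<open>coset_sum_rec\<close> expresses the partial symmetriser for \<open>j\<close> by those
  for \<open>j + 1\<close> and \<open>j + 2\<close>, and the operators for \<open>j\<close> and \<open>j + 1\<close> together commute with \<open>T\<^sub>j\<close>; what remains is
  an identity between quadratic polynomials in \<open>X\<^sub>m\<^sub>+\<^sub>1\<close>.
\<close>

lemma \<Lambda>s_coset_sum:
  assumes "1 \<le> j" "j \<le> Suc m"
  shows "\<Lambda>s m j (coset_sum m j) = \<iota> (gfac m j) * symm m"
  using assms
proof (induction "Suc m - j" arbitrary: j rule: less_induct)
  case less
  let ?v = "lvar (Suc m) :: 'k laurent" and ?a = "lvar j :: 'k laurent"
    and ?b = "lvar (j + 1) :: 'k laurent" and ?c = "lconst q"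
  have c: "lconst (1 - q) = 1 - ?c" by (simp add: lconst.sc_diff lconst.sc_one)
  consider "j = Suc m" | "j = m" | "j < m" using less.prems by linarith
  then show ?case
  proof cases
    case 1
    then show ?thesis by (simp add: \<Lambda>s_top coset_sum_top gfac_top \<iota>_one)
  next
    case 2
    let ?x = "symm m" and ?T = "opT q m"
    have top: "coset_sum m m = ?T * ?x + ?x"
      using coset_sum_step[of m m] by (simp add: coset_sum_top)
    have st: "\<Lambda>s m m y = y * \<iota> ?v - \<iota> ?a * y" for y
      using \<Lambda>s_step[of m m y] by (simp add: 2 \<Lambda>s_top \<Lambda>_def)
    have "\<Lambda>s m j (coset_sum m j) = ?T * (?x * \<iota> ?v) + ?x * \<iota> ?v - \<iota> ?a * ?T * ?x - \<iota> ?a * ?x"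
      unfolding 2 top st by (simp add: algebra_simps)
    also have "?x * \<iota> ?v = \<iota> ?v * ?x" by (rule symm_\<iota>) simp
    also have "?T * (\<iota> ?v * ?x) = \<iota> ?a * ?T * ?x - \<iota> ((1 - ?c) * ?v) * ?x"
      using opT_\<iota>_lvar_Suc[of m] by (simp add: 2 c left_diff_distrib flip: mult.assoc)
    also have "\<iota> ?a * ?T * ?x - \<iota> ((1 - ?c) * ?v) * ?x + \<iota> ?v * ?x - \<iota> ?a * ?T * ?x - \<iota> ?a * ?x
        = \<iota> (?v - (1 - ?c) * ?v - ?a) * ?x"
      by (simp only: \<iota>_diff left_diff_distrib) simp
    also have "?v - (1 - ?c) * ?v - ?a = gfac m j"
      using gfac_step[of m m] by (simp add: 2 gfac_top wall_def algebra_simps)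
    finally show ?thesis .
  next
    case 3
    let ?x = "symm m" and ?G = "gfac m (j + 2)" and ?T = "opT q j"
    have IH1: "\<Lambda>s m (j + 1) (coset_sum m (j + 1)) = \<iota> (gfac m (j + 1)) * ?x"
      and IH2: "\<Lambda>s m (j + 2) (coset_sum m (j + 2)) = \<iota> ?G * ?x"
      using less.hyps[of "j + 1"] less.hyps[of "j + 2"] less.prems 3 by auto
    have g1: "gfac m (j + 1) = (?c * ?v - ?b) * ?G"
      using gfac_step[of "j + 1" m] 3 by (simp add: wall_def)
    have g0: "gfac m j = (?c * ?v - ?a) * ((?c * ?v - ?b) * ?G)"
      using gfac_step[of j m] g1 3 by (simp add: wall_def)
    have S2: "\<Lambda>s m j y = \<Lambda> (Suc m) j (\<Lambda> (Suc m) (j + 1) (\<Lambda>s m (j + 2) y))" for y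
      using \<Lambda>s_step[of j m] \<Lambda>s_step[of "j + 1" m] 3 by simp
    have S1: "\<Lambda>s m j y = \<Lambda> (Suc m) j (\<Lambda>s m (j + 1) y)" for y
      using \<Lambda>s_step[of j m] 3 by simp
    have TS: "\<Lambda>s m j (?T * y) = ?T * \<Lambda>s m j y" for y
      unfolding S2 by (simp add: \<Lambda>s_opT \<Lambda>_\<Lambda>_opT[simplified])
    have A: "\<Lambda>s m j (coset_sum m (j + 1)) = \<iota> ((?v - ?a) * ((?c * ?v - ?b) * ?G)) * ?x"
      unfolding S1 IH1 g1 by (rule \<Lambda>_symm) simp
    have B: "\<Lambda>s m j (coset_sum m (j + 2)) = \<iota> ((?v - ?a) * ((?v - ?b) * ?G)) * ?x"
      unfolding S2 IH2 by (simp add: \<Lambda>_symm)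
    let ?S = "(?c * ?v * ?v - ?v * (?a + ?b) + ?a * ?b) * ?G"
    let ?R = "(1 - ?c) * ?v * ?G"
    have symG: "rename (adj j) ?G = ?G"
      unfolding gfac_def rename_prod by (rule prod.cong) (use 3 in auto)
    have symS: "rename (adj j) ?S = ?S"
      using 3 by (simp add: rename_mult rename_add rename_diff symG[simplified] add.commute mult.commute)
    have symR: "rename (adj j) ?R = ?R"
      using 3 by (simp add: rename_mult rename_diff symG[simplified])
    have split: "(?v - ?a) * ((?c * ?v - ?b) * ?G) = ?S + ?R * ?a"
      by (simp add: algebra_simps)
    have T: "?T * \<iota> ((?v - ?a) * ((?c * ?v - ?b) * ?G)) * ?x = \<iota> (?c * ?S + ?R * ?b) * ?x"
      unfolding split by (rule opT_move_symm[OF symS symR]) (use less.prems 3 in auto)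
    have "\<Lambda>s m j (coset_sum m j) = ?T * \<Lambda>s m j (coset_sum m (j + 1))
        + \<Lambda>s m j (coset_sum m (j + 1)) - Q * \<Lambda>s m j (coset_sum m (j + 2))"
      using coset_sum_rec[of j m] less.prems 3 by (simp add: \<Lambda>s_linear TS)
    also have "\<dots> = \<iota> (?c * ?S + ?R * ?b) * ?x + \<iota> ((?v - ?a) * ((?c * ?v - ?b) * ?G)) * ?x
        - Q * (\<iota> ((?v - ?a) * ((?v - ?b) * ?G)) * ?x)"
      by (simp only: A B trans[OF mult.assoc[symmetric] T])
    also have "\<dots> = \<iota> (?c * ?S + ?R * ?b + (?v - ?a) * ((?c * ?v - ?b) * ?G)
        - ?c * ((?v - ?a) * ((?v - ?b) * ?G))) * ?x"
      by (simp only: \<iota>_add \<iota>_diff \<iota>_mult[of ?c] distrib_right left_diff_distrib mult.assoc)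
    also have "?c * ?S + ?R * ?b + (?v - ?a) * ((?c * ?v - ?b) * ?G)
        - ?c * ((?v - ?a) * ((?v - ?b) * ?G)) = gfac m j"
      unfolding g0 by (simp add: algebra_simps)
    finally show ?thesis .
  qed
qed


lemma \<Lambda>s_bispan:
  assumes "Suc m \<le> r" "1 \<le> j" "y \<in> bispan (PH (Suc m)) x"
  shows "\<Lambda>s m j y \<in> bispan (PH (Suc m)) x"
proof -
  have diff: "y - z \<in> bispan (PH (Suc m)) x" if "y \<in> bispan (PH (Suc m)) x" "z \<in> bispan (PH (Suc m)) x" for y z
  proof -
    have "\<iota> (- 1) \<in> PH (Suc m)" by (rule PH.\<iota>) (use res_diff[of 0 1] in simp)
    then have "\<iota> (- 1) * z \<in> bispan (PH (Suc m)) x" using that by (intro bispan_PH_left)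
    then have "y + \<iota> (- 1) * z \<in> bispan (PH (Suc m)) x" using that by (intro bispan.add)
    then show ?thesis by (simp add: \<iota>_minus \<iota>_one)
  qed
  have *: "foldr (\<Lambda> (Suc m)) is y \<in> bispan (PH (Suc m)) x" if "set is \<subseteq> {1..r}" for "is"
    using that
  proof (induction "is")
    case (Cons i js)
    then have "\<iota> (lvar i) \<in> PH (Suc m)" "\<iota> (lvar (Suc m)) \<in> PH (Suc m)"
      using assms by (auto intro!: PH.\<iota>)
    then show ?case using Cons by (simp add: \<Lambda>_def diff bispan_PH_left bispan_PH_right)
  qed (simp add: assms)
  show ?thesis unfolding \<Lambda>s_def by (rule *) (use assms in auto)
qed

lemma gfac_symm_in_bispan:
  assumes "Suc m \<le> r"
  shows "\<iota> (gfac m 1) * symm m \<in> bispan (PH (Suc m)) (symm (Suc m))"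
proof -
  have "coset_sum m 1 = symm (Suc m)" by (simp only: coset_sum_def symm_Suc)
  moreover have "symm (Suc m) \<in> bispan (PH (Suc m)) (symm (Suc m))"
    using bispan.gen[OF PH_one PH_one, of "symm (Suc m)" "Suc m"] by simp
  ultimately show ?thesis
    using \<Lambda>s_bispan[OF assms, of 1 "coset_sum m 1"] \<Lambda>s_coset_sum[of 1 m] by simp
qed

definition lt_pairs :: "nat \<Rightarrow> (nat \<times> nat) set"
  where "lt_pairs m = {(i, j). 1 \<le> i \<and> i < j \<and> j \<le> m}"

lemma finite_lt_pairs [simp]: "finite (lt_pairs m)"
proof -
  have "lt_pairs m \<subseteq> {1..m} \<times> {1..m}" by (auto simp: lt_pairs_def)
  then show ?thesis by (rule finite_subset) simp
qed

lemma wall_prod_lt_pairs_Suc: "wall_prod q (lt_pairs (Suc m)) = gfac m 1 * wall_prod q (lt_pairs m)"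
proof -
  let ?C = "(\<lambda>i. (i, Suc m)) ` {1..m}"
  have e: "lt_pairs (Suc m) = ?C \<union> lt_pairs m"
  proof (rule Set.set_eqI)
    fix x :: "nat \<times> nat"
    obtain i j where x: "x = (i, j)" by (cases x)
    show "x \<in> lt_pairs (Suc m) \<longleftrightarrow> x \<in> ?C \<union> lt_pairs m"
      unfolding x by (cases "j = Suc m") (auto simp: lt_pairs_def image_iff)
  qed
  have d: "?C \<inter> lt_pairs m = {}" by (auto simp: lt_pairs_def)
  have "wall_prod q (lt_pairs (Suc m)) = wall_prod q ?C * wall_prod q (lt_pairs m)"
    unfolding e wall_prod_def by (rule prod.union_disjoint[OF _ _ d]) simp_all
  moreover have "wall_prod q ?C = gfac m 1"
  proof -
    have "inj_on (\<lambda>i. (i, Suc m)) {1..m}" by (simp add: inj_on_def)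
    then show ?thesis unfolding wall_prod_def gfac_def by (simp add: prod.reindex)
  qed
  ultimately show ?thesis by simp
qed

lemma PH_commute:
  assumes "\<And>i. 1 \<le> i \<Longrightarrow> i < m \<Longrightarrow> rename (adj i) g = g" "x \<in> PH m"
  shows "\<iota> g * x = x * \<iota> g"
  using assms(2)
proof induction
  case (T i)
  then show ?case using opT_\<iota>_sym[OF assms(1)] by simp
next
  case (mult x y)
  have "\<iota> g * (x * y) = (\<iota> g * x) * y" by (simp only: mult.assoc)
  also have "\<dots> = x * (\<iota> g * y)" by (simp only: mult.IH mult.assoc)
  also have "\<dots> = x * y * \<iota> g" by (simp only: mult.IH mult.assoc)
  finally show ?case .
qed (rule \<iota>_commute)

text \<open>
  Induction on \<open>m\<close>: the new factor \<open>gfac m 1\<close> is symmetric in the first \<open>m\<close> variables, so it can be moved next to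
  \<open>symm m\<close>, and their product lies in the ideal of \<open>symm (Suc m)\<close>.
\<close>

lemma wall_prod_lt_pairs_in_bispan:
  "m \<le> r \<Longrightarrow> \<iota> (wall_prod q (lt_pairs m)) \<in> bispan (PH m) (symm m)"
proof (induction m)
  case 0
  have "lt_pairs 0 = {}" by (auto simp: lt_pairs_def)
  then have "\<iota> (wall_prod q (lt_pairs 0)) = 1 * symm 0 * 1"
    by (simp add: wall_prod_def \<iota>_one symm_def)
  then show ?case using bispan.gen[OF PH_one PH_one] by simp
next
  case (Suc m)
  have g: "rename (adj i) (gfac m 1) = gfac m 1" if i: "1 \<le> i" "i < m" for i
  proof -
    have mem: "adj i \<langle>$\<rangle> k \<in> {1..m}" if "k \<in> {1..m}" for k
      using that i by (cases "k = i"; cases "k = i + 1") auto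
    have "rename (adj i) (gfac m 1) = (\<Prod>k\<in>{1..m}. wall q (adj i \<langle>$\<rangle> k) (Suc m))"
      unfolding gfac_def rename_prod by (rule prod.cong) (use i in auto)
    also have "\<dots> = (\<Prod>k\<in>{1..m}. wall q k (Suc m))"
      by (rule prod.reindex_bij_witness[of _ "apply (adj i)" "apply (adj i)"]) (use mem in simp_all)
    finally show ?thesis by (simp only: gfac_def)
  qed
  have "\<iota> (gfac m 1) * y \<in> bispan (PH (Suc m)) (symm (Suc m))" if "y \<in> bispan (PH m) (symm m)" for y
    using that
  proof induction
    case (gen u v)
    have uv: "u \<in> PH (Suc m)" "v \<in> PH (Suc m)" using gen PH_mono[of _ m "Suc m"] by auto
    have "\<iota> (gfac m 1) * u = u * \<iota> (gfac m 1)" using PH_commute[OF g gen(1)] by simp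
    then have "\<iota> (gfac m 1) * (u * symm m * v) = u * (\<iota> (gfac m 1) * symm m) * v"
      by (simp flip: mult.assoc)
    moreover have "u * (\<iota> (gfac m 1) * symm m) * v \<in> bispan (PH (Suc m)) (symm (Suc m))"
      using gfac_symm_in_bispan[of m] Suc.prems uv by (intro bispan_PH_right[OF bispan_PH_left])
    ultimately show ?case by simp
  qed (simp_all add: distrib_left bispan.zero bispan.add)
  then show ?case using Suc by (simp add: wall_prod_lt_pairs_Suc \<iota>_mult)
qed

subsection \<open>Moving the missing index\<close>

text \<open>
  For \<open>k = r\<close> these are the pairs \<open>i < j < r\<close>. Passing from \<open>k + 1\<close> to \<open>k\<close> by an intertwiner permutes the indices and
  adds the two walls between \<open>k\<close> and \<open>k + 1\<close> (\<open>pairs_step\<close>). The pair \<open>(i, j)\<close> is missing from \<open>pairs j\<close> if \<open>i < j\<close>,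
  and from \<open>pairs r\<close> if \<open>i > j\<close>.
\<close>

definition pairs :: "nat \<Rightarrow> (nat \<times> nat) set"
  where "pairs k = {(i, j). 1 \<le> i \<and> i < j \<and> j \<le> r \<and> i \<noteq> k \<and> j \<noteq> k}
    \<union> {(i, j). i = k \<and> k < j \<and> j \<le> r} \<union> {(i, j). j = k \<and> k < i \<and> i \<le> r}"

abbreviation E :: "nat \<Rightarrow> 'k laurent" where "E k \<equiv> wall_prod q (pairs k)"

lemma in_pairs_iff: "(i, j) \<in> pairs k \<longleftrightarrow>
    1 \<le> i \<and> i < j \<and> j \<le> r \<and> i \<noteq> k \<and> j \<noteq> k \<or> i = k \<and> k < j \<and> j \<le> r \<or> j = k \<and> k < i \<and> i \<le> r"
  by (simp add: pairs_def)

abbreviation square :: "(nat \<times> nat) set"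
  where "square \<equiv> {(i, j). 1 \<le> i \<and> i \<le> r \<and> 1 \<le> j \<and> j \<le> r \<and> i \<noteq> j}"

lemma pairs_bounds:
  assumes "1 \<le> k" "k \<le> r" "(i, j) \<in> pairs k"
  shows "1 \<le> i" "i \<le> r" "1 \<le> j" "j \<le> r" "i \<noteq> j"
  using assms unfolding in_pairs_iff by presburger+

lemma pairs_subset:
  assumes "1 \<le> k" "k \<le> r"
  shows "pairs k \<subseteq> square"
proof
  fix x assume x: "x \<in> pairs k"
  obtain i j where ij: "x = (i, j)" by (cases x)
  show "x \<in> square" using pairs_bounds[OF assms x[unfolded ij]] by (simp add: ij)
qed

lemma finite_square: "finite square"
proof -
  have "square \<subseteq> {1..r} \<times> {1..r}" by (intro subsetI) (simp add: case_prod_beta mem_Times_iff)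
  then show ?thesis by (rule finite_subset) simp
qed

lemma finite_pairs: "1 \<le> k \<Longrightarrow> k \<le> r \<Longrightarrow> finite (pairs k)"
  using finite_subset[OF pairs_subset finite_square] .

lemma pairs_neq: "\<forall>(i, j)\<in>pairs k. i \<noteq> j"
  by (intro ballI) (clarsimp simp: in_pairs_iff)

lemma pairs_top: "1 \<le> r \<Longrightarrow> pairs r = lt_pairs (r - 1)"
proof (rule Set.set_eqI)
  fix x :: "nat \<times> nat" assume r: "1 \<le> r"
  obtain i j where x: "x = (i, j)" by (cases x)
  show "x \<in> pairs r \<longleftrightarrow> x \<in> lt_pairs (r - 1)"
    unfolding x in_pairs_iff lt_pairs_def mem_Collect_eq prod.case using r by presburger
qed

lemma pairs_step:
  assumes "1 \<le> k" "k < r"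
  shows "pairs k = map_prod (apply (adj k)) (apply (adj k)) ` pairs (k + 1) \<union> {(k + 1, k), (k, k + 1)}"
    and "map_prod (apply (adj k)) (apply (adj k)) ` pairs (k + 1) \<inter> {(k + 1, k), (k, k + 1)} = {}"
proof -
  have inv: "adj k \<langle>$\<rangle> (adj k \<langle>$\<rangle> a) = a" for a by simp
  have val: "adj k \<langle>$\<rangle> a = (if a = k then k + 1 else if a = k + 1 then k else a)" for a by simp
  \<comment> \<open>The map is an involution, so its images are preimages.\<close>
  have mem: "(a, b) \<in> map_prod (apply (adj k)) (apply (adj k)) ` pairs (k + 1)
      \<longleftrightarrow> (adj k \<langle>$\<rangle> a, adj k \<langle>$\<rangle> b) \<in> pairs (k + 1)" for a b
  proof
    assume "(adj k \<langle>$\<rangle> a, adj k \<langle>$\<rangle> b) \<in> pairs (k + 1)"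
    then show "(a, b) \<in> map_prod (apply (adj k)) (apply (adj k)) ` pairs (k + 1)"
      by (intro image_eqI[of _ _ "(adj k \<langle>$\<rangle> a, adj k \<langle>$\<rangle> b)"]) (simp_all only: map_prod_simp inv)
  next
    assume "(a, b) \<in> map_prod (apply (adj k)) (apply (adj k)) ` pairs (k + 1)"
    then show "(adj k \<langle>$\<rangle> a, adj k \<langle>$\<rangle> b) \<in> pairs (k + 1)"
      by (auto simp only: map_prod_simp prod.inject inv)
  qed
  show "pairs k = map_prod (apply (adj k)) (apply (adj k)) ` pairs (k + 1) \<union> {(k + 1, k), (k, k + 1)}"
  proof (rule Set.set_eqI)
    fix x :: "nat \<times> nat"
    obtain a b where x: "x = (a, b)" by (cases x)
    show "x \<in> pairs k \<longleftrightarrow> x \<in> map_prod (apply (adj k)) (apply (adj k)) ` pairs (k + 1) \<union> {(k + 1, k), (k, k + 1)}"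
      unfolding x Un_iff mem val in_pairs_iff insert_iff empty_iff prod.inject using assms by (auto split: if_splits)
  qed
  show "map_prod (apply (adj k)) (apply (adj k)) ` pairs (k + 1) \<inter> {(k + 1, k), (k, k + 1)} = {}"
    proof -
    have "(k, k + 1) \<notin> map_prod (apply (adj k)) (apply (adj k)) ` pairs (k + 1)"
      "(k + 1, k) \<notin> map_prod (apply (adj k)) (apply (adj k)) ` pairs (k + 1)"
      unfolding mem val in_pairs_iff by simp_all
    then show ?thesis by (simp only: Int_insert_right if_False Int_empty_right)
  qed
qed

definition J :: "'k model set" where "J = bispan H (symm (r - 1))"

lemma J_left: "y \<in> J \<Longrightarrow> a \<in> H \<Longrightarrow> a * y \<in> J"
  unfolding J_def by (rule bispan_left) (simp_all add: H_closed)

lemma J_right: "y \<in> J \<Longrightarrow> a \<in> H \<Longrightarrow> y * a \<in> J"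
  unfolding J_def by (rule bispan_right) (simp_all add: H_closed)

lemma res_wall_prod:
  assumes "\<And>i j. (i, j) \<in> S \<Longrightarrow> 1 \<le> i \<and> i \<le> r \<and> 1 \<le> j \<and> j \<le> r"
  shows "res (wall_prod q S) = wall_prod q S"
  using assms
proof (induction S rule: infinite_finite_induct)
  case (insert x S)
  obtain i j where x: "x = (i, j)" by (cases x)
  have "res (wall q i j) = wall q i j"
    using insert.prems[of i j] by (simp add: wall_def res_diff res_mult x)
  moreover have "wall_prod q (insert x S) = wall q i j * wall_prod q S"
    using insert by (simp add: wall_prod_def x)
  moreover have "res (wall_prod q S) = wall_prod q S"
    by (rule insert.IH) (use insert.prems in blast)
  ultimately show ?case by (simp add: res_mult)
qed (simp_all add: wall_prod_def)

lemma op\<tau>_in_H: "1 \<le> i \<Longrightarrow> i < r \<Longrightarrow> op\<tau> q i \<in> H"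
  unfolding op\<tau>_eq by (intro H_closed H_\<iota>) (simp_all add: res_diff res_mult)

text \<open>
  Sandwiching \<open>E\<^sub>k\<^sub>+\<^sub>1\<close> between two intertwiners stays in the ideal and gives \<open>E\<^sub>k\<close>.
\<close>

lemma E_in_J:
  assumes "1 \<le> k" "k \<le> r"
  shows "\<iota> (E k) \<in> J"
  using assms(2,1)
proof (induction k rule: inc_induct)
  case base
  have "\<iota> (wall_prod q (lt_pairs (r - 1))) \<in> bispan (PH (r - 1)) (symm (r - 1))"
    by (rule wall_prod_lt_pairs_in_bispan) simp
  then show ?case unfolding J_def pairs_top[OF base]
    by (rule bispan_mono) (auto intro: PH_subset_H)
next
  case (step k)
  have "op\<tau> q k * \<iota> (E (Suc k)) * op\<tau> q k \<in> J"
    using step by (intro J_left J_right op\<tau>_in_H) auto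
  also have "op\<tau> q k * \<iota> (E (Suc k)) * op\<tau> q k
      = \<iota> (rename (adj k) (E (k + 1)) * (wall q (k + 1) k * wall q k (k + 1)))"
    by (simp only: op\<tau>_\<iota> op\<tau>_square \<iota>_mult mult.assoc Suc_eq_plus1)
  also have "rename (adj k) (E (k + 1)) * (wall q (k + 1) k * wall q k (k + 1)) = E k"
  proof -
    have "E k = wall_prod q (map_prod (apply (adj k)) (apply (adj k)) ` pairs (k + 1)) * wall_prod q {(k + 1, k), (k, k + 1)}"
      unfolding pairs_step(1)[OF step(4,2)] wall_prod_def
      by (rule prod.union_disjoint) (use pairs_step(2)[OF step(4,2)] step finite_pairs[of "k + 1"] in auto)
    then show ?thesis by (simp add: rename_wall_prod) (simp add: wall_prod_def)
  qed
  finally show ?case .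
qed

subsection \<open>A central element and division\<close>

definition \<Delta> :: "'k laurent"
  where "\<Delta> = wall_prod q square"

lemma \<Delta>_neq_0: "\<Delta> \<noteq> 0"
  unfolding \<Delta>_def by (rule wall_prod_neq_0[OF q_neq_0 finite_square]) auto

lemma E_neq_0: "1 \<le> k \<Longrightarrow> k \<le> r \<Longrightarrow> E k \<noteq> 0"
  by (rule wall_prod_neq_0[OF q_neq_0 finite_pairs pairs_neq])

lemma \<Delta>_in_H: "\<iota> \<Delta> \<in> H"
  unfolding \<Delta>_def by (rule H_\<iota>, rule res_wall_prod) simp

lemma res_E:
  assumes "1 \<le> k" "k \<le> r"
  shows "res (E k) = E k"
  by (rule res_wall_prod, intro conjI; rule pairs_bounds[OF assms]; assumption)

lemma E_in_H: "1 \<le> k \<Longrightarrow> k \<le> r \<Longrightarrow> \<iota> (E k) \<in> H"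
  by (rule H_\<iota>, rule res_E)

lemma \<Delta>_central:
  assumes "h \<in> H"
  shows "\<iota> \<Delta> * h = h * \<iota> \<Delta>"
proof -
  let ?S = "square"
  have "rename (adj i) \<Delta> = \<Delta>" if i: "1 \<le> i" "i < r" for i
  proof -
    let ?f = "map_prod (apply (adj i)) (apply (adj i))"
    have bounds: "1 \<le> adj i \<langle>$\<rangle> a \<and> adj i \<langle>$\<rangle> a \<le> r" if "1 \<le> a" "a \<le> r" for a
      using that i by (cases "a = i"; cases "a = i + 1") simp_all
    have ne: "adj i \<langle>$\<rangle> a \<noteq> adj i \<langle>$\<rangle> b" if "a \<noteq> b" for a b
      using that injD[OF inj_apply, of "adj i" a b] by blast
    have sub: "?f ` ?S \<subseteq> ?S"
    proof
      fix x assume "x \<in> ?f ` ?S"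
      then obtain a b where ab: "(a, b) \<in> ?S" and x: "x = (adj i \<langle>$\<rangle> a, adj i \<langle>$\<rangle> b)" by auto
      from ab have ab': "1 \<le> a" "a \<le> r" "1 \<le> b" "b \<le> r" "a \<noteq> b" by simp_all
      show "x \<in> ?S" unfolding x mem_Collect_eq prod.case
        using bounds[OF ab'(1,2)] bounds[OF ab'(3,4)] ne[OF ab'(5)] by blast
    qed
    have "?f (?f x) = x" for x by (cases x) simp
    then have "?f ` (?f ` ?S) = ?S" unfolding image_image by simp
    then have "?f ` ?S = ?S" using sub image_mono[OF sub, of ?f] by (intro subset_antisym) simp_all
    then show ?thesis by (simp only: \<Delta>_def rename_wall_prod)
  qed
  then have T: "opTw q u * \<iota> \<Delta> = \<iota> \<Delta> * opTw q u" if "u \<in> normal_words r" for u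
    using normal_words_letters[OF that] by (intro opTw_\<iota>) auto
  obtain a where h: "h = (\<Sum>u\<in>normal_words r. \<iota> (a u) * opTw q u)" using H_expand[OF assms] by blast
  have "\<iota> \<Delta> * (\<iota> (a u) * opTw q u) = \<iota> (a u) * opTw q u * \<iota> \<Delta>" if "u \<in> normal_words r" for u
    by (simp only: mult.assoc T[OF that]) (simp only: \<iota>_commute[of \<Delta>] flip: mult.assoc)
  then show ?thesis by (simp add: h sum_distrib_left sum_distrib_right)
qed

lemma \<Delta>_multiple:
  assumes "1 \<le> k" "k \<le> r"
  shows "\<exists>e\<in>H. \<iota> \<Delta> = e * \<iota> (E k)"
proof -
  let ?S = "square"
  have "\<Delta> = wall_prod q (?S - pairs k) * E k"
    unfolding \<Delta>_def wall_prod_def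
    by (rule prod.subset_diff[OF pairs_subset[OF assms] finite_square])
  then have "\<iota> \<Delta> = \<iota> (wall_prod q (?S - pairs k)) * \<iota> (E k)" by (simp only: \<iota>_mult)
  moreover have "\<iota> (wall_prod q (?S - pairs k)) \<in> H" by (rule H_\<iota>, rule res_wall_prod) simp
  ultimately show ?thesis by (rule bexI)
qed

text \<open>
  The Bernstein basis turns the equations into equations between Laurent polynomials, one family for
  each basis element, to which \<open>wall_prod_common_quotient\<close> applies.
\<close>

lemma division:
  assumes q2: "q\<^sup>2 \<noteq> 1" and r: "1 \<le> r"
    and h: "\<And>k. k \<in> {1..r} \<Longrightarrow> h k \<in> H"
    and cross: "\<And>k l. k \<in> {1..r} \<Longrightarrow> l \<in> {1..r} \<Longrightarrow> \<iota> (E l) * h k = \<iota> (E k) * h l"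
  shows "\<exists>g\<in>H. \<forall>k\<in>{1..r}. h k = \<iota> (E k) * g"
proof -
  have "\<forall>k\<in>{1..r}. \<exists>a. (\<forall>u. res (a u) = a u) \<and> h k = (\<Sum>u\<in>normal_words r. \<iota> (a u) * opTw q u)"
    using H_expand[OF h] by blast
  from bchoice[OF this] obtain a where a: "\<And>k u. k \<in> {1..r} \<Longrightarrow> res (a k u) = a k u"
    "\<And>k. k \<in> {1..r} \<Longrightarrow> h k = (\<Sum>u\<in>normal_words r. \<iota> (a k u) * opTw q u)"
    by blast
  have "\<exists>b. \<forall>k\<in>{1..r}. a k u = E k * b" if u: "u \<in> normal_words r" for u
  proof (rule wall_prod_common_quotient[OF q_neq_0 q2])
    fix k l assume kl: "k \<in> {1..r}" "l \<in> {1..r}"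
    have "(\<Sum>u\<in>normal_words r. \<iota> (E l * a k u - E k * a l u) * opTw q u) = \<iota> (E l) * h k - \<iota> (E k) * h l"
      by (simp add: a(2)[OF kl(1)] a(2)[OF kl(2)] \<iota>_diff \<iota>_mult left_diff_distrib sum_subtractf
          sum_distrib_left mult.assoc)
    also have "\<dots> = 0" by (simp add: cross[OF kl])
    finally have "E l * a k u - E k * a l u = 0"
      using opTw_independent[OF q_neq_0 _ u, of "\<lambda>u. E l * a k u - E k * a l u"] by simp
    then show "E l * a k u = E k * a l u" by simp
  next
    fix i j k assume k: "k \<in> {1..r}" and ij: "(i, j) \<in> pairs k"
    have ij: "1 \<le> i" "1 \<le> j" "i \<le> r" "j \<le> r" "i \<noteq> j" using pairs_bounds[of k i j] k ij by auto
    show "\<exists>l\<in>{1..r}. (i, j) \<notin> pairs l"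
    proof (cases "i < j")
      case True
      then have "(i, j) \<notin> pairs j" unfolding in_pairs_iff by simp
      then show ?thesis using ij by (intro bexI[of _ j]) simp_all
    next
      case False
      then have "(i, j) \<notin> pairs r" unfolding in_pairs_iff using ij by simp
      then show ?thesis using r by (intro bexI[of _ r]) simp_all
    qed
  qed (simp_all add: finite_pairs pairs_neq)
  then have "\<forall>u\<in>normal_words r. \<exists>b. \<forall>k\<in>{1..r}. a k u = E k * b" by blast
  from bchoice[OF this] obtain b
    where b: "\<And>u k. u \<in> normal_words r \<Longrightarrow> k \<in> {1..r} \<Longrightarrow> a k u = E k * b u"
    by blast
  have res: "res (b u) = b u" if u: "u \<in> normal_words r" for u
  proof -
    have "res (E r) = E r" by (rule res_E) (use r in simp_all)
    then have "E r * res (b u) = E r * b u"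
      using a(1)[of r u] b[OF u, of r] r by (simp add: res_mult)
    then show ?thesis using E_neq_0[of r] r by simp
  qed
  define g where "g = (\<Sum>u\<in>normal_words r. \<iota> (b u) * opTw q u)"
  have "g \<in> H" unfolding g_def
    by (intro H_sum H_closed H_\<iota> res H_opTw normal_words_letters) auto
  moreover have "h k = \<iota> (E k) * g" if "k \<in> {1..r}" for k
    using that by (simp add: a(2) g_def b \<iota>_mult sum_distrib_left mult.assoc)
  ultimately show ?thesis by blast
qed

end

section \<open>The affine Hecke algebra as a subring of the model\<close>

context hecke_parameters
begin

abbreviation HH :: "('k, 'k hecke) module" where "HH \<equiv> affine_hecke r q"

abbreviation HH_mult :: "'k hecke \<Rightarrow> 'k hecke \<Rightarrow> 'k hecke" (infixl "\<bullet>" 70)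
  where "x \<bullet> y \<equiv> x \<otimes>\<^bsub>HH\<^esub> y"

definition coset :: "(hecke_gen, 'k) free_alg \<Rightarrow> 'k hecke" where "coset p = I +>\<^bsub>F\<^esub> p"

lemma HH_simps:
  "carrier HH = coset ` FA"
  "p \<in> FA \<Longrightarrow> p' \<in> FA \<Longrightarrow> coset p \<bullet> coset p' = coset (p * p')"
  "p \<in> FA \<Longrightarrow> p' \<in> FA \<Longrightarrow> coset p \<oplus>\<^bsub>HH\<^esub> coset p' = coset (p + p')"
  "\<one>\<^bsub>HH\<^esub> = coset 1" "\<zero>\<^bsub>HH\<^esub> = coset 0"
  "p \<in> FA \<Longrightarrow> c \<odot>\<^bsub>HH\<^esub> coset p = coset (const c * p)"
proof -
  note defs = affine_hecke_def presented_algebra_def Let_def FactRing_def coset_def I_def[symmetric]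
  have mult: "rcoset_mult F I (I +>\<^bsub>F\<^esub> p) (I +>\<^bsub>F\<^esub> p') = I +>\<^bsub>F\<^esub> (p * p')"
    if "p \<in> FA" "p' \<in> FA" for p p'
    using I.rcoset_mult_add[OF that] by simp
  show "carrier HH = coset ` FA"
    by (auto simp: defs A_RCOSETS_def')
  show "coset p \<bullet> coset p' = coset (p * p')" if "p \<in> FA" "p' \<in> FA" for p p'
    using mult[OF that] by (simp add: defs)
  show "coset p \<oplus>\<^bsub>HH\<^esub> coset p' = coset (p + p')" if "p \<in> FA" "p' \<in> FA" for p p'
    using I.a_rcos_sum[OF that] by (simp add: defs)
  show "\<one>\<^bsub>HH\<^esub> = coset 1" by (simp add: defs)
  show "\<zero>\<^bsub>HH\<^esub> = coset 0" using I.a_rcos_const[OF I_closed(4)] by (simp add: defs)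
  show "c \<odot>\<^bsub>HH\<^esub> coset p = coset (const c * p)" if "p \<in> FA" for p
    using mult[OF closed(7) that] by (simp add: defs)
qed

lemma coset_eq_iff:
  assumes "p \<in> FA" "p' \<in> FA"
  shows "coset p = coset p' \<longleftrightarrow> \<rho> q p = \<rho> q p'"
proof -
  have "\<ominus>\<^bsub>F\<^esub> p' = - p'" by (rule F.minus_equality) (use assms in simp_all)
  then have "p \<ominus>\<^bsub>F\<^esub> p' = p - p'" by (simp add: a_minus_def)
  then have "coset p = coset p' \<longleftrightarrow> p - p' \<in> I"
    using F.quotient_eq_iff_same_a_r_cos[OF I.ideal_axioms assms] by (simp add: coset_def)
  also have "\<dots> \<longleftrightarrow> \<rho> q (p - p') = 0" using \<rho>_eq_0_iff[of "p - p'"] assms by simp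
  finally show ?thesis by (simp add: \<rho>_diff)
qed

text \<open>
  The embedding of the Hecke algebra into the operators; ring equations in the Hecke algebra are
  verified after applying it.
\<close>

definition \<Phi> :: "'k hecke \<Rightarrow> 'k model"
  where "\<Phi> x = \<rho> q (SOME p. p \<in> FA \<and> coset p = x)"

lemma \<Phi>_coset [simp]:
  assumes "p \<in> FA"
  shows "\<Phi> (coset p) = \<rho> q p"
proof -
  define p' where "p' = (SOME p'. p' \<in> FA \<and> coset p' = coset p)"
  have "p' \<in> FA \<and> coset p' = coset p"
    unfolding p'_def by (rule someI[of _ p]) (simp add: assms)
  then have "\<rho> q p' = \<rho> q p" using coset_eq_iff[OF _ assms, of p'] by simp
  then show ?thesis by (simp only: \<Phi>_def p'_def)
qed

lemma HH_cases:
  assumes "x \<in> carrier HH"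
  obtains p where "p \<in> FA" "x = coset p"
  using assms by (auto simp: HH_simps)

lemma coset_closed [simp]: "p \<in> FA \<Longrightarrow> coset p \<in> carrier HH"
  by (simp add: HH_simps)

lemma HH_closed:
  "x \<in> carrier HH \<Longrightarrow> y \<in> carrier HH \<Longrightarrow> x \<bullet> y \<in> carrier HH"
  "x \<in> carrier HH \<Longrightarrow> y \<in> carrier HH \<Longrightarrow> x \<oplus>\<^bsub>HH\<^esub> y \<in> carrier HH"
  "\<one>\<^bsub>HH\<^esub> \<in> carrier HH" "\<zero>\<^bsub>HH\<^esub> \<in> carrier HH"
  "x \<in> carrier HH \<Longrightarrow> c \<odot>\<^bsub>HH\<^esub> x \<in> carrier HH"
  by (auto elim!: HH_cases simp: HH_simps(2-))

lemma \<Phi>_simps: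
  "x \<in> carrier HH \<Longrightarrow> y \<in> carrier HH \<Longrightarrow> \<Phi> (x \<bullet> y) = \<Phi> x * \<Phi> y"
  "x \<in> carrier HH \<Longrightarrow> y \<in> carrier HH \<Longrightarrow> \<Phi> (x \<oplus>\<^bsub>HH\<^esub> y) = \<Phi> x + \<Phi> y"
  "\<Phi> \<one>\<^bsub>HH\<^esub> = 1" "\<Phi> \<zero>\<^bsub>HH\<^esub> = 0"
  by (auto elim!: HH_cases simp: HH_simps(2-) \<rho>_mult \<rho>_add \<rho>_zero)

lemma \<Phi>_smult: "x \<in> carrier HH \<Longrightarrow> \<Phi> (c \<odot>\<^bsub>HH\<^esub> x) = \<iota> (lconst c) * \<Phi> x"
  by (auto elim!: HH_cases simp: HH_simps(2-) \<rho>_mult)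

lemma \<Phi>_eq_iff:
  assumes "x \<in> carrier HH" "y \<in> carrier HH"
  shows "\<Phi> x = \<Phi> y \<longleftrightarrow> x = y"
proof -
  obtain p p' where "p \<in> FA" "x = coset p" "p' \<in> FA" "y = coset p'" using assms by (meson HH_cases)
  then show ?thesis by (simp add: coset_eq_iff)
qed

lemma \<Phi>_in_H: "x \<in> carrier HH \<Longrightarrow> \<Phi> x \<in> H"
  by (auto elim!: HH_cases simp: H_def)

lemma H_preimage:
  assumes "h \<in> H"
  obtains x where "x \<in> carrier HH" "\<Phi> x = h"
proof -
  obtain p where "p \<in> FA" "h = \<rho> q p" using assms by (auto simp: H_def)
  then show ?thesis by (intro that[of "coset p"]) (simp_all add: HH_simps)
qed

sublocale HR: ring "affine_hecke r q"
proof (rule ringI)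
  show "abelian_group HH"
  proof (rule abelian_groupI)
    fix x assume "x \<in> carrier HH"
    then obtain p where "p \<in> FA" "x = coset p" by (rule HH_cases)
    then show "\<exists>y\<in>carrier HH. y \<oplus>\<^bsub>HH\<^esub> x = \<zero>\<^bsub>HH\<^esub>"
      by (intro bexI[of _ "coset (- p)"]) (simp_all add: HH_simps)
  qed (simp_all add: HH_closed \<Phi>_simps algebra_simps flip: \<Phi>_eq_iff)
  show "monoid HH"
    by (rule monoidI) (simp_all add: HH_closed \<Phi>_simps algebra_simps flip: \<Phi>_eq_iff)
qed (simp_all add: HH_closed \<Phi>_simps algebra_simps flip: \<Phi>_eq_iff)

lemma \<Phi>_finsum:
  assumes "finite A" "f \<in> A \<rightarrow> carrier HH"
  shows "\<Phi> (finsum HH f A) = (\<Sum>a\<in>A. \<Phi> (f a))"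
  using assms
proof (induction A rule: finite_induct)
  case (insert a A)
  then have "finsum HH f A \<in> carrier HH" "f a \<in> carrier HH" by (auto intro: HR.finsum_closed)
  then show ?case using insert by (simp add: HR.finsum_insert \<Phi>_simps)
qed (simp add: \<Phi>_simps)

lemma hecke_T_perm_of_word:
  assumes u: "u \<in> normal_words r"
  shows "hecke_T r q (perm_of_word u) \<in> carrier HH" "\<Phi> (hecke_T r q (perm_of_word u)) = opTw q u"
proof -
  define v where "v = (SOME is. reduced_expression r (perm_of_word u) is)"
  have vu: "v \<sim>\<^sub>b u" unfolding v_def by (rule reduced_expression_braid_eq[OF u])
  have set: "set v \<subseteq> {1..<r}" using braid_eq_set[OF vu] normal_words_letters[OF u] by simp
  let ?f = "\<lambda>is. foldr (\<lambda>i h. hecke_elt r q (GenT i) \<bullet> h) is \<one>\<^bsub>HH\<^esub>"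
  have "?f is \<in> carrier HH \<and> \<Phi> (?f is) = opTw q is" if "set is \<subseteq> {1..<r}" for "is"
    using that
  proof (induction "is")
    case (Cons i js)
    have T: "tT i \<in> FA" using Cons.prems by simp
    have "hecke_elt r q (GenT i) = coset (tT i)" by (simp add: hecke_elt_def coset_def I_def)
    then have "hecke_elt r q (GenT i) \<in> carrier HH" "\<Phi> (hecke_elt r q (GenT i)) = opT q i"
      using T by (simp_all add: HH_simps gen_op_def)
    then show ?case using Cons by (simp add: HH_closed \<Phi>_simps)
  qed (simp add: HH_closed \<Phi>_simps)
  from this[OF set] show "hecke_T r q (perm_of_word u) \<in> carrier HH"
    "\<Phi> (hecke_T r q (perm_of_word u)) = opTw q u"
    using opTw_braid_eq[OF vu] by (simp_all add: hecke_T_def v_def)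
qed

lemma hecke_T_closed:
  assumes "w permutes {1..r}"
  shows "hecke_T r q w \<in> carrier HH"
proof -
  obtain u where "u \<in> normal_words r" "w = perm_of_word u"
    using assms perm_of_word_image[of r] by blast
  then show ?thesis using hecke_T_perm_of_word by simp
qed

lemma young_subgroup_permutes: "l \<in> compositions n r \<Longrightarrow> w \<in> young_subgroup l \<Longrightarrow> w permutes {1..r}"
  by (simp add: compositions_def young_subgroup_def)

lemma x_elt_closed:
  assumes "l \<in> compositions n r"
  shows "x_elt r q l \<in> carrier HH"
  unfolding x_elt_def
  by (rule HR.finsum_closed) (use hecke_T_closed young_subgroup_permutes[OF assms] in blast)

definition hook :: "nat \<Rightarrow> nat list" where "hook n = (r - 1) # 1 # replicate (n - 2) 0"

lemma hook_composition: "2 \<le> n \<Longrightarrow> 1 \<le> r \<Longrightarrow> hook n \<in> compositions n r"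
  by (simp add: compositions_def hook_def sum_list_replicate)

lemma young_subgroup_hook:
  assumes "2 \<le> n" "1 \<le> r"
  shows "young_subgroup (hook n) = {w. w permutes {1..r - 1}}"
proof -
  have sum: "sum_list (hook n) = r" using assms by (simp add: hook_def sum_list_replicate)
  have b0: "block (hook n) 0 = {1..r - 1}" by (simp add: block_def hook_def)
  have b1: "block (hook n) 1 = {r}" using assms by (simp add: block_def hook_def)
  have b2: "block (hook n) i = {}" if "2 \<le> i" for i
  proof -
    obtain j where i: "i = Suc (Suc j)" using \<open>2 \<le> i\<close> by (metis Suc_le_D numeral_2_eq_2 Suc_le_mono)
    have "sum_list (take k (replicate (n - 2) (0::nat))) = 0" for k
      by (simp add: sum_list_replicate)
    then show ?thesis by (simp add: block_def hook_def i sum_list_replicate)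
  qed
  show ?thesis
  proof (intro subset_antisym subsetI)
    fix w assume w: "w \<in> young_subgroup (hook n)"
    have wr: "w permutes {1..r}" using w by (simp add: young_subgroup_def sum)
    have "w ` block (hook n) 1 = block (hook n) 1"
      using w assms by (simp add: young_subgroup_def hook_def)
    then have "w ` {r} = {r}" by (simp only: b1)
    then have fx: "w r = r" by simp
    have "w permutes {1..r - 1}"
    proof (rule permutes_superset[OF wr])
      fix x assume "x \<in> {1..r} - {1..r - 1}"
      then have "x = r" by auto
      then show "w x = x" using fx by simp
    qed
    then show "w \<in> {w. w permutes {1..r - 1}}" by simp
  next
    fix w assume "w \<in> {w. w permutes {1..r - 1}}"
    then have w: "w permutes {1..r - 1}" by simp
    have "w permutes {1..r}" by (rule permutes_subset[OF w]) auto
    moreover have "w ` block (hook n) i = block (hook n) i" for i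
    proof -
      consider "i = 0" | "i = 1" | "2 \<le> i" by linarith
      then show ?thesis
      proof cases
        case 1
        then show ?thesis using permutes_image[OF w] by (simp only: b0)
      next
        case 2
        have "w r = r" by (rule permutes_not_in[OF w]) (use assms in auto)
        then show ?thesis by (simp only: 2 b1) simp
      next
        case 3
        then show ?thesis by (simp add: b2)
      qed
    qed
    ultimately show "w \<in> young_subgroup (hook n)" by (simp add: young_subgroup_def sum)
  qed
qed

lemma \<Phi>_x_hook:
  assumes "2 \<le> n" "1 \<le> r"
  shows "\<Phi> (x_elt r q (hook n)) = symm (r - 1)"
proof -
  obtain m where m: "r = Suc m" using assms by (cases r) auto
  have sub: "u \<in> normal_words r" if "u \<in> normal_words m" for u
    using normal_words_Suc_I[of "Suc m" m u] that by (simp add: m)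
  have T: "hecke_T r q w \<in> carrier HH" if "w permutes {1..m}" for w
    by (rule hecke_T_closed, rule permutes_subset[OF that]) (simp add: m)
  have "\<Phi> (x_elt r q (hook n)) = (\<Sum>w\<in>{w. w permutes {1..r - 1}}. \<Phi> (hecke_T r q w))"
    unfolding x_elt_def young_subgroup_hook[OF assms]
    by (rule \<Phi>_finsum) (use T in \<open>simp_all add: m finite_permutations\<close>)
  also have "\<dots> = (\<Sum>w\<in>{w. w permutes {1..m}}. \<Phi> (hecke_T r q w))" by (simp add: m)
  also have "\<dots> = (\<Sum>u\<in>normal_words m. \<Phi> (hecke_T r q (perm_of_word u)))"
    unfolding perm_of_word_image[symmetric] by (simp add: sum.reindex[OF inj_on_perm_of_word])
  also have "\<dots> = symm m" unfolding symm_def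
    by (rule sum.cong[OF HOL.refl]) (rule hecke_T_perm_of_word(2)[OF sub])
  finally show ?thesis by (simp add: m)
qed

end

section \<open>The double centraliser\<close>

locale hecke_tensor = hecke_parameters r q for r :: nat and q :: "'k::field" +
  fixes n :: nat
  assumes n_ge_2: "2 \<le> n" and r_ge_1: "1 \<le> r" and q_sq: "q\<^sup>2 \<noteq> 1"
begin

abbreviation L :: "nat list set" where "L \<equiv> compositions n r"
abbreviation x :: "nat list \<Rightarrow> 'k hecke" where "x l \<equiv> x_elt r q l"
abbreviation hk :: "nat list" where "hk \<equiv> hook n"
abbreviation M :: "('k hecke, nat list \<Rightarrow> 'k hecke) module" where "M \<equiv> tensor_space n r q"
abbreviation S where "S \<equiv> affine_schur n r q"
abbreviation xH :: "nat list \<Rightarrow> 'k hecke set"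
  where "xH l \<equiv> {x l \<bullet> h | h. h \<in> carrier HH}"

lemma hk_in_L: "hk \<in> L"
  by (rule hook_composition[OF n_ge_2 r_ge_1])

lemma x_closed [simp]: "l \<in> L \<Longrightarrow> x l \<in> carrier HH"
  by (rule x_elt_closed)

lemma \<Phi>_x_hk: "\<Phi> (x hk) = symm (r - 1)"
  by (rule \<Phi>_x_hook[OF n_ge_2 r_ge_1])

lemma HH_eqI: "a \<in> carrier HH \<Longrightarrow> b \<in> carrier HH \<Longrightarrow> \<Phi> a = \<Phi> b \<Longrightarrow> a = b"
  by (simp add: \<Phi>_eq_iff)

lemma M_simps:
  "carrier M = (\<Pi>\<^sub>E l\<in>L. xH l)"
  "\<zero>\<^bsub>M\<^esub> = (\<lambda>l\<in>L. \<zero>\<^bsub>HH\<^esub>)"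
  "t \<oplus>\<^bsub>M\<^esub> t' = (\<lambda>l\<in>L. t l \<oplus>\<^bsub>HH\<^esub> t' l)"
  "h \<odot>\<^bsub>M\<^esub> t = (\<lambda>l\<in>L. t l \<bullet> h)"
  by (simp_all add: tensor_space_def Let_def)

lemma xH_subset: "l \<in> L \<Longrightarrow> a \<in> xH l \<Longrightarrow> a \<in> carrier HH"
  by auto

lemma xH_closed:
  assumes l: "l \<in> L"
  shows "a \<in> xH l \<Longrightarrow> h \<in> carrier HH \<Longrightarrow> a \<bullet> h \<in> xH l"
    and "a \<in> xH l \<Longrightarrow> b \<in> xH l \<Longrightarrow> a \<oplus>\<^bsub>HH\<^esub> b \<in> xH l"
    and "\<zero>\<^bsub>HH\<^esub> \<in> xH l"
proof -
  show "a \<bullet> h \<in> xH l" if a: "a \<in> xH l" and h: "h \<in> carrier HH"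
  proof -
    obtain y where y: "a = x l \<bullet> y" "y \<in> carrier HH" using a by blast
    then have "a \<bullet> h = x l \<bullet> (y \<bullet> h)" using l h by (simp add: HR.m_assoc)
    then show ?thesis using y h by blast
  qed
  show "a \<oplus>\<^bsub>HH\<^esub> b \<in> xH l" if a: "a \<in> xH l" and b: "b \<in> xH l"
  proof -
    obtain y z where y: "a = x l \<bullet> y" "y \<in> carrier HH" "b = x l \<bullet> z" "z \<in> carrier HH"
      using a b by blast
    then have "a \<oplus>\<^bsub>HH\<^esub> b = x l \<bullet> (y \<oplus>\<^bsub>HH\<^esub> z)" using l by (simp add: HR.r_distr)
    then show ?thesis using y by blast
  qed
  have "\<zero>\<^bsub>HH\<^esub> = x l \<bullet> \<zero>\<^bsub>HH\<^esub>" using l by simp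
  then show "\<zero>\<^bsub>HH\<^esub> \<in> xH l" by blast
qed

lemma M_comp: "t \<in> carrier M \<Longrightarrow> l \<in> L \<Longrightarrow> t l \<in> xH l"
  unfolding M_simps by (rule PiE_mem)

lemma M_comp_HH: "t \<in> carrier M \<Longrightarrow> l \<in> L \<Longrightarrow> t l \<in> carrier HH"
  using M_comp xH_subset by blast

lemma M_eqI: "t \<in> carrier M \<Longrightarrow> t' \<in> carrier M \<Longrightarrow> (\<And>l. l \<in> L \<Longrightarrow> t l = t' l) \<Longrightarrow> t = t'"
  unfolding M_simps by (rule PiE_ext)

lemma M_restrictI: "(\<And>l. l \<in> L \<Longrightarrow> f l \<in> xH l) \<Longrightarrow> (\<lambda>l\<in>L. f l) \<in> carrier M"
  unfolding M_simps(1) by (rule restrict_PiE_iff[THEN iffD2]) (rule ballI)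

lemma M_closed:
  "t \<in> carrier M \<Longrightarrow> t' \<in> carrier M \<Longrightarrow> t \<oplus>\<^bsub>M\<^esub> t' \<in> carrier M"
  "t \<in> carrier M \<Longrightarrow> h \<in> carrier HH \<Longrightarrow> h \<odot>\<^bsub>M\<^esub> t \<in> carrier M"
  "\<zero>\<^bsub>M\<^esub> \<in> carrier M"
  unfolding M_simps(2-)
  by (rule M_restrictI, rule xH_closed, assumption, (rule M_comp, assumption+)+)
    (rule M_restrictI, rule xH_closed, assumption, rule M_comp, assumption+,
     rule M_restrictI, rule xH_closed, assumption)

definition single :: "nat list \<Rightarrow> 'k hecke \<Rightarrow> nat list \<Rightarrow> 'k hecke"
  where "single l z = (\<lambda>l'\<in>L. if l' = l then z else \<zero>\<^bsub>HH\<^esub>)"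

lemma single_closed: "z \<in> xH l \<Longrightarrow> single l z \<in> carrier M"
  unfolding single_def
proof (rule M_restrictI)
  fix l' assume "z \<in> xH l" "l' \<in> L"
  then show "(if l' = l then z else \<zero>\<^bsub>HH\<^esub>) \<in> xH l'"
    using xH_closed(3)[of l'] by (cases "l' = l") (simp_all only: if_True if_False simp_thms)
qed

lemma single_apply: "l' \<in> L \<Longrightarrow> single l z l' = (if l' = l then z else \<zero>\<^bsub>HH\<^esub>)"
  by (simp add: single_def)

lemma single_inject: "l \<in> L \<Longrightarrow> single l a = single l b \<Longrightarrow> a = b"
  by (drule fun_cong[of _ _ l]) (simp add: single_apply)

lemma single_add:
  assumes "a \<in> carrier HH" "b \<in> carrier HH"
  shows "single l (a \<oplus>\<^bsub>HH\<^esub> b) = single l a \<oplus>\<^bsub>M\<^esub> single l b"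
  unfolding M_simps single_def by (rule restrict_ext) (use assms in simp)

lemma single_smult:
  assumes "a \<in> carrier HH" "h \<in> carrier HH"
  shows "single l (a \<bullet> h) = h \<odot>\<^bsub>M\<^esub> single l a"
  unfolding M_simps single_def by (rule restrict_ext) (use assms in simp)

lemma schur_iff:
  "\<psi> \<in> carrier S \<longleftrightarrow> \<psi> \<in> carrier M \<rightarrow>\<^sub>E carrier M \<and>
    (\<forall>t\<in>carrier M. \<forall>t'\<in>carrier M. \<psi> (t \<oplus>\<^bsub>M\<^esub> t') = \<psi> t \<oplus>\<^bsub>M\<^esub> \<psi> t') \<and>
    (\<forall>h\<in>carrier HH. \<forall>t\<in>carrier M. \<psi> (h \<odot>\<^bsub>M\<^esub> t) = h \<odot>\<^bsub>M\<^esub> \<psi> t)"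
  by (simp add: affine_schur_def End_algebra_def)

lemma schurI:
  assumes "\<And>t. t \<in> carrier M \<Longrightarrow> f t \<in> carrier M"
    and "\<And>t t'. t \<in> carrier M \<Longrightarrow> t' \<in> carrier M \<Longrightarrow> f (t \<oplus>\<^bsub>M\<^esub> t') = f t \<oplus>\<^bsub>M\<^esub> f t'"
    and "\<And>t h. t \<in> carrier M \<Longrightarrow> h \<in> carrier HH \<Longrightarrow> f (h \<odot>\<^bsub>M\<^esub> t) = h \<odot>\<^bsub>M\<^esub> f t"
  shows "(\<lambda>t\<in>carrier M. f t) \<in> carrier S"
  unfolding schur_iff using assms by (simp add: M_closed)

text \<open>
  These elements of the Schur algebra send the summand of the hook to the one of \<open>l\<close> by left multiplication,
  and all other summands to \<open>0\<close>.
\<close>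

lemma left_mult_schur:
  assumes l: "l \<in> L" and a: "a \<in> xH l"
  shows "(\<lambda>t\<in>carrier M. single l (a \<bullet> t hk)) \<in> carrier S"
proof (rule schurI)
  note aH = xH_subset[OF l a] and hkL = hk_in_L
  fix t assume t: "t \<in> carrier M"
  note th = M_comp_HH[OF t hkL]
  show "single l (a \<bullet> t hk) \<in> carrier M"
    by (rule single_closed[OF xH_closed(1)[OF l a th]])
  show "single l (a \<bullet> (t \<oplus>\<^bsub>M\<^esub> t') hk)
      = single l (a \<bullet> t hk) \<oplus>\<^bsub>M\<^esub> single l (a \<bullet> t' hk)" if t': "t' \<in> carrier M" for t'
  proof -
    have "(t \<oplus>\<^bsub>M\<^esub> t') hk = t hk \<oplus>\<^bsub>HH\<^esub> t' hk" using hkL by (simp add: M_simps(3))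
    then show ?thesis using aH th M_comp_HH[OF t' hkL] by (simp add: HR.r_distr single_add)
  qed
  show "single l (a \<bullet> (h \<odot>\<^bsub>M\<^esub> t) hk) = h \<odot>\<^bsub>M\<^esub> single l (a \<bullet> t hk)" if h: "h \<in> carrier HH" for h
  proof -
    have "(h \<odot>\<^bsub>M\<^esub> t) hk = t hk \<bullet> h" using hkL by (simp add: M_simps(4))
    then show ?thesis using aH th h by (simp add: single_smult HR.m_assoc[symmetric])
  qed
qed

lemma projection_schur:
  assumes l: "l \<in> L"
  shows "(\<lambda>t\<in>carrier M. single l (t l)) \<in> carrier S"
proof (rule schurI)
  fix t assume t: "t \<in> carrier M"
  note tl = M_comp_HH[OF t l]
  show "single l (t l) \<in> carrier M" by (rule single_closed[OF M_comp[OF t l]])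
  show "single l ((t \<oplus>\<^bsub>M\<^esub> t') l) = single l (t l) \<oplus>\<^bsub>M\<^esub> single l (t' l)" if t': "t' \<in> carrier M" for t'
    using single_add[OF tl M_comp_HH[OF t' l]] l by (simp add: M_simps(3))
  show "single l ((h \<odot>\<^bsub>M\<^esub> t) l) = h \<odot>\<^bsub>M\<^esub> single l (t l)" if h: "h \<in> carrier HH" for h
    using single_smult[OF tl h] l by (simp add: M_simps(4))
qed

lemma M_smult_smult:
  assumes "t \<in> carrier M" "a \<in> carrier HH" "b \<in> carrier HH"
  shows "b \<odot>\<^bsub>M\<^esub> (a \<odot>\<^bsub>M\<^esub> t) = (a \<bullet> b) \<odot>\<^bsub>M\<^esub> t"
  unfolding M_simps by (rule restrict_ext) (use assms M_comp_HH in \<open>simp add: HR.m_assoc\<close>)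

lemma M_smult_add:
  assumes "t \<in> carrier M" "t' \<in> carrier M" "h \<in> carrier HH"
  shows "h \<odot>\<^bsub>M\<^esub> (t \<oplus>\<^bsub>M\<^esub> t') = h \<odot>\<^bsub>M\<^esub> t \<oplus>\<^bsub>M\<^esub> h \<odot>\<^bsub>M\<^esub> t'"
  unfolding M_simps by (rule restrict_ext) (use assms M_comp_HH in \<open>simp add: HR.l_distr\<close>)

lemma central_schur:
  assumes c: "c \<in> carrier HH" "\<And>h. h \<in> carrier HH \<Longrightarrow> c \<bullet> h = h \<bullet> c"
  shows "(\<lambda>t\<in>carrier M. c \<odot>\<^bsub>M\<^esub> t) \<in> carrier S"
  by (rule schurI) (simp_all add: M_closed c M_smult_add M_smult_smult)

subsection \<open>Injectivity\<close>

text \<open>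
  The ideal \<open>J\<close> annihilates \<open>w\<close>, and it contains a non-zero Laurent polynomial, which acts invertibly on
  functions.
\<close>

lemma x_hk_faithful:
  assumes w: "w \<in> H" and zero: "\<And>v. v \<in> H \<Longrightarrow> symm (r - 1) * v * w = 0"
  shows "w = 0"
proof -
  have "y * w = 0" if "y \<in> J" for y
    using that unfolding J_def
  proof induction
    case (gen u v)
    have "u * symm (r - 1) * v * w = u * (symm (r - 1) * v * w)" by (simp add: mult.assoc)
    then show ?case by (simp only: zero[OF gen(2)] mult_zero_right)
  qed (simp_all add: distrib_right)
  then have "\<iota> (E 1) * w = 0" using E_in_J[of 1] r_ge_1 by simp
  then show ?thesis using \<iota>_cancel E_neq_0[of 1] r_ge_1 by blast
qed

lemma right_mult_injective:
  assumes h: "h \<in> carrier HH" "h' \<in> carrier HH"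
    and eq: "\<And>t. t \<in> carrier M \<Longrightarrow> h \<odot>\<^bsub>M\<^esub> t = h' \<odot>\<^bsub>M\<^esub> t"
  shows "h = h'"
proof (rule HH_eqI[OF h])
  have "\<Phi> h - \<Phi> h' = 0"
  proof (rule x_hk_faithful)
    show "\<Phi> h - \<Phi> h' \<in> H" using h by (intro H_closed(2) \<Phi>_in_H)
    fix v assume "v \<in> H"
    then obtain y where y: "y \<in> carrier HH" "\<Phi> y = v" by (rule H_preimage)
    let ?a = "x hk \<bullet> y"
    have a: "?a \<in> xH hk" "?a \<in> carrier HH" using y hk_in_L by (blast, simp)
    have "(h \<odot>\<^bsub>M\<^esub> single hk ?a) hk = (h' \<odot>\<^bsub>M\<^esub> single hk ?a) hk"
      using eq[OF single_closed[OF a(1)]] by simp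
    then have "?a \<bullet> h = ?a \<bullet> h'" using hk_in_L by (simp add: M_simps(4) single_def)
    then have "\<Phi> (?a \<bullet> h) = \<Phi> (?a \<bullet> h')" by simp
    then have "symm (r - 1) * v * \<Phi> h = symm (r - 1) * v * \<Phi> h'"
      using y h a hk_in_L by (simp add: \<Phi>_simps \<Phi>_x_hk)
    then show "symm (r - 1) * v * (\<Phi> h - \<Phi> h') = 0" by (simp add: right_diff_distrib)
  qed
  then show "\<Phi> h = \<Phi> h'" by simp
qed

subsection \<open>Surjectivity\<close>

lemma double_centraliser:
  assumes f: "f \<in> carrier M \<rightarrow>\<^sub>E carrier M"
    and f_add: "\<And>t t'. t \<in> carrier M \<Longrightarrow> t' \<in> carrier M \<Longrightarrow> f (t \<oplus>\<^bsub>M\<^esub> t') = f t \<oplus>\<^bsub>M\<^esub> f t'"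
    and f_schur: "\<And>\<psi> t. \<psi> \<in> carrier S \<Longrightarrow> t \<in> carrier M \<Longrightarrow> f (\<psi> t) = \<psi> (f t)"
  shows "\<exists>g\<in>carrier HH. \<forall>t\<in>carrier M. f t = g \<odot>\<^bsub>M\<^esub> t"
proof -
  have f_closed: "f t \<in> carrier M" if "t \<in> carrier M" for t using f that by blast
  \<comment> \<open>The pair \<open>(d, g)\<close> is good if \<open>f\<close> replaces a right factor \<open>d\<close> by \<open>g\<close>; such \<open>d\<close> exhaust \<open>J\<close>.\<close>
  define good where "good d g \<longleftrightarrow> d \<in> carrier HH \<and> g \<in> carrier HH \<and>
    (\<forall>l\<in>L. \<forall>y\<in>carrier HH. f (single l (x l \<bullet> y \<bullet> d)) = single l (x l \<bullet> y \<bullet> g))" for d g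
  have xy: "x l \<bullet> y \<in> xH l" if "y \<in> carrier HH" for l y using that by blast
  have good_x: "\<exists>g. good (x hk \<bullet> v) g" if v: "v \<in> carrier HH" for v
  proof -
    let ?t = "single hk (x hk \<bullet> v)"
    have t: "?t \<in> carrier M" by (rule single_closed[OF xy[OF v]])
    have g: "f ?t hk \<in> carrier HH" by (rule M_comp_HH[OF f_closed[OF t] hk_in_L])
    have xv: "x hk \<bullet> v \<in> carrier HH" using v hk_in_L by simp
    have "f (single l (x l \<bullet> y \<bullet> (x hk \<bullet> v))) = single l (x l \<bullet> y \<bullet> f ?t hk)"
      if l: "l \<in> L" and y: "y \<in> carrier HH" for l y
      using f_schur[OF left_mult_schur[OF l xy[OF y]] t] t f_closed[OF t] hk_in_L
      by (simp add: single_apply)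
    then show ?thesis unfolding good_def using xv g by blast
  qed
  have good_left: "good (u \<bullet> d) (u \<bullet> g)" if "good d g" and u: "u \<in> carrier HH" for d g u
  proof -
    have d: "d \<in> carrier HH" and g: "g \<in> carrier HH" using that by (auto simp: good_def)
    have "f (single l (x l \<bullet> y \<bullet> (u \<bullet> d))) = single l (x l \<bullet> y \<bullet> (u \<bullet> g))"
      if l: "l \<in> L" and y: "y \<in> carrier HH" for l y
    proof -
      have "f (single l (x l \<bullet> (y \<bullet> u) \<bullet> d)) = single l (x l \<bullet> (y \<bullet> u) \<bullet> g)"
        using \<open>good d g\<close> l y u by (simp add: good_def)
      then show ?thesis using l y u d g by (simp add: HR.m_assoc)
    qed
    then show ?thesis unfolding good_def using d g u by simp
  qed
  have good_add: "good (d \<oplus>\<^bsub>HH\<^esub> d') (g \<oplus>\<^bsub>HH\<^esub> g')" if "good d g" "good d' g'" for d d' g g'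
  proof -
    have cl: "d \<in> carrier HH" "g \<in> carrier HH" "d' \<in> carrier HH" "g' \<in> carrier HH"
      using that by (auto simp: good_def)
    have "f (single l (x l \<bullet> y \<bullet> (d \<oplus>\<^bsub>HH\<^esub> d'))) = single l (x l \<bullet> y \<bullet> (g \<oplus>\<^bsub>HH\<^esub> g'))"
      if l: "l \<in> L" and y: "y \<in> carrier HH" for l y
    proof -
      have m: "single l (x l \<bullet> y \<bullet> z) \<in> carrier M" if "z \<in> carrier HH" for z
        by (rule single_closed[OF xH_closed(1)[OF l xy[OF y] that]])
      show ?thesis
        using \<open>good d g\<close> \<open>good d' g'\<close> l y cl f_add[OF m[OF cl(1)] m[OF cl(3)]]
        by (simp add: good_def HR.r_distr single_add)
    qed
    then show ?thesis unfolding good_def using cl by simp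
  qed
  have good_J: "\<exists>d g. good d g \<and> \<Phi> d = z" if "z \<in> J" for z
    using that unfolding J_def
  proof induction
    case (gen u v)
    obtain u' where u': "u' \<in> carrier HH" "\<Phi> u' = u" using gen(1) by (rule H_preimage)
    obtain v' where v': "v' \<in> carrier HH" "\<Phi> v' = v" using gen(2) by (rule H_preimage)
    obtain g where g: "good (x hk \<bullet> v') g" using good_x[OF v'(1)] by blast
    have "\<Phi> (u' \<bullet> (x hk \<bullet> v')) = u * symm (r - 1) * v"
      using u' v' hk_in_L by (simp add: \<Phi>_simps \<Phi>_x_hk mult.assoc)
    then show ?case using good_left[OF g u'(1)] by blast
  next
    case zero
    obtain g where g: "good (x hk \<bullet> \<zero>\<^bsub>HH\<^esub>) g" using good_x[of "\<zero>\<^bsub>HH\<^esub>"] by auto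
    moreover have "\<Phi> (x hk \<bullet> \<zero>\<^bsub>HH\<^esub>) = 0" using hk_in_L by (simp add: \<Phi>_simps)
    ultimately show ?case by blast
  next
    case (add y z)
    then obtain d g d' g' where "good d g" "\<Phi> d = y" "good d' g'" "\<Phi> d' = z" by blast
    moreover from this have "\<Phi> (d \<oplus>\<^bsub>HH\<^esub> d') = y + z" by (simp add: good_def \<Phi>_simps)
    ultimately show ?case using good_add by blast
  qed
  have "\<exists>dg. good (fst dg) (snd dg) \<and> \<Phi> (fst dg) = \<iota> (E k)" if k: "k \<in> {1..r}" for k
  proof -
    obtain d g where "good d g" "\<Phi> d = \<iota> (E k)"
      using good_J[OF E_in_J, of k] k by auto
    then show ?thesis by (intro exI[of _ "(d, g)"]) simp
  qed
  then have "\<forall>k\<in>{1..r}. \<exists>dg. good (fst dg) (snd dg) \<and> \<Phi> (fst dg) = \<iota> (E k)" by blast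
  from bchoice[OF this] obtain dg where dg: "\<And>k. k \<in> {1..r} \<Longrightarrow> good (fst (dg k)) (snd (dg k))"
    "\<And>k. k \<in> {1..r} \<Longrightarrow> \<Phi> (fst (dg k)) = \<iota> (E k)" by blast
  define d where "d k = fst (dg k)" for k
  define g where "g k = snd (dg k)" for k
  have good: "good (d k) (g k)" and \<Phi>d: "\<Phi> (d k) = \<iota> (E k)" if "k \<in> {1..r}" for k
    using dg[OF that] by (simp_all add: d_def g_def)
  have dg_cl: "d k \<in> carrier HH" "g k \<in> carrier HH" if "k \<in> {1..r}" for k
    using good[OF that] by (simp_all add: good_def)
  have goodD: "f (single l (x l \<bullet> y \<bullet> d k)) = single l (x l \<bullet> y \<bullet> g k)"
    if "k \<in> {1..r}" "l \<in> L" "y \<in> carrier HH" for k l y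
    using good[OF that(1)] that(2,3) by (simp add: good_def)

  \<comment> \<open>Both sides describe the effect of \<open>f\<close> on \<open>x y E\<^sub>k E\<^sub>l\<close>.\<close>
  have cross: "\<iota> (E l) * \<Phi> (g k) = \<iota> (E k) * \<Phi> (g l)" if k: "k \<in> {1..r}" and l: "l \<in> {1..r}" for k l
  proof -
    have "\<iota> (E l) * \<Phi> (g k) - \<iota> (E k) * \<Phi> (g l) = 0"
    proof (rule x_hk_faithful)
      show "\<iota> (E l) * \<Phi> (g k) - \<iota> (E k) * \<Phi> (g l) \<in> H"
        using k l dg_cl by (intro H_closed(2,3) E_in_H \<Phi>_in_H) auto
      fix v assume "v \<in> H"
      then obtain y where y: "y \<in> carrier HH" "\<Phi> y = v" by (rule H_preimage)
      have dd: "d l \<bullet> d k = d k \<bullet> d l"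
        by (rule HH_eqI) (use dg_cl k l in \<open>simp_all add: \<Phi>_simps \<Phi>d \<iota>_commute\<close>)
      have "single hk (x hk \<bullet> (y \<bullet> d l) \<bullet> g k) = f (single hk (x hk \<bullet> (y \<bullet> d l) \<bullet> d k))"
        using goodD[OF k hk_in_L, of "y \<bullet> d l"] y dg_cl[OF l] by simp
      also have "x hk \<bullet> (y \<bullet> d l) \<bullet> d k = x hk \<bullet> (y \<bullet> d k) \<bullet> d l"
        using y dg_cl[OF k] dg_cl[OF l] hk_in_L by (simp add: HR.m_assoc dd)
      also have "f (single hk (x hk \<bullet> (y \<bullet> d k) \<bullet> d l)) = single hk (x hk \<bullet> (y \<bullet> d k) \<bullet> g l)"
        using goodD[OF l hk_in_L, of "y \<bullet> d k"] y dg_cl[OF k] by simp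
      finally have "x hk \<bullet> (y \<bullet> d l) \<bullet> g k = x hk \<bullet> (y \<bullet> d k) \<bullet> g l"
        by (rule single_inject[OF hk_in_L])
      then have "\<Phi> (x hk \<bullet> (y \<bullet> d l) \<bullet> g k) = \<Phi> (x hk \<bullet> (y \<bullet> d k) \<bullet> g l)"
        by simp
      then have "symm (r - 1) * (v * \<iota> (E l)) * \<Phi> (g k) = symm (r - 1) * (v * \<iota> (E k)) * \<Phi> (g l)"
        using y dg_cl[OF k] dg_cl[OF l] hk_in_L by (simp add: \<Phi>_simps \<Phi>_x_hk \<Phi>d[OF k] \<Phi>d[OF l])
      then show "symm (r - 1) * v * (\<iota> (E l) * \<Phi> (g k) - \<iota> (E k) * \<Phi> (g l)) = 0"
        by (simp add: right_diff_distrib mult.assoc)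
    qed
    then show ?thesis by simp
  qed
  have "\<exists>b\<in>H. \<forall>k\<in>{1..r}. \<Phi> (g k) = \<iota> (E k) * b"
    by (rule division[OF q_sq r_ge_1 \<Phi>_in_H[OF dg_cl(2)] cross])
  then obtain b where b: "b \<in> H" "\<And>k. k \<in> {1..r} \<Longrightarrow> \<Phi> (g k) = \<iota> (E k) * b" by blast
  obtain h where h: "h \<in> carrier HH" "\<Phi> h = b" using b(1) by (rule H_preimage)
  have one: "1 \<in> {1..r}" using r_ge_1 by simp
  obtain e where e: "e \<in> H" "\<iota> \<Delta> = e * \<iota> (E 1)" using \<Delta>_multiple[of 1] r_ge_1 by auto
  obtain e' where e': "e' \<in> carrier HH" "\<Phi> e' = e" using e(1) by (rule H_preimage)
  obtain c where c: "c \<in> carrier HH" "\<Phi> c = \<iota> \<Delta>" using \<Delta>_in_H by (rule H_preimage)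
  have c_central: "c \<bullet> y = y \<bullet> c" if "y \<in> carrier HH" for y
    by (rule HH_eqI) (use that c \<Delta>_central[OF \<Phi>_in_H[OF that]] in \<open>simp_all add: \<Phi>_simps\<close>)
  have c_cancel: "a = a'" if "a \<in> carrier HH" "a' \<in> carrier HH" "a \<bullet> c = a' \<bullet> c" for a a'
  proof (rule HH_eqI[OF that(1,2)])
    have "c \<bullet> a = c \<bullet> a'" using that by (simp add: c_central)
    then have "\<Phi> (c \<bullet> a) = \<Phi> (c \<bullet> a')" by simp
    then have "\<iota> \<Delta> * (\<Phi> a - \<Phi> a') = 0" using that c by (simp add: \<Phi>_simps right_diff_distrib)
    then show "\<Phi> a = \<Phi> a'" using \<iota>_cancel[OF \<Delta>_neq_0, of "\<Phi> a - \<Phi> a'"] by simp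
  qed
  \<comment> \<open>Multiply by the central \<open>\<Delta>\<close>, a left multiple of \<open>E\<^sub>1\<close>, to reach an element on which \<open>f\<close> is known.\<close>
  have f_single: "f (single l z) = single l (z \<bullet> h)" if l: "l \<in> L" and z: "z \<in> xH l" for l z
  proof (rule M_eqI)
    obtain y where y: "z = x l \<bullet> y" "y \<in> carrier HH" using z by blast
    have sz: "single l z \<in> carrier M" by (rule single_closed[OF z])
    have zH: "z \<in> carrier HH" by (rule xH_subset[OF l z])
    show "f (single l z) \<in> carrier M" by (rule f_closed[OF sz])
    show "single l (z \<bullet> h) \<in> carrier M" by (rule single_closed[OF xH_closed(1)[OF l z h(1)]])
    have eg: "e' \<bullet> g 1 = h \<bullet> c"
    proof (rule HH_eqI)
      have "\<Phi> (e' \<bullet> g 1) = e * (\<iota> (E 1) * b)" using e' dg_cl[OF one] b(2)[OF one] by (simp add: \<Phi>_simps)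
      also have "\<dots> = b * \<iota> \<Delta>" using \<Delta>_central[OF b(1)] by (simp add: e(2) mult.assoc)
      finally show "\<Phi> (e' \<bullet> g 1) = \<Phi> (h \<bullet> c)" using h c by (simp add: \<Phi>_simps)
    qed (use e' dg_cl[OF one] h c in simp_all)
    have ed: "e' \<bullet> d 1 = c"
      by (rule HH_eqI) (use e' dg_cl[OF one] c e(2) \<Phi>d[OF one] in \<open>simp_all add: \<Phi>_simps\<close>)
    have "c \<odot>\<^bsub>M\<^esub> f (single l z) = f (c \<odot>\<^bsub>M\<^esub> single l z)"
      using f_schur[OF central_schur[OF c(1) c_central] sz] sz f_closed[OF sz] by simp
    also have "c \<odot>\<^bsub>M\<^esub> single l z = single l (x l \<bullet> (y \<bullet> e') \<bullet> d 1)"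
      using single_smult[OF zH c(1), of l] y l e' c dg_cl[OF one] by (simp add: HR.m_assoc ed[simplified])
    also have "f \<dots> = single l (x l \<bullet> (y \<bullet> e') \<bullet> g 1)"
      using y e' by (intro goodD[OF one l]) simp
    also have "\<dots> = single l (z \<bullet> h \<bullet> c)"
      using y l e' h c dg_cl[OF one] by (simp add: HR.m_assoc eg[simplified])
    also have "\<dots> = c \<odot>\<^bsub>M\<^esub> single l (z \<bullet> h)"
      using zH h c by (simp add: single_smult)
    finally have eq: "c \<odot>\<^bsub>M\<^esub> f (single l z) = c \<odot>\<^bsub>M\<^esub> single l (z \<bullet> h)" .
    fix l' assume l': "l' \<in> L"
    have "f (single l z) l' \<bullet> c = single l (z \<bullet> h) l' \<bullet> c"
      using fun_cong[OF eq, of l'] l' by (simp add: M_simps(4))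
    then show "f (single l z) l' = single l (z \<bullet> h) l'"
      by (rule c_cancel[rotated 2])
        (use M_comp_HH[OF f_closed[OF sz] l'] zH h l' in \<open>simp_all add: single_apply\<close>)
  qed
  have "f t = h \<odot>\<^bsub>M\<^esub> t" if t: "t \<in> carrier M" for t
  proof (rule M_eqI[OF f_closed[OF t] M_closed(2)[OF t h(1)]])
    fix l assume l: "l \<in> L"
    have "single l (f t l) = f (single l (t l))"
      using f_schur[OF projection_schur[OF l] t] t f_closed[OF t] by simp
    also have "\<dots> = single l (t l \<bullet> h)" by (rule f_single[OF l M_comp[OF t l]])
    finally have "f t l = t l \<bullet> h" by (rule single_inject[OF l])
    then show "f t l = (h \<odot>\<^bsub>M\<^esub> t) l" using l by (simp add: M_simps(4))
  qed
  then show ?thesis using h(1) by blast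
qed

subsection \<open>The isomorphism\<close>

abbreviation R where "R \<equiv> op_algebra (End_algebra S (evaluation_module M))"

lemma R_simps:
  "f \<in> carrier R \<longleftrightarrow> f \<in> carrier M \<rightarrow>\<^sub>E carrier M \<and>
    (\<forall>t\<in>carrier M. \<forall>t'\<in>carrier M. f (t \<oplus>\<^bsub>M\<^esub> t') = f t \<oplus>\<^bsub>M\<^esub> f t') \<and>
    (\<forall>\<psi>\<in>carrier S. \<forall>t\<in>carrier M. f (\<psi> t) = \<psi> (f t))"
  "f \<otimes>\<^bsub>R\<^esub> f' = compose (carrier M) f' f"
  "\<one>\<^bsub>R\<^esub> = (\<lambda>t\<in>carrier M. t)"
  "f \<oplus>\<^bsub>R\<^esub> f' = (\<lambda>t\<in>carrier M. f t \<oplus>\<^bsub>M\<^esub> f' t)"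
  "c \<odot>\<^bsub>R\<^esub> f = (\<lambda>t\<in>carrier M. (c \<odot>\<^bsub>S\<^esub> \<one>\<^bsub>S\<^esub>) (f t))"
  by (simp_all add: op_algebra_def End_algebra_def evaluation_module_def)

lemma xi_eq: "xi n r q h = (\<lambda>t\<in>carrier M. h \<odot>\<^bsub>M\<^esub> t)"
  by (simp add: xi_def)

lemma xi_closed:
  assumes h: "h \<in> carrier HH"
  shows "xi n r q h \<in> carrier R"
proof -
  have "\<psi> (h \<odot>\<^bsub>M\<^esub> t) = h \<odot>\<^bsub>M\<^esub> \<psi> t" "\<psi> t \<in> carrier M" if "\<psi> \<in> carrier S" "t \<in> carrier M" for \<psi> t
    using that h unfolding schur_iff by blast+
  then show ?thesis unfolding R_simps xi_eq using h by (simp add: M_closed M_smult_add)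
qed

lemma xi_iso: "xi n r q \<in> algebra_iso HH R"
proof -
  have "xi n r q \<in> ring_iso HH R"
  proof (rule ring_iso_memI)
    show "xi n r q h \<in> carrier R" if "h \<in> carrier HH" for h using xi_closed[OF that] .
    show "xi n r q (h \<bullet> h') = xi n r q h \<otimes>\<^bsub>R\<^esub> xi n r q h'"
      if "h \<in> carrier HH" "h' \<in> carrier HH" for h h'
      unfolding R_simps xi_eq compose_def
      by (rule restrict_ext) (use that in \<open>simp add: M_closed M_smult_smult\<close>)
    show "xi n r q (h \<oplus>\<^bsub>HH\<^esub> h') = xi n r q h \<oplus>\<^bsub>R\<^esub> xi n r q h'"
      if "h \<in> carrier HH" "h' \<in> carrier HH" for h h'
      unfolding R_simps xi_eq
    proof (rule restrict_ext)
      fix t assume t: "t \<in> carrier M"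
      have "(h \<oplus>\<^bsub>HH\<^esub> h') \<odot>\<^bsub>M\<^esub> t = h \<odot>\<^bsub>M\<^esub> t \<oplus>\<^bsub>M\<^esub> h' \<odot>\<^bsub>M\<^esub> t"
        unfolding M_simps by (rule restrict_ext) (use that M_comp_HH[OF t] in \<open>simp add: HR.r_distr\<close>)
      then show "(h \<oplus>\<^bsub>HH\<^esub> h') \<odot>\<^bsub>M\<^esub> t
          = (\<lambda>t\<in>carrier M. h \<odot>\<^bsub>M\<^esub> t) t \<oplus>\<^bsub>M\<^esub> (\<lambda>t\<in>carrier M. h' \<odot>\<^bsub>M\<^esub> t) t"
        using t by simp
    qed
    show "xi n r q \<one>\<^bsub>HH\<^esub> = \<one>\<^bsub>R\<^esub>"
      unfolding R_simps xi_eq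
    proof (rule restrict_ext)
      fix t assume t: "t \<in> carrier M"
      show "\<one>\<^bsub>HH\<^esub> \<odot>\<^bsub>M\<^esub> t = t"
        by (rule M_eqI[OF M_closed(2)[OF t HR.one_closed] t])
          (use M_comp_HH[OF t] in \<open>simp add: M_simps(4)\<close>)
    qed
    show "bij_betw (xi n r q) (carrier HH) (carrier R)"
    proof (rule bij_betw_imageI)
      show "inj_on (xi n r q) (carrier HH)"
      proof (rule inj_onI)
        fix h h' assume h: "h \<in> carrier HH" "h' \<in> carrier HH" and eq: "xi n r q h = xi n r q h'"
        show "h = h'"
        proof (rule right_mult_injective[OF h])
          fix t assume "t \<in> carrier M"
          then show "h \<odot>\<^bsub>M\<^esub> t = h' \<odot>\<^bsub>M\<^esub> t" using fun_cong[OF eq, of t] by (simp add: xi_eq)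
        qed
      qed
      show "xi n r q ` carrier HH = carrier R"
      proof (intro subset_antisym subsetI)
        fix f assume "f \<in> xi n r q ` carrier HH"
        then show "f \<in> carrier R" using xi_closed by blast
      next
        fix f assume "f \<in> carrier R"
        then have f: "f \<in> carrier M \<rightarrow>\<^sub>E carrier M"
          "\<And>t t'. t \<in> carrier M \<Longrightarrow> t' \<in> carrier M \<Longrightarrow> f (t \<oplus>\<^bsub>M\<^esub> t') = f t \<oplus>\<^bsub>M\<^esub> f t'"
          "\<And>\<psi> t. \<psi> \<in> carrier S \<Longrightarrow> t \<in> carrier M \<Longrightarrow> f (\<psi> t) = \<psi> (f t)"
          unfolding R_simps by blast+
        obtain g where g: "g \<in> carrier HH" "\<forall>t\<in>carrier M. f t = g \<odot>\<^bsub>M\<^esub> t"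
          using double_centraliser[OF f] by blast
        have "f = xi n r q g"
          by (rule extensionalityI[of _ "carrier M"]) (use f(1) g(2) in \<open>auto simp: xi_eq PiE_def\<close>)
        then show "f \<in> xi n r q ` carrier HH" using g(1) by blast
      qed
    qed
  qed
  moreover have "xi n r q (c \<odot>\<^bsub>HH\<^esub> h) = c \<odot>\<^bsub>R\<^esub> xi n r q h" if h: "h \<in> carrier HH" for c h
  proof -
    have c1: "c \<odot>\<^bsub>HH\<^esub> \<one>\<^bsub>HH\<^esub> \<in> carrier HH" by (intro HH_closed)
    \<comment> \<open>Scalars act on the tensor space from the right, as multiples of the unit, and these are central.\<close>
    have ch: "c \<odot>\<^bsub>HH\<^esub> h = h \<bullet> (c \<odot>\<^bsub>HH\<^esub> \<one>\<^bsub>HH\<^esub>)"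
    proof (rule HH_eqI)
      obtain p where p: "p \<in> FA" "h = coset p" using h by (rule HH_cases)
      have "\<Phi> h * \<iota> (lconst c) = \<iota> (lconst c) * \<Phi> h"
        using p arg_cong[OF const_commute[of c p], of "\<rho> q"] by (simp add: \<rho>_mult)
      then show "\<Phi> (c \<odot>\<^bsub>HH\<^esub> h) = \<Phi> (h \<bullet> (c \<odot>\<^bsub>HH\<^esub> \<one>\<^bsub>HH\<^esub>))"
        using h c1 by (simp add: \<Phi>_smult \<Phi>_simps)
    qed (use h c1 in \<open>simp_all add: HH_closed\<close>)
    have cS: "(c \<odot>\<^bsub>S\<^esub> \<one>\<^bsub>S\<^esub>) t = (c \<odot>\<^bsub>HH\<^esub> \<one>\<^bsub>HH\<^esub>) \<odot>\<^bsub>M\<^esub> t" if "t \<in> carrier M" for t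
      using that by (simp add: affine_schur_def End_algebra_def)
    show ?thesis unfolding R_simps xi_eq
      by (rule restrict_ext) (use h c1 in \<open>simp add: cS M_closed M_smult_smult ch\<close>)
  qed
  ultimately show ?thesis by (simp add: algebra_iso_def)
qed

end

theorem theorem6p8:
  fixes \<epsilon> :: "'k::field_char_0" and n r :: nat
  assumes "\<epsilon> \<noteq> 0"
    and "\<forall>m>0. \<epsilon> ^ m \<noteq> 1"
    and "n \<ge> 2"
    and "r \<ge> 1"
  shows "xi n r (\<epsilon>\<^sup>2) \<in>
    algebra_iso (affine_hecke r (\<epsilon>\<^sup>2))
      (op_algebra
        (End_algebra (affine_schur n r (\<epsilon>\<^sup>2)) (evaluation_module (tensor_space n r (\<epsilon>\<^sup>2)))))"
proof -
  have "(\<epsilon>\<^sup>2)\<^sup>2 = \<epsilon> ^ 4" by (simp flip: power_mult)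
  then have "(\<epsilon>\<^sup>2)\<^sup>2 \<noteq> 1" using assms(2) by simp
  then interpret hecke_tensor r "\<epsilon>\<^sup>2" n
    by unfold_locales (use assms in simp_all)
  show ?thesis by (rule xi_iso)
qed

end
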